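(* Let $n\ge 1$, $s>0$, $1<p<\infty$ and $\lambda>1$. (i) (Local compactness.) Let $\Omega\subset\mathbb R^n$ be a bounded Lipschitz domain and assume that $n=2sp$. Then the restriction to $\Omega$ yields the compact embedding $$\mathcal{L}^{p}_{s+\ln,\lambda}(\mathbb R^n)\hookrightarrow\hookrightarrow C(\overline{\Omega}).$$ Consequently, the embeddings $\mathcal{L}^{p}_{s+\ln,\lambda}(\mathbb R^n)\hookrightarrow\hookrightarrow L^q(\Omega)$ are compact for all $1\le q\le\infty$. (ii) (Global radial compactness.) Assume $n\ge2$ and $n=2sp$. Then the embedding $$\mathcal{L}^{p}_{s+\ln,\lambda,\mathrm{rad}}(\mathbb R^n)\hookrightarrow\hookrightarrow C_0(\mathbb R^n)$$ is compact. Consequently, the embeddings $\mathcal{L}^{p}_{s+\ln,\lambda,\mathrm{rad}}(\mathbb R^n)\hookrightarrow\hookrightarrow L^q(\mathbb R^n)$ are compact for all $p<q\le\infty$.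
   Context: The Fourier transform is $\widehat u(\xi)=\int_{\mathbb{R}^n}u(x)e^{-2\pi i x\cdot\xi}\,dx$, extended to $\mathcal S'(\mathbb R^n)$. For $s>0$, $\lambda>1$, $(\lambda I-\Delta)^{s+\ln}$ is the Fourier multiplier on $\mathcal S'(\mathbb R^n)$ with symbol $(\lambda+4\pi^2|\xi|^2)^s\ln(\lambda+4\pi^2|\xi|^2)$, and $\mathcal L^{p}_{s+\ln,\lambda}(\mathbb R^n)=\{u\in\mathcal S'(\mathbb R^n):(\lambda I-\Delta)^{s+\ln}u\in L^p(\mathbb R^n)\}$ with norm $\|u\|_{\mathcal L^{p}_{s+\ln,\lambda}}=\|(\lambda I-\Delta)^{s+\ln}u\|_{L^p}$. $\mathcal{L}^{p}_{s+\ln,\lambda,\mathrm{rad}}(\mathbb R^n)$ is its closed subspace of radially symmetric functions. $C_0(\mathbb R^n)$ is the space of continuous functions vanishing at infinity with the supremum norm. The symbol $\hookrightarrow\hookrightarrow$ denotes a compact embedding (bounded sequences have images with convergent subsequences in the target norm). *)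

theory Defs
  imports "HOL-Analysis.Analysis" "HOL-Probability.Essential_Supremum"
begin

section \<open>Schwartz functions and tempered distributions\<close>

definition partial_deriv :: "'n::finite \<Rightarrow> (real^'n \<Rightarrow> complex) \<Rightarrow> real^'n \<Rightarrow> complex" where
  "partial_deriv i f x = frechet_derivative f (at x) (axis i 1)"

text \<open>A list of coordinate indices plays the role of a multi-index.\<close>

definition iter_partial :: "'n::finite list \<Rightarrow> (real^'n \<Rightarrow> complex) \<Rightarrow> real^'n \<Rightarrow> complex" where
  "iter_partial \<alpha> f = foldr partial_deriv \<alpha> f"

definition schwartz :: "(real^'n::finite \<Rightarrow> complex) set" where
  "schwartz = {\<phi>. (\<forall>\<alpha> x. iter_partial \<alpha> \<phi> differentiable (at x)) \<and>
                  (\<forall>k \<alpha>. bounded (range (\<lambda>x. (1 + norm x) ^ k *\<^sub>R iter_partial \<alpha> \<phi> x)))}"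

definition schwartz_seminorm :: "nat \<Rightarrow> (real^'n::finite \<Rightarrow> complex) \<Rightarrow> real" where
  "schwartz_seminorm N \<phi> =
     (\<Sum>\<alpha> | length \<alpha> \<le> N. SUP x. (1 + norm x) ^ N * norm (iter_partial \<alpha> \<phi> x))"

text \<open>
  A tempered distribution is a linear functional on the Schwartz space that is continuous, i.e.
  bounded by one of the (increasing) seminorms above. It is undefined outside the Schwartz space,
  so that equality of functionals is equality of distributions.
\<close>

type_synonym 'n distrib = "(real^'n \<Rightarrow> complex) \<Rightarrow> complex"

definition tempered :: "'n::finite distrib set" where
  "tempered = {u \<in> extensional schwartz.
     (\<forall>\<phi>\<in>schwartz. \<forall>\<psi>\<in>schwartz. u (\<lambda>x. \<phi> x + \<psi> x) = u \<phi> + u \<psi>) \<and>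
     (\<forall>c. \<forall>\<phi>\<in>schwartz. u (\<lambda>x. c * \<phi> x) = c * u \<phi>) \<and>
     (\<exists>C N. \<forall>\<phi>\<in>schwartz. norm (u \<phi>) \<le> C * schwartz_seminorm N \<phi>)}"

text \<open>The distribution \<open>u\<close> is (given by integration against) the function \<open>f\<close>.\<close>

definition is_function :: "'n::finite distrib \<Rightarrow> (real^'n \<Rightarrow> complex) \<Rightarrow> bool" where
  "is_function u f \<longleftrightarrow> f \<in> borel_measurable lborel \<and>
     (\<forall>\<phi>\<in>schwartz. integrable lborel (\<lambda>x. f x * \<phi> x)) \<and>
     u = (\<lambda>\<phi>\<in>schwartz. LINT x|lborel. f x * \<phi> x)"


section \<open>Fourier transform and Fourier multipliers\<close>

definition fourier :: "(real^'n::finite \<Rightarrow> complex) \<Rightarrow> real^'n \<Rightarrow> complex" where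
  "fourier f \<xi> = (LINT x|lborel. f x * cis (- 2 * pi * (x \<bullet> \<xi>)))"

definition inv_fourier :: "(real^'n::finite \<Rightarrow> complex) \<Rightarrow> real^'n \<Rightarrow> complex" where
  "inv_fourier f x = (LINT \<xi>|lborel. f \<xi> * cis (2 * pi * (x \<bullet> \<xi>)))"

definition distrib_fourier :: "'n::finite distrib \<Rightarrow> 'n distrib" where
  "distrib_fourier u = (\<lambda>\<phi>\<in>schwartz. u (fourier \<phi>))"

definition distrib_inv_fourier :: "'n::finite distrib \<Rightarrow> 'n distrib" where
  "distrib_inv_fourier u = (\<lambda>\<phi>\<in>schwartz. u (inv_fourier \<phi>))"

text \<open>Meaningful for smooth \<open>m\<close> all of whose derivatives grow at most polynomially.\<close>

definition distrib_mult :: "(real^'n::finite \<Rightarrow> complex) \<Rightarrow> 'n distrib \<Rightarrow> 'n distrib" where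
  "distrib_mult m u = (\<lambda>\<phi>\<in>schwartz. u (\<lambda>\<xi>. m \<xi> * \<phi> \<xi>))"

definition fourier_multiplier :: "(real^'n::finite \<Rightarrow> complex) \<Rightarrow> 'n distrib \<Rightarrow> 'n distrib" where
  "fourier_multiplier m u = distrib_inv_fourier (distrib_mult m (distrib_fourier u))"

definition log_symbol :: "real \<Rightarrow> real \<Rightarrow> real^'n::finite \<Rightarrow> complex" where
  "log_symbol s lam \<xi> = complex_of_real
     ((lam + 4 * pi\<^sup>2 * (norm \<xi>)\<^sup>2) powr s * ln (lam + 4 * pi\<^sup>2 * (norm \<xi>)\<^sup>2))"

definition log_op :: "real \<Rightarrow> real \<Rightarrow> 'n::finite distrib \<Rightarrow> 'n distrib" where
  "log_op s lam u = fourier_multiplier (log_symbol s lam) u"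


section \<open>Function spaces\<close>

text \<open>
  Spaces of functions are sets of functions together with a (semi)norm; in the Lebesgue spaces,
  functions that agree almost everywhere are at distance 0. The exponent ranges over \<open>[1, \<infinity>]\<close>.
\<close>

definition Lp_space :: "ennreal \<Rightarrow> 'a measure \<Rightarrow> ('a \<Rightarrow> complex) set" where
  "Lp_space q M = {f \<in> borel_measurable M.
     if q = \<infinity> then esssup M (\<lambda>x. ereal (norm (f x))) < \<infinity>
     else integrable M (\<lambda>x. norm (f x) powr enn2real q)}"

definition Lp_norm :: "ennreal \<Rightarrow> 'a measure \<Rightarrow> ('a \<Rightarrow> complex) \<Rightarrow> real" where
  "Lp_norm q M f =
     (if q = \<infinity> then real_of_ereal (esssup M (\<lambda>x. ereal (norm (f x))))
      else (LINT x|M. norm (f x) powr enn2real q) powr (1 / enn2real q))"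

definition cont_space :: "'a::topological_space set \<Rightarrow> ('a \<Rightarrow> complex) set" where
  "cont_space K = {f. continuous_on K f}"

definition C0_space :: "('a::real_normed_vector \<Rightarrow> complex) set" where
  "C0_space = {f. continuous_on UNIV f \<and> (f \<longlongrightarrow> 0) at_infinity}"

definition sup_norm :: "'a set \<Rightarrow> ('a \<Rightarrow> complex) \<Rightarrow> real" where
  "sup_norm K f = (SUP x\<in>K. norm (f x))"

definition log_space :: "real \<Rightarrow> real \<Rightarrow> real \<Rightarrow> 'n::finite distrib set" where
  "log_space p s lam =
     {u \<in> tempered. \<exists>g \<in> Lp_space (ennreal p) lborel. is_function (log_op s lam u) g}"

text \<open>The choice of the representative is immaterial, being unique up to null sets.\<close>

definition log_norm :: "real \<Rightarrow> real \<Rightarrow> real \<Rightarrow> 'n::finite distrib \<Rightarrow> real" where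
  "log_norm p s lam u = Lp_norm (ennreal p) lborel
     (SOME g. g \<in> Lp_space (ennreal p) lborel \<and> is_function (log_op s lam u) g)"

definition log_space_rad :: "real \<Rightarrow> real \<Rightarrow> real \<Rightarrow> 'n::finite distrib set" where
  "log_space_rad p s lam =
     {u \<in> log_space p s lam. \<exists>f. is_function u f \<and> (\<forall>x y. norm x = norm y \<longrightarrow> f x = f y)}"


section \<open>Lipschitz domains\<close>

text \<open>
  Near each boundary point the set is, in suitable Cartesian coordinates, the region above the
  graph of a Lipschitz function: \<open>e\<close> is the vertical direction and the hyperplane orthogonal to
  \<open>e\<close> carries the remaining \<open>n - 1\<close> coordinates.
\<close>

definition lipschitz_domain :: "'a::euclidean_space set \<Rightarrow> bool" where
  "lipschitz_domain \<Omega> \<longleftrightarrow> open \<Omega> \<and> connected \<Omega> \<and> \<Omega> \<noteq> {} \<and>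
     (\<forall>z \<in> frontier \<Omega>. \<exists>r>0. \<exists>e L \<gamma>. norm e = 1 \<and> L-lipschitz_on {y. y \<bullet> e = 0} \<gamma> \<and>
        \<Omega> \<inter> ball z r = {x \<in> ball z r. \<gamma> (x - (x \<bullet> e) *\<^sub>R e) < x \<bullet> e})"


section \<open>Compact embeddings\<close>

text \<open>The function \<open>f\<close> is, up to a null set, the restriction to \<open>\<Omega>\<close> of \<open>u\<close>.\<close>

definition restricts_to ::
    "(real^'n::finite) set \<Rightarrow> 'n distrib \<Rightarrow> (real^'n \<Rightarrow> complex) \<Rightarrow> bool" where
  "restricts_to \<Omega> u f \<longleftrightarrow> (\<exists>F. is_function u F \<and> (AE x in lborel. x \<in> \<Omega> \<longrightarrow> f x = F x))"

text \<open>
  The embedding is given as a relation \<open>R\<close>, since the image of an element is a function determined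
  only up to functions of norm 0. The three clauses: \<open>X\<close> is mapped into \<open>Y\<close>, boundedly, and images
  of bounded sequences have convergent subsequences.
\<close>

definition compact_embedding ::
    "'u set \<Rightarrow> ('u \<Rightarrow> real) \<Rightarrow> ('u \<Rightarrow> ('a \<Rightarrow> complex) \<Rightarrow> bool) \<Rightarrow>
     ('a \<Rightarrow> complex) set \<Rightarrow> (('a \<Rightarrow> complex) \<Rightarrow> real) \<Rightarrow> bool" where
  "compact_embedding X norm_X R Y norm_Y \<longleftrightarrow>
     (\<forall>u\<in>X. \<exists>f\<in>Y. R u f) \<and>
     (\<exists>C. \<forall>u\<in>X. \<forall>f\<in>Y. R u f \<longrightarrow> norm_Y f \<le> C * norm_X u) \<and>
     (\<forall>u f. (\<forall>k. u k \<in> X \<and> f k \<in> Y \<and> R (u k) (f k)) \<and> (\<exists>B. \<forall>k. norm_X (u k) \<le> B) \<longrightarrow>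
        (\<exists>r g. strict_mono (r :: nat \<Rightarrow> nat) \<and> g \<in> Y \<and>
               (\<lambda>k. norm_Y (\<lambda>x. f (r k) x - g x)) \<longlonglongrightarrow> 0))"

end

theory Submission
  imports Defs "HOL-Probability.Probability" "HOL-Complex_Analysis.Great_Picard"
begin

text \<open>
  Write \<open>a = lam + 4 \<pi>\<^sup>2 |\<xi>|\<^sup>2 > 1\<close>. The inverse of the symbol is a mixture of negative powers of \<open>a\<close>,
  and each of these is a mixture of Gaussians in \<open>\<xi>\<close>:
  \<open>a powr -s / ln a = \<integral> a powr -t dt\<close> over \<open>t \<ge> s\<close>, and
  \<open>a powr -t = \<integral> r powr (t-1) / Gamma t * exp (- a r) dr\<close> over \<open>r > 0\<close>. So the inverse symbol is the
  Fourier transform of \<open>K x = \<integral> heat r x d\<mu>(r)\<close> for a finite measure \<open>\<mu>\<close>; this \<open>K\<close> is \<open>log_kernel\<close>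
  and \<open>\<mu>\<close> is \<open>laplace_measure\<close>. It is a positive integrable radial function, continuous off the
  origin. Testing the equation for \<open>u\<close> with \<open>K * \<psi>\<close> shows that every \<open>u\<close> in the space is the
  convolution \<open>K * g\<close> with \<open>g = log_op s lam u\<close> in \<open>L^p\<close> (\<open>log_space_representation\<close>).

  The logarithm is what puts \<open>K\<close> in \<open>L^q\<close> for the conjugate exponent \<open>q = p / (p - 1)\<close> when
  \<open>n = 2 s p\<close> (\<open>log_kernel_Lq\<close>): near the origin \<open>K x\<close> is of order \<open>|x| powr (- n / q) / ln (1 / |x|)\<close>,
  and \<open>\<integral> dr / (r ln (1/r) powr q)\<close> converges at 0 since \<open>q > 1\<close>; without the logarithm it would
  diverge. By Hoelder's inequality and the continuity of translations in \<open>L^q\<close>, the functions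
  \<open>K * g\<close> with \<open>g\<close> in a ball of \<open>L^p\<close> are uniformly bounded and uniformly equicontinuous
  (\<open>norm_conv_le\<close>, \<open>equicontinuous_conv\<close>), so the Arzela-Ascoli theorem gives compactness in
  \<open>C (closure \<Omega>)\<close>, and hence in \<open>L^q (\<Omega>)\<close>, for bounded \<open>\<Omega>\<close>.

  On the whole space mass could escape to infinity, and radial symmetry prevents this. By Young's
  inequality the functions \<open>K * g\<close> are also bounded in \<open>L^p\<close>. If such a radial function has modulus
  at least \<open>e\<close> at distance \<open>R\<close> from the origin, then by equicontinuity it exceeds \<open>e / 2\<close> on every ball of
  some fixed radius centred on the sphere of radius \<open>R\<close>. For \<open>n \<ge> 2\<close> the number of disjoint balls of
  this kind grows with \<open>R\<close>, so the bound in \<open>L^p\<close> bounds \<open>R\<close> (\<open>radial_uniform_decay\<close>). Hence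
  subsequences that converge locally uniformly converge uniformly, and \<open>|f|^q \<le> (sup |f|)^(q-p) |f|^p\<close>
  turns uniform convergence into convergence in \<open>L^q\<close> for \<open>q > p\<close>.
\<close>

section \<open>Rapid decay and Schwartz functions\<close>

definition rapid :: "(real^'n::finite \<Rightarrow> complex) \<Rightarrow> bool" where
  "rapid f \<longleftrightarrow> (\<forall>k. \<exists>C. \<forall>x. (1 + norm x) ^ k * norm (f x) \<le> C)"

lemma bounded_weighted_range_iff:
  "bounded (range (\<lambda>x. (1 + norm x) ^ k *\<^sub>R f x)) \<longleftrightarrow>
     (\<exists>C. \<forall>x::real^'n::finite. (1 + norm x) ^ k * norm (f x :: complex) \<le> C)"
  by (simp add: bounded_iff)

text \<open>
  The Schwartz space is the largest class of differentiable, rapidly decreasing functions that is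
  closed under partial derivatives. Membership is thus shown by exhibiting such a class, and no
  iterated derivative ever has to be computed.
\<close>

lemma schwartz_coinduct:
  assumes "X f"
    and diff: "\<And>f x. X f \<Longrightarrow> f differentiable (at x)"
    and part: "\<And>f i. X f \<Longrightarrow> X (partial_deriv i f)"
    and rapid: "\<And>f. X f \<Longrightarrow> rapid f"
  shows "f \<in> schwartz"
proof -
  have X: "X (iter_partial \<alpha> f)" for \<alpha>
    by (induction \<alpha>) (use \<open>X f\<close> part in \<open>auto simp: iter_partial_def\<close>)
  show ?thesis
    unfolding schwartz_def bounded_weighted_range_iff
    using diff[OF X] rapid[OF X] by (auto simp: rapid_def)
qed

lemma partial_deriv_schwartz: "f \<in> schwartz \<Longrightarrow> partial_deriv i f \<in> schwartz"
proof -
  have "iter_partial \<alpha> (partial_deriv i f) = iter_partial (\<alpha> @ [i]) f" for \<alpha>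
    by (simp add: iter_partial_def)
  then show "f \<in> schwartz \<Longrightarrow> partial_deriv i f \<in> schwartz"
    by (auto simp: schwartz_def)
qed

lemma schwartz_differentiable: "f \<in> schwartz \<Longrightarrow> f differentiable (at x)"
  unfolding schwartz_def by (auto dest!: spec[of _ "[]"] simp: iter_partial_def)

lemma schwartz_rapid: "f \<in> schwartz \<Longrightarrow> rapid f"
  unfolding schwartz_def bounded_weighted_range_iff rapid_def mem_Collect_eq
  by (metis iter_partial_def foldr.simps(1) id_apply)

lemma partial_deriv_eqI:
  "(f has_derivative f') (at x) \<Longrightarrow> partial_deriv i f x = f' (axis i 1)"
  by (simp add: partial_deriv_def frechet_derivative_at[symmetric])

lemma partial_deriv_add:
  assumes "\<And>x. f differentiable (at x)" "\<And>x. g differentiable (at x)"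
  shows "partial_deriv i (\<lambda>x. f x + g x) = (\<lambda>x. partial_deriv i f x + partial_deriv i g x)"
proof
  fix x
  from assms obtain f' g' where "(f has_derivative f') (at x)" "(g has_derivative g') (at x)"
    unfolding differentiable_def by blast
  then show "partial_deriv i (\<lambda>x. f x + g x) x = partial_deriv i f x + partial_deriv i g x"
    by (simp add: partial_deriv_eqI[OF has_derivative_add] partial_deriv_eqI)
qed

lemma partial_deriv_mult:
  assumes "\<And>x. f differentiable (at x)" "\<And>x. g differentiable (at x)"
  shows "partial_deriv i (\<lambda>x. f x * g x) = (\<lambda>x. partial_deriv i f x * g x + f x * partial_deriv i g x)"
proof
  fix x
  from assms obtain f' g' where "(f has_derivative f') (at x)" "(g has_derivative g') (at x)"
    unfolding differentiable_def by blast
  then show "partial_deriv i (\<lambda>x. f x * g x) x = partial_deriv i f x * g x + f x * partial_deriv i g x"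
    by (simp add: partial_deriv_eqI[OF has_derivative_mult] partial_deriv_eqI)
qed

lemma partial_deriv_of_real:
  fixes f :: "real^'n::finite \<Rightarrow> real"
  assumes "\<And>x. (f has_derivative f' x) (at x)"
  shows "partial_deriv i (\<lambda>x. complex_of_real (f x)) = (\<lambda>x. of_real (f' x (axis i 1)))"
  using assms by (intro ext partial_deriv_eqI has_derivative_of_real)

lemma rapid_add:
  assumes "rapid f" "rapid g" shows "rapid (\<lambda>x. f x + g x)"
  unfolding rapid_def
proof
  fix k
  from assms obtain C D where
    "\<And>x. (1 + norm x) ^ k * norm (f x) \<le> C" "\<And>x. (1 + norm x) ^ k * norm (g x) \<le> D"
    unfolding rapid_def by meson
  then have "(1 + norm x) ^ k * norm (f x + g x) \<le> C + D" for x
    using mult_left_mono[OF norm_triangle_ineq[of "f x" "g x"], of "(1 + norm x) ^ k"]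
    by (smt (verit) distrib_left norm_ge_zero zero_le_power)
  then show "\<exists>C. \<forall>x. (1 + norm x) ^ k * norm (f x + g x) \<le> C" by blast
qed

lemma one_le_one_plus_norm_power:
  fixes x :: "real^'n::finite"
  shows "1 \<le> (1 + norm x) ^ k"
  by (simp add: one_le_power)

lemma rapid_mult:
  assumes P: "\<And>x. norm (P x) \<le> C * (1 + norm x) ^ N" and "rapid f"
  shows "rapid (\<lambda>x. P x * f x)"
  unfolding rapid_def
proof
  fix k
  from assms obtain D where D: "\<And>x. (1 + norm x) ^ (k + N) * norm (f x) \<le> D"
    unfolding rapid_def by meson
  have "0 \<le> C" using order_trans[OF norm_ge_zero P[of 0]] by simp
  have "(1 + norm x) ^ k * norm (P x * f x) \<le> C * D" for x
  proof -
    have "(1 + norm x) ^ k * norm (P x * f x) \<le> (1 + norm x) ^ k * ((C * (1 + norm x) ^ N) * norm (f x))"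
      unfolding norm_mult by (intro mult_left_mono mult_right_mono P) auto
    also have "\<dots> = C * ((1 + norm x) ^ (k + N) * norm (f x))"
      by (simp add: power_add algebra_simps)
    also have "\<dots> \<le> C * D" by (intro mult_left_mono D \<open>0 \<le> C\<close>)
    finally show ?thesis .
  qed
  then show "\<exists>C. \<forall>x. (1 + norm x) ^ k * norm (P x * f x) \<le> C" by blast
qed

section \<open>Slowly increasing multipliers\<close>

abbreviation (input) bracket :: "real \<Rightarrow> real^'n::finite \<Rightarrow> real" where
  "bracket lam x \<equiv> lam + 4 * pi\<^sup>2 * (norm x)\<^sup>2"

text \<open>
  Multiplication by a smooth function preserves the Schwartz space if all its derivatives have
  polynomial growth. Instead of
  bounding all derivatives of a given symbol, one generates a class that contains the symbol and its
  inverse, the characters and the translated Gaussians, with enough further functions to be closed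
  under partial derivatives.
\<close>

inductive_set slow :: "(real^'n::finite \<Rightarrow> complex) set" where
  const: "(\<lambda>x. c) \<in> slow"
| coord: "(\<lambda>x. of_real (x $ i)) \<in> slow"
| powr: "1 < lam \<Longrightarrow> (\<lambda>x. of_real (bracket lam x powr t)) \<in> slow"
| ln: "1 < lam \<Longrightarrow> (\<lambda>x. of_real (ln (bracket lam x))) \<in> slow"
| inverse_ln: "1 < lam \<Longrightarrow> (\<lambda>x. of_real (1 / ln (bracket lam x))) \<in> slow"
| gauss: "0 \<le> c \<Longrightarrow> (\<lambda>x. of_real (exp (- c * (norm (x - a))\<^sup>2))) \<in> slow"
| cis: "(\<lambda>x. cis (x \<bullet> a)) \<in> slow"
| add: "P \<in> slow \<Longrightarrow> Q \<in> slow \<Longrightarrow> (\<lambda>x. P x + Q x) \<in> slow"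
| mult: "P \<in> slow \<Longrightarrow> Q \<in> slow \<Longrightarrow> (\<lambda>x. P x * Q x) \<in> slow"

lemma bracket_gt_1: "1 < lam \<Longrightarrow> 1 < bracket lam x"
  by (smt (verit) mult_nonneg_nonneg zero_le_power2)

lemma bracket_derivative:
  "((\<lambda>x. bracket lam x) has_derivative (\<lambda>h. 8 * pi\<^sup>2 * (x \<bullet> h))) (at x)"
  unfolding power2_norm_eq_inner
  by (auto intro!: derivative_eq_intros simp: inner_commute)

text \<open>
  Only first derivatives of the generators need to be computed: closure under \<open>partial_deriv\<close>
  supplies all the others, and their growth.
\<close>

lemma slow_props:
  fixes P :: "real^'n::finite \<Rightarrow> complex"
  assumes "P \<in> slow"
  shows "(\<forall>x. P differentiable (at x)) \<and> (\<forall>i. partial_deriv i P \<in> slow) \<and>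
         (\<exists>C N. \<forall>x. norm (P x) \<le> C * (1 + norm x) ^ N)"
  using assms
proof induction
  case (const c)
  have "partial_deriv i (\<lambda>x. c) = (\<lambda>x. 0)" for i :: 'n
    by (rule ext, rule partial_deriv_eqI[OF has_derivative_const])
  then show ?case using slow.const[of 0]
    by (intro conjI allI exI[of _ "norm c"] exI[of _ 0]) auto
next
  case (coord i)
  have d: "((\<lambda>x. x $ i) has_derivative (\<lambda>h. h $ i)) (at x)" for x :: "real^'n"
    by (rule bounded_linear.has_derivative[OF bounded_linear_vec_nth has_derivative_ident])
  have "norm (complex_of_real (x $ i)) \<le> 1 * (1 + norm x) ^ 1" for x :: "real^'n"
    using component_le_norm_cart[of x i] by simp
  then have "\<exists>C N. \<forall>x::real^'n. norm (complex_of_real (x $ i)) \<le> C * (1 + norm x) ^ N" by blast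
  then show ?case
    using has_derivative_of_real[OF d] slow.const
    by (auto simp: partial_deriv_of_real[OF d] differentiable_def simp del: norm_of_real)
next
  case (powr lam t)
  have d: "((\<lambda>x. bracket lam x powr t) has_derivative 
     (\<lambda>h. t * bracket lam x powr (t - 1) * (8 * pi\<^sup>2 * (x \<bullet> h)))) (at x)" for x :: "real^'n"
    using bracket_gt_1[OF powr, of x] bracket_derivative[of lam x]
    by (auto intro!: derivative_eq_intros simp: powr_diff field_simps)
  have "(\<lambda>x. (of_real (t * 8 * pi\<^sup>2) * of_real (bracket lam x powr (t - 1))) * of_real (x $ i)) \<in> slow" for i :: 'n
    by (intro slow.mult slow.powr slow.coord slow.const powr)
  then have "partial_deriv i (\<lambda>x. complex_of_real (bracket lam x powr t)) \<in> slow" for i :: 'n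
    unfolding partial_deriv_of_real[OF d] by (simp add: inner_axis algebra_simps)
  moreover have "\<exists>C N. \<forall>x::real^'n. norm (complex_of_real (bracket lam x powr t)) \<le> C * (1 + norm x) ^ N"
  proof -
    obtain N :: nat where N: "t \<le> real N" using real_arch_simple by blast
    have "norm (complex_of_real (bracket lam x powr t)) \<le> (lam + 4 * pi\<^sup>2) ^ N * (1 + norm x) ^ (2 * N)"
      for x :: "real^'n"
    proof -
      have "bracket lam x powr t \<le> bracket lam x powr N"
        using bracket_gt_1[OF powr, of x] N by (intro powr_mono) auto
      also have "\<dots> = bracket lam x ^ N"
        using bracket_gt_1[OF powr, of x] by (intro powr_realpow) auto
      also have "\<dots> \<le> ((lam + 4 * pi\<^sup>2) * (1 + norm x)^2) ^ N"
      proof (rule power_mono)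
        have "lam * 1 \<le> lam * (1 + norm x)\<^sup>2" "4 * pi\<^sup>2 * (norm x)\<^sup>2 \<le> 4 * pi\<^sup>2 * (1 + norm x)\<^sup>2"
          using powr one_le_one_plus_norm_power[of x 2] by (intro mult_left_mono power_mono; simp)+
        then show "bracket lam x \<le> (lam + 4 * pi\<^sup>2) * (1 + norm x)^2"
          unfolding distrib_right by linarith
      qed (use bracket_gt_1[OF powr, of x] in auto)
      finally show ?thesis by (simp add: power_mult_distrib power_mult)
    qed
    then show ?thesis by blast
  qed
  ultimately show ?case using has_derivative_of_real[OF d] unfolding differentiable_def by blast
next
  case (ln lam)
  have d: "((\<lambda>x. ln (bracket lam x)) has_derivative 
     (\<lambda>h. bracket lam x powr (-1) * (8 * pi\<^sup>2 * (x \<bullet> h)))) (at x)" for x :: "real^'n"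
    using bracket_gt_1[OF ln, of x] bracket_derivative[of lam x]
    by (auto intro!: derivative_eq_intros simp: powr_minus_divide field_simps)
  have "(\<lambda>x. (of_real (8 * pi\<^sup>2) * of_real (bracket lam x powr (- 1))) * of_real (x $ i)) \<in> slow" for i :: 'n
    by (intro slow.mult slow.powr slow.coord slow.const ln)
  then have "partial_deriv i (\<lambda>x. complex_of_real (ln (bracket lam x))) \<in> slow" for i :: 'n
    unfolding partial_deriv_of_real[OF d] by (simp add: inner_axis algebra_simps)
  moreover have "\<exists>C N. \<forall>x::real^'n. norm (complex_of_real (ln (bracket lam x))) \<le> C * (1 + norm x) ^ N"
  proof -
    have "norm (complex_of_real (ln (bracket lam x))) \<le> (lam + 4 * pi\<^sup>2) * (1 + norm x) ^ 2"
      for x :: "real^'n"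
    proof -
      have "lam * 1 \<le> lam * (1 + norm x)\<^sup>2" "4 * pi\<^sup>2 * (norm x)\<^sup>2 \<le> 4 * pi\<^sup>2 * (1 + norm x)\<^sup>2"
        using ln one_le_one_plus_norm_power[of x 2] by (intro mult_left_mono power_mono; simp)+
      moreover have "0 \<le> ln (bracket lam x)" "ln (bracket lam x) \<le> bracket lam x"
        using bracket_gt_1[OF ln, of x] by (auto intro!: ln_bound)
      ultimately show ?thesis unfolding distrib_right norm_of_real by linarith
    qed
    then show ?thesis by blast
  qed
  ultimately show ?case using has_derivative_of_real[OF d] unfolding differentiable_def by blast
next
  case (inverse_ln lam)
  have lnpos: "ln (bracket lam x) \<ge> ln lam" "ln lam > 0" for x :: "real^'n"
    using inverse_ln bracket_gt_1[OF inverse_ln, of x] by auto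
  have lnpos': "ln (bracket lam x) > 0" for x :: "real^'n" using lnpos(1)[of x] lnpos(2) by linarith
  have d: "((\<lambda>x. 1 / ln (bracket lam x)) has_derivative 
     (\<lambda>h. - (1 / ln (bracket lam x)) * (1 / ln (bracket lam x)) * bracket lam x powr (-1) * (8 * pi\<^sup>2 * (x \<bullet> h)))) (at x)" for x :: "real^'n"
  proof -
    have "((\<lambda>x. ln (bracket lam x)) has_derivative 
       (\<lambda>h. bracket lam x powr (-1) * (8 * pi\<^sup>2 * (x \<bullet> h)))) (at x)"
      using bracket_gt_1[OF inverse_ln, of x] bracket_derivative[of lam x]
      by (auto intro!: derivative_eq_intros simp: powr_minus_divide field_simps)
    from Deriv.has_derivative_inverse[OF _ this] lnpos'[of x] show ?thesis
      by (simp add: inverse_eq_divide mult_ac)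
  qed
  have "(\<lambda>x. (of_real (- 8 * pi\<^sup>2) * of_real (bracket lam x powr (- 1))) * of_real (x $ i) 
      * of_real (1 / ln (bracket lam x)) * of_real (1 / ln (bracket lam x))) \<in> slow" for i :: 'n
    by (intro slow.mult slow.powr slow.coord slow.const slow.inverse_ln inverse_ln)
  then have "partial_deriv i (\<lambda>x. complex_of_real (1 / ln (bracket lam x))) \<in> slow" for i :: 'n
    unfolding partial_deriv_of_real[OF d] by (simp add: inner_axis algebra_simps)
  moreover have "\<exists>C N. \<forall>x::real^'n. norm (complex_of_real (1 / ln (bracket lam x))) \<le> C * (1 + norm x) ^ N"
  proof -
    have "norm (complex_of_real (1 / ln (bracket lam x))) \<le> (1 / ln lam) * (1 + norm x) ^ 0"
      for x :: "real^'n"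
      unfolding norm_of_real using lnpos(1)[of x] lnpos(2) lnpos'[of x] by (simp add: field_simps)
    then show ?thesis by blast
  qed
  ultimately show ?case using has_derivative_of_real[OF d] unfolding differentiable_def by blast
next
  case (gauss c a)
  have d: "((\<lambda>x. exp (- c * (norm (x - a))\<^sup>2)) has_derivative 
     (\<lambda>h. exp (- c * (norm (x - a))\<^sup>2) * (- 2 * c * ((x - a) \<bullet> h)))) (at x)" for x :: "real^'n"
    unfolding power2_norm_eq_inner
    by (auto intro!: derivative_eq_intros simp: inner_commute algebra_simps)
  have "(\<lambda>x. of_real (- 2 * c) * of_real (exp (- c * (norm (x - a))\<^sup>2)) * (of_real (x $ i) + of_real (- a $ i))) \<in> slow" for i :: 'n
    by (intro slow.mult slow.gauss slow.coord slow.const slow.add gauss)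
  then have "partial_deriv i (\<lambda>x. complex_of_real (exp (- c * (norm (x - a))\<^sup>2))) \<in> slow" for i :: 'n
    unfolding partial_deriv_of_real[OF d] by (simp add: inner_axis algebra_simps)
  moreover have "norm (complex_of_real (exp (- c * (norm (x - a))\<^sup>2))) \<le> 1 * (1 + norm x) ^ 0" for x :: "real^'n"
    using gauss by simp
  ultimately show ?case using has_derivative_of_real[OF d] unfolding differentiable_def by blast
next
  case (cis a)
  have d: "((\<lambda>x. cis (x \<bullet> a)) has_derivative (\<lambda>h. \<i> * of_real (h \<bullet> a) * cis (x \<bullet> a))) (at x)" for x :: "real^'n"
  proof -
    have "((\<lambda>x. x \<bullet> a) has_derivative (\<lambda>h. h \<bullet> a)) (at x)"
      by (intro has_derivative_inner_left has_derivative_ident)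
    from has_derivative_cis[OF this] show ?thesis
      by (simp add: scaleR_conv_of_real mult_ac)
  qed
  have "partial_deriv i (\<lambda>x. cis (x \<bullet> a)) = (\<lambda>x. (\<i> * of_real (a $ i)) * cis (x \<bullet> a))" for i :: 'n
    by (rule ext, subst partial_deriv_eqI[OF d]) (simp add: inner_axis')
  moreover have "(\<lambda>x. (\<i> * of_real (a $ i)) * cis (x \<bullet> a)) \<in> slow" for i :: 'n
    by (intro slow.mult slow.const slow.cis)
  moreover have "norm (cis (x \<bullet> a)) \<le> 1 * (1 + norm x) ^ 0" for x :: "real^'n"
    by simp
  ultimately show ?case using d unfolding differentiable_def by metis
next
  case (add P Q)
  then obtain C N D M where b: "\<And>x. norm (P x) \<le> C * (1 + norm x) ^ N" "\<And>x. norm (Q x) \<le> D * (1 + norm x) ^ M"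
    by meson
  have "0 \<le> C" "0 \<le> D" using order_trans[OF norm_ge_zero b(1)[of 0]] order_trans[OF norm_ge_zero b(2)[of 0]] by simp_all
  have "norm (P x + Q x) \<le> (C + D) * (1 + norm x) ^ (N + M)" for x
  proof -
    have "C * (1 + norm x) ^ N \<le> C * (1 + norm x) ^ (N + M)" "D * (1 + norm x) ^ M \<le> D * (1 + norm x) ^ (N + M)"
      using \<open>0 \<le> C\<close> \<open>0 \<le> D\<close> by (intro mult_left_mono power_increasing; simp)+
    then show ?thesis using b[of x] norm_triangle_ineq[of "P x" "Q x"] by (simp add: algebra_simps)
  qed
  with add show ?case by (auto simp: partial_deriv_add intro: slow.add)
next
  case (mult P Q)
  then obtain C N D M where b: "\<And>x. norm (P x) \<le> C * (1 + norm x) ^ N" "\<And>x. norm (Q x) \<le> D * (1 + norm x) ^ M"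
    by meson
  have "0 \<le> C" "0 \<le> D" using order_trans[OF norm_ge_zero b(1)[of 0]] order_trans[OF norm_ge_zero b(2)[of 0]] by simp_all
  have "norm (P x * Q x) \<le> (C * D) * (1 + norm x) ^ (N + M)" for x
    using mult_mono[OF b(1)[of x] b(2)[of x]] \<open>0 \<le> C\<close> by (simp add: norm_mult power_add algebra_simps)
  with mult show ?case by (auto simp: partial_deriv_mult intro!: slow.add slow.mult)
qed

text \<open>
  By the product rule, all derivatives of the product of \<open>\<psi>\<close> with a slowly increasing function lie in
  this class.
\<close>

inductive_set slow_combinations for \<psi> :: "real^'n::finite \<Rightarrow> complex" where
  base: "P \<in> slow \<Longrightarrow> (\<lambda>x. P x * iter_partial \<alpha> \<psi> x) \<in> slow_combinations \<psi>"
| add: "f \<in> slow_combinations \<psi> \<Longrightarrow> g \<in> slow_combinations \<psi> \<Longrightarrow> (\<lambda>x. f x + g x) \<in> slow_combinations \<psi>"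

lemma slow_mult_schwartz:
  fixes P \<psi> :: "real^'n::finite \<Rightarrow> complex"
  assumes "P \<in> slow" "\<psi> \<in> schwartz"
  shows "(\<lambda>x. P x * \<psi> x) \<in> schwartz"
proof -
  have iter: "iter_partial \<alpha> \<psi> \<in> schwartz" for \<alpha>
    by (induction \<alpha>) (use \<open>\<psi> \<in> schwartz\<close> partial_deriv_schwartz in \<open>auto simp: iter_partial_def\<close>)
  have props: "(\<forall>x. f differentiable (at x)) \<and> (\<forall>i. partial_deriv i f \<in> slow_combinations \<psi>) \<and> rapid f"
    if "f \<in> slow_combinations \<psi>" for f
    using that
  proof induction
    case (base P \<alpha>)
    note P = slow_props[OF base]
    have "partial_deriv i (\<lambda>x. P x * iter_partial \<alpha> \<psi> x) \<in> slow_combinations \<psi>" for i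
    proof -
      have "partial_deriv i (\<lambda>x. P x * iter_partial \<alpha> \<psi> x) =
        (\<lambda>x. partial_deriv i P x * iter_partial \<alpha> \<psi> x + P x * iter_partial (i # \<alpha>) \<psi> x)"
        using P schwartz_differentiable[OF iter] by (subst partial_deriv_mult) (auto simp: iter_partial_def)
      then show ?thesis using P base by (auto intro!: slow_combinations.intros)
    qed
    then show ?case using P schwartz_differentiable[OF iter] schwartz_rapid[OF iter]
      by (auto intro: rapid_mult)
  next
    case (add f g)
    then show ?case by (auto simp: partial_deriv_add rapid_add intro: slow_combinations.add)
  qed
  have "(\<lambda>x. P x * iter_partial [] \<psi> x) \<in> slow_combinations \<psi>"
    using \<open>P \<in> slow\<close> by (rule slow_combinations.base)
  then have "(\<lambda>x. P x * \<psi> x) \<in> slow_combinations \<psi>" by (simp add: iter_partial_def)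
  then show ?thesis
    by (rule schwartz_coinduct[where X = "\<lambda>f. f \<in> slow_combinations \<psi>"]) (use props in auto)
qed

text \<open>A single term of the exponential series is below its sum.\<close>

lemma power_mult_exp_neg_le:
  fixes u b :: real assumes "0 < b" "0 \<le> u"
  shows "u ^ k * exp (- b * u) \<le> fact k / b ^ k"
proof -
  have "(b * u) ^ k / fact k \<le> exp (b * u)"
    using sum_le_suminf[OF summable_exp, of "{k}" "b * u"] assms
    by (simp add: exp_def divide_inverse mult.commute)
  then show ?thesis using assms by (simp add: exp_minus field_simps power_mult_distrib)
qed

lemma one_plus_norm_power_le:
  "(1 + norm x) ^ k \<le> 2 ^ k * (1 + (norm (x::real^'n::finite))\<^sup>2) ^ k"
proof -
  have "1 + norm x \<le> 2 * (1 + (norm x)\<^sup>2)"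
    using zero_le_power2[of "norm x - 1"] zero_le_power2[of "norm x"]
    unfolding power2_diff power_one mult_1_right distrib_left by argo
  then have "(1 + norm x) ^ k \<le> (2 * (1 + (norm x)\<^sup>2)) ^ k"
    by (intro power_mono) auto
  then show ?thesis by (simp only: power_mult_distrib)
qed

lemma rapid_gaussian:
  assumes "0 < c"
  shows "rapid (\<lambda>x::real^'n::finite. of_real (exp (- c * (norm x)\<^sup>2)))"
  unfolding rapid_def
proof (intro allI exI)
  fix k and x :: "real^'n"
  have "(1 + norm x) ^ k * norm (complex_of_real (exp (- c * (norm x)\<^sup>2)))
      \<le> (2 ^ k * (1 + (norm x)\<^sup>2) ^ k) * exp (- c * (norm x)\<^sup>2)"
    using one_plus_norm_power_le[of x k] by simp
  also have "\<dots> = (2 ^ k * exp c) * ((1 + (norm x)\<^sup>2) ^ k * exp (- c * (1 + (norm x)\<^sup>2)))"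
    by (simp add: algebra_simps flip: exp_add)
  also have "\<dots> \<le> (2 ^ k * exp c) * (fact k / c ^ k)"
    using assms by (intro mult_left_mono power_mult_exp_neg_le) auto
  finally show "(1 + norm x) ^ k * norm (complex_of_real (exp (- c * (norm x)\<^sup>2)))
      \<le> (2 ^ k * exp c) * (fact k / c ^ k)" .
qed

text \<open>The products of the Gaussian with the class \<open>slow\<close> are closed under partial derivatives.\<close>

lemma gaussian_schwartz:
  assumes "0 < c"
  shows "(\<lambda>x::real^'n::finite. of_real (exp (- c * (norm x)\<^sup>2))) \<in> schwartz"
proof -
  let ?\<gamma> = "\<lambda>x::real^'n. complex_of_real (exp (- c * (norm x)\<^sup>2))"
  define X where "X f \<longleftrightarrow> (\<exists>P\<in>slow. f = (\<lambda>x. P x * ?\<gamma> x))" for f :: "real^'n \<Rightarrow> complex"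
  have slow: "?\<gamma> \<in> slow" using slow.gauss[of c 0] assms by simp
  have d: "((\<lambda>x. exp (- c * (norm x)\<^sup>2)) has_derivative 
     (\<lambda>h. exp (- c * (norm x)\<^sup>2) * (- 2 * c * (x \<bullet> h)))) (at x)" for x :: "real^'n"
    unfolding power2_norm_eq_inner
    by (auto intro!: derivative_eq_intros simp: inner_commute algebra_simps)
  show ?thesis
  proof (rule schwartz_coinduct[where X = X])
    show "X ?\<gamma>" unfolding X_def by (rule bexI[of _ "\<lambda>x. 1"]) (auto intro: slow.const)
  next
    fix f x assume "X f"
    then obtain P where P: "P \<in> slow" "f = (\<lambda>x. P x * ?\<gamma> x)" by (auto simp: X_def)
    then show "f differentiable (at x)"
      using slow_props[OF P(1)] slow_props[OF slow] by auto
  next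
    fix f assume "X f"
    then obtain P where P: "P \<in> slow" "f = (\<lambda>x. P x * ?\<gamma> x)" by (auto simp: X_def)
    then show "rapid f"
      using slow_props[OF P(1)] rapid_gaussian[OF assms] by (auto intro: rapid_mult)
    fix i
    have "partial_deriv i f = (\<lambda>x. (partial_deriv i P x + P x * (of_real (- 2 * c) * of_real (x $ i))) * ?\<gamma> x)"
    proof -
      have pd: "partial_deriv i ?\<gamma> = (\<lambda>x. of_real (- 2 * c) * of_real (x $ i) * ?\<gamma> x)"
        unfolding partial_deriv_of_real[OF d] by (auto simp: inner_axis fun_eq_iff)
      have "partial_deriv i f = (\<lambda>x. partial_deriv i P x * ?\<gamma> x + P x * partial_deriv i ?\<gamma> x)"
        unfolding P(2) using slow_props[OF P(1)] slow_props[OF slow] by (intro partial_deriv_mult) auto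
      then show ?thesis unfolding pd by (simp add: fun_eq_iff algebra_simps)
    qed
    moreover have "(\<lambda>x. partial_deriv i P x + P x * (of_real (- 2 * c) * of_real (x $ i))) \<in> slow"
      using slow_props[OF P(1)] by (intro slow.add slow.mult slow.const slow.coord P(1)) blast
    ultimately show "X (partial_deriv i f)" unfolding X_def by (rule bexI)
  qed
qed

section \<open>Integration over Euclidean space\<close>

lemma borel_measurable_cis [measurable]: "cis \<in> borel_measurable borel"
  by (intro borel_measurable_continuous_onI continuous_intros)

lemma nn_integral_lborel_affine:
  fixes f :: "'a::euclidean_space \<Rightarrow> ennreal"
  assumes [measurable]: "f \<in> borel_measurable borel" and "c \<noteq> 0"
  shows "(\<integral>\<^sup>+x. f x \<partial>lborel) = ennreal (\<bar>c\<bar> ^ DIM('a)) * (\<integral>\<^sup>+x. f (t + c *\<^sub>R x) \<partial>lborel)"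
  by (subst lborel_affine[OF \<open>c \<noteq> 0\<close>, of t])
     (simp add: nn_integral_density nn_integral_distr nn_integral_cmult)

lemma integral_lborel_affine:
  fixes f :: "'a::euclidean_space \<Rightarrow> 'b::{banach, second_countable_topology}"
  assumes [measurable]: "f \<in> borel_measurable borel" and "c \<noteq> 0"
  shows "(LINT x|lborel. f x) = \<bar>c\<bar> ^ DIM('a) *\<^sub>R (LINT x|lborel. f (t + c *\<^sub>R x))"
  by (subst lborel_affine[OF \<open>c \<noteq> 0\<close>, of t])
     (simp add: integral_density integral_distr)

lemma integrable_lborel_affine_iff:
  fixes f :: "'a::euclidean_space \<Rightarrow> 'b::{banach, second_countable_topology}"
  assumes [measurable]: "f \<in> borel_measurable borel" and "c \<noteq> 0"
  shows "integrable lborel (\<lambda>x. f (t + c *\<^sub>R x)) \<longleftrightarrow> integrable lborel f"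
proof -
  have "integrable lborel f \<longleftrightarrow> integrable (density (distr lborel borel (\<lambda>x. t + c *\<^sub>R x)) (\<lambda>_. \<bar>c\<bar> ^ DIM('a))) f"
    by (subst lborel_affine[OF \<open>c \<noteq> 0\<close>, of t]) simp
  also have "\<dots> \<longleftrightarrow> integrable lborel (\<lambda>x. f (t + c *\<^sub>R x))"
  proof -
    let ?g = "\<lambda>x. f (t + c *\<^sub>R x)" and ?k = "\<bar>c\<bar> ^ DIM('a)"
    have "integrable lborel (\<lambda>x. ?k *\<^sub>R ?g x) \<longleftrightarrow> integrable lborel ?g"
    proof
      assume "integrable lborel (\<lambda>x. ?k *\<^sub>R ?g x)"
      then have "integrable lborel (\<lambda>x. (1 / ?k) *\<^sub>R (?k *\<^sub>R ?g x))"
        by (rule integrable_scaleR_right)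
      then show "integrable lborel ?g" using \<open>c \<noteq> 0\<close> by simp
    qed (rule integrable_scaleR_right)
    then show ?thesis by (simp add: integrable_density integrable_distr_eq)
  qed
  finally show ?thesis by simp
qed

lemma integral_lborel_prod:
  fixes f :: "'a::euclidean_space \<Rightarrow> real \<Rightarrow> 'b::{real_normed_field, banach, second_countable_topology}"
  assumes int: "\<And>b. b \<in> Basis \<Longrightarrow> integrable lborel (f b)"
  shows "(LINT x|lborel. (\<Prod>b\<in>Basis. f b (x \<bullet> b))) = (\<Prod>b\<in>Basis. (LINT x|lborel. f b x))"
proof -
  interpret product_sigma_finite "\<lambda>_::'a. lborel :: real measure" ..
  have [measurable]: "f b \<in> borel_measurable borel" if "b \<in> Basis" for b
    using int[OF that] by auto
  have "(LINT x|lborel. (\<Prod>b\<in>Basis. f b (x \<bullet> b))) =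
        (LINT x|(\<Pi>\<^sub>M b\<in>Basis. lborel). (\<Prod>b\<in>Basis. f b ((\<Sum>b\<in>Basis. x b *\<^sub>R b) \<bullet> b)))"
    by (subst lborel_eq[where 'a='a]) (simp add: integral_distr)
  also have "\<dots> = (LINT x|(\<Pi>\<^sub>M b\<in>Basis. lborel). (\<Prod>b\<in>Basis. f b (x b)))"
    by (intro Bochner_Integration.integral_cong refl prod.cong) (simp add: inner_sum_left_Basis)
  also have "\<dots> = (\<Prod>b\<in>Basis. (LINT x|lborel. f b x))"
    using int by (intro product_integral_prod) auto
  finally show ?thesis .
qed

lemma integrable_lborel_prod:
  fixes f :: "real \<Rightarrow> real"
  assumes int: "integrable lborel f" and nn: "\<And>x. 0 \<le> f x"
  shows "integrable lborel (\<lambda>x::'a::euclidean_space. \<Prod>b\<in>Basis. f (x \<bullet> b))"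
proof (rule integrableI_nonneg)
  have [measurable]: "f \<in> borel_measurable borel" using int by auto
  show "(\<lambda>x::'a. \<Prod>b\<in>Basis. f (x \<bullet> b)) \<in> borel_measurable lborel" by measurable
  have "(\<integral>\<^sup>+x. ennreal (\<Prod>b\<in>Basis. f (x \<bullet> b)) \<partial>(lborel :: 'a measure)) = (\<Prod>b\<in>(Basis::'a set). \<integral>\<^sup>+x. ennreal (f x) \<partial>lborel)"
    using nn by (subst nn_integral_lborel_prod[symmetric]) (auto simp: prod_ennreal)
  also have "\<dots> < \<infinity>"
    using int nn by (subst nn_integral_eq_integral) (auto simp: ennreal_power)
  finally show "(\<integral>\<^sup>+x. ennreal (\<Prod>b\<in>Basis. f (x \<bullet> b)) \<partial>(lborel :: 'a measure)) < \<infinity>" .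
qed (auto intro!: prod_nonneg nn)

lemma norm_power2_eq_sum: "(norm (x::'a::euclidean_space))\<^sup>2 = (\<Sum>b\<in>Basis. (x \<bullet> b)\<^sup>2)"
  unfolding power2_norm_eq_inner by (subst euclidean_inner) (simp add: power2_eq_square)

text \<open>
  Comparison with a product of one-dimensional integrands avoids polar coordinates: each factor of
  \<open>\<Prod>b\<in>Basis. 1 + (x \<bullet> b)\<^sup>2\<close> is at most \<open>(1 + |x|)\<^sup>2\<close>.
\<close>

lemma integrable_inverse_one_plus_norm_power:
  "integrable lborel (\<lambda>x::real^'n::finite. 1 / (1 + norm x) ^ (2 * CARD('n)))"
proof -
  have "integrable lborel (\<lambda>x::real. 1 / (1 + x\<^sup>2))"
    using integrable_inverse_1_plus_square
    by (simp add: set_integrable_def inverse_eq_divide)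
  then have int: "integrable lborel (\<lambda>x::real^'n. \<Prod>b\<in>Basis. 1 / (1 + (x \<bullet> b)\<^sup>2))"
    by (rule integrable_lborel_prod) simp
  have "1 / (1 + norm x) ^ (2 * CARD('n)) \<le> (\<Prod>b\<in>Basis. 1 / (1 + (x \<bullet> b)\<^sup>2))" for x :: "real^'n"
  proof -
    have "(\<Prod>b\<in>Basis. 1 + (x \<bullet> b)\<^sup>2) \<le> (\<Prod>b\<in>(Basis :: (real^'n) set). (1 + norm x)\<^sup>2)"
    proof (intro prod_mono conjI)
      fix b :: "real^'n" assume "b \<in> Basis"
      then have "(x \<bullet> b)\<^sup>2 \<le> (norm x)\<^sup>2" by (metis Basis_le_norm power2_abs power_mono abs_ge_zero)
      then show "1 + (x \<bullet> b)\<^sup>2 \<le> (1 + norm x)\<^sup>2" by (simp add: power2_sum add_increasing2)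
    qed (simp add: add_nonneg_nonneg)
    also have "\<dots> = (1 + norm x) ^ (2 * CARD('n))" by (simp add: power_mult)
    finally have "(\<Prod>b\<in>Basis. 1 + (x \<bullet> b)\<^sup>2) \<le> (1 + norm x) ^ (2 * CARD('n))" .
    moreover have "0 < (\<Prod>b\<in>Basis. 1 + (x \<bullet> b)\<^sup>2)"
      by (intro prod_pos) (simp add: add_pos_nonneg)
    ultimately show ?thesis by (simp add: prod_dividef frac_le)
  qed
  then show ?thesis
    by (intro Bochner_Integration.integrable_bound[OF int]) (auto intro: order_trans[OF _ abs_ge_self])
qed

lemma integrable_rapid:
  fixes f :: "real^'n::finite \<Rightarrow> complex"
  assumes "rapid f" and [measurable]: "f \<in> borel_measurable borel"
  shows "integrable lborel f"
proof -
  obtain C where C: "\<And>x. (1 + norm x) ^ (2 * CARD('n)) * norm (f x) \<le> C"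
    using assms unfolding rapid_def by meson
  have "norm (f x) \<le> norm (C * (1 / (1 + norm x) ^ (2 * CARD('n))))" for x
  proof -
    have "0 < (1 + norm x) ^ (2 * CARD('n))" by (simp add: add_pos_nonneg)
    then have "norm (f x) \<le> C * (1 / (1 + norm x) ^ (2 * CARD('n)))"
      using C[of x] by (simp add: pos_le_divide_eq mult.commute)
    then show ?thesis unfolding real_norm_def by (rule order_trans[OF _ abs_ge_self])
  qed
  then show ?thesis
    by (intro Bochner_Integration.integrable_bound[OF integrable_mult_right[OF
          integrable_inverse_one_plus_norm_power, of C]] AE_I2) auto
qed

section \<open>The heat kernel\<close>

text \<open>
  The fundamental solution of the heat equation at time \<open>r\<close>, which is the density of \<open>n\<close> independent
  normal variables of variance \<open>2 r\<close>.
\<close>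

definition heat :: "real \<Rightarrow> real^'n::finite \<Rightarrow> real" where
  "heat r x = exp (- (norm x)\<^sup>2 / (4 * r)) / sqrt (4 * pi * r) ^ CARD('n)"

lemma borel_measurable_heat_pair [measurable]: "(\<lambda>(r, x). heat r x) \<in> borel_measurable (borel \<Otimes>\<^sub>M borel)"
  unfolding heat_def[abs_def] by measurable

lemma borel_measurable_heat [measurable]: "heat r \<in> borel_measurable borel"
  unfolding heat_def[abs_def] by measurable

lemma heat_nonneg [simp]: "0 \<le> r \<Longrightarrow> 0 \<le> heat r x"
  by (simp add: heat_def)

lemma heat_eq_prod:
  assumes "0 < r"
  shows "heat r (x::real^'n::finite) = (\<Prod>b\<in>Basis. normal_density 0 (sqrt (2 * r)) (x \<bullet> b))"
proof -
  have "(\<Prod>b\<in>Basis. normal_density 0 (sqrt (2 * r)) (x \<bullet> b)) =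
     (\<Prod>b\<in>(Basis::(real^'n) set). 1 / sqrt (4 * pi * r) * exp (- (x \<bullet> b)\<^sup>2 / (4 * r)))"
    using assms by (intro prod.cong) (auto simp: normal_density_def)
  also have "\<dots> = (1 / sqrt (4 * pi * r)) ^ CARD('n) * exp (\<Sum>b\<in>Basis. - (x \<bullet> b)\<^sup>2 / (4 * r))"
    by (simp only: prod.distrib) (simp add: exp_sum)
  also have "(\<Sum>b\<in>Basis. - (x \<bullet> b)\<^sup>2 / (4 * r)) = - (norm x)\<^sup>2 / (4 * r)"
    by (simp add: norm_power2_eq_sum sum_negf sum_divide_distrib)
  finally show ?thesis by (simp add: heat_def power_divide)
qed

lemma integrable_heat [simp]: "0 < r \<Longrightarrow> integrable lborel (heat r)"
  by (simp add: heat_eq_prod[THEN ext] integrable_lborel_prod)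

lemma integral_heat [simp]: "0 < r \<Longrightarrow> (LINT x|lborel. heat r x) = 1"
  by (subst heat_eq_prod[THEN ext]) (simp_all add: integral_lborel_prod[where f = "\<lambda>_. normal_density 0 (sqrt (2 * r))"])

lemma integral_normal_density_cis:
  assumes "0 < \<sigma>"
  shows "(LINT x|lborel. complex_of_real (normal_density 0 \<sigma> x) * cis (t * x)) = of_real (exp (- (\<sigma> * t)\<^sup>2 / 2))"
proof -
  have "(LINT x|lborel. complex_of_real (normal_density 0 \<sigma> x) * cis (t * x)) =
     \<bar>\<sigma>\<bar> *\<^sub>R (LINT x|lborel. complex_of_real (normal_density 0 \<sigma> (0 + \<sigma> *\<^sub>R x)) * cis (t * (0 + \<sigma> *\<^sub>R x)))"
    using assms by (subst integral_lborel_affine[of _ \<sigma> 0]) auto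
  also have "\<dots> = (LINT x|lborel. complex_of_real (std_normal_density x) * cis (\<sigma> * t * x))"
    using assms by (subst integral_scaleR_right[symmetric])
      (auto intro!: Bochner_Integration.integral_cong simp: normal_density_def real_sqrt_mult scaleR_conv_of_real
        power_mult_distrib mult_ac field_simps)
  also have "\<dots> = char std_normal_distribution (\<sigma> * t)"
    unfolding char_def by (subst integral_density) (auto simp: scaleR_conv_of_real cis_conv_exp)
  finally show ?thesis by (simp add: char_std_normal_distribution)
qed

lemma cis_sum: "finite A \<Longrightarrow> cis (\<Sum>a\<in>A. f a) = (\<Prod>a\<in>A. cis (f a))"
  by (induction rule: finite_induct) (auto simp flip: cis_mult)

text \<open>
  The product structure of the heat kernel reduces this to the characteristic function of the normal
  distribution.
\<close>

lemma integral_heat_cis: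
  fixes \<xi> :: "real^'n::finite"
  assumes "0 < r"
  shows "(LINT x|lborel. complex_of_real (heat r x) * cis (c * (x \<bullet> \<xi>))) = of_real (exp (- c\<^sup>2 * r * (norm \<xi>)\<^sup>2))"
proof -
  have "(LINT x|lborel. complex_of_real (heat r x) * cis (c * (x \<bullet> \<xi>))) =
     (LINT x|lborel. (\<Prod>b\<in>Basis. complex_of_real (normal_density 0 (sqrt (2 * r)) (x \<bullet> b)) * cis ((c * (\<xi> \<bullet> b)) * (x \<bullet> b))))"
    using assms
    by (intro Bochner_Integration.integral_cong refl, subst euclidean_inner)
      (simp add: heat_eq_prod prod.distrib sum_distrib_left cis_sum[symmetric] mult_ac)
  also have "\<dots> = (\<Prod>b\<in>Basis. of_real (exp (- (sqrt (2 * r) * (c * (\<xi> \<bullet> b)))\<^sup>2 / 2)))"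
  proof (subst integral_lborel_prod)
    fix b :: "real^'n"
    have "integrable lborel (\<lambda>x. complex_of_real (normal_density 0 (sqrt (2 * r)) x))" using assms by simp
    then show "integrable lborel (\<lambda>x. complex_of_real (normal_density 0 (sqrt (2 * r)) x) * cis (c * (\<xi> \<bullet> b) * x))"
      by (rule Bochner_Integration.integrable_bound) (auto simp: norm_mult)
  qed (use assms in \<open>simp add: integral_normal_density_cis\<close>)
  also have "\<dots> = of_real (exp (\<Sum>b\<in>Basis. - c\<^sup>2 * r * (\<xi> \<bullet> b)\<^sup>2))"
    using assms by (simp add: exp_sum power_mult_distrib mult_ac)
  finally show ?thesis by (simp add: norm_power2_eq_sum sum_distrib_left sum_negf)
qed

lemma heat_scale:
  assumes "0 < r"
  shows "sqrt r ^ CARD('n) * heat r (sqrt r *\<^sub>R x) = heat 1 (x::real^'n::finite)"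
  using assms by (simp add: heat_def real_sqrt_mult power_mult_distrib field_simps)

text \<open>
  After the substitution \<open>z = sqrt r w\<close> the kernel no longer depends on \<open>r\<close>, so dominated convergence
  applies.
\<close>

lemma heat_approximate_identity:
  fixes f :: "real^'n::finite \<Rightarrow> complex"
  assumes [measurable]: "f \<in> borel_measurable borel" and bound: "\<And>x. norm (f x) \<le> B"
    and cont: "isCont f x" and r: "\<And>k. 0 < r k" "r \<longlonglongrightarrow> 0"
  shows "(\<lambda>k. LINT z|lborel. f (x + z) * of_real (heat (r k) z)) \<longlonglongrightarrow> f x"
proof -
  have eq: "(LINT z|lborel. f (x + z) * of_real (heat (r k) z)) =
    (LINT z|lborel. f (x + sqrt (r k) *\<^sub>R z) * of_real (heat 1 z))" for k
  proof -
    have "(LINT z|lborel. f (x + z) * of_real (heat (r k) z)) =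
      \<bar>sqrt (r k)\<bar> ^ DIM(real^'n) *\<^sub>R
        (LINT z|lborel. f (x + (0 + sqrt (r k) *\<^sub>R z)) * of_real (heat (r k) (0 + sqrt (r k) *\<^sub>R z)))"
      using r(1)[of k] by (intro integral_lborel_affine) auto
    also have "\<dots> = (LINT z|lborel. f (x + sqrt (r k) *\<^sub>R z) * of_real (heat 1 z))"
    proof -
      have "f (x + sqrt (r k) *\<^sub>R z) * of_real (heat 1 z) =
          \<bar>sqrt (r k)\<bar> ^ DIM(real^'n) *\<^sub>R (f (x + (0 + sqrt (r k) *\<^sub>R z)) * of_real (heat (r k) (0 + sqrt (r k) *\<^sub>R z)))" for z
        using r(1)[of k] by (simp add: heat_scale[OF r(1)[of k], symmetric] scaleR_conv_of_real)
      then show ?thesis by (simp only: integral_scaleR_right)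
    qed
    finally show ?thesis .
  qed
  have "(\<lambda>k. LINT z|lborel. f (x + sqrt (r k) *\<^sub>R z) * of_real (heat 1 z))
     \<longlonglongrightarrow> (LINT z|lborel. f x * of_real (heat 1 (z::real^'n)))"
  proof (rule integral_dominated_convergence[where w = "\<lambda>z::real^'n. B * heat 1 z"])
    show "AE z in lborel. (\<lambda>k. f (x + sqrt (r k) *\<^sub>R z) * of_real (heat 1 z)) \<longlonglongrightarrow> f x * of_real (heat 1 z)"
    proof (intro AE_I2 tendsto_mult tendsto_const)
      fix z
      have "(\<lambda>k. x + sqrt (r k) *\<^sub>R z) \<longlonglongrightarrow> x + sqrt 0 *\<^sub>R z"
        by (intro tendsto_intros r)
      then show "(\<lambda>k. f (x + sqrt (r k) *\<^sub>R z)) \<longlonglongrightarrow> f x"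
        using isCont_tendsto_compose[OF cont] by simp
    qed
  qed (auto simp: norm_mult intro!: mult_right_mono bound)
  also have "(LINT z|lborel. f x * of_real (heat 1 (z::real^'n))) = f x"
    by simp
  finally show ?thesis unfolding eq .
qed

section \<open>The Fourier transform on the Schwartz space\<close>

lemma integrable_pair_mult_bounded:
  fixes f :: "'a::euclidean_space \<Rightarrow> complex" and g :: "'b::euclidean_space \<Rightarrow> complex"
  assumes f: "integrable lborel f" and g: "integrable lborel g"
    and [measurable]: "(\<lambda>(x, y). h x y) \<in> borel_measurable (borel \<Otimes>\<^sub>M borel)"
    and h: "\<And>x y. norm (h x y) \<le> C"
  shows "integrable (lborel \<Otimes>\<^sub>M lborel) (\<lambda>(x, y). f x * g y * h x y)"
proof (rule lborel_pair.Fubini_integrable)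
  have [measurable]: "f \<in> borel_measurable borel" "g \<in> borel_measurable borel" using f g by auto
  show "(\<lambda>(x, y). f x * g y * h x y) \<in> borel_measurable (lborel \<Otimes>\<^sub>M lborel)" by measurable
  have bound: "norm (f x * g y * h x y) \<le> C * (norm (f x) * norm (g y))" for x y
    using mult_left_mono[OF h[of x y], of "norm (f x) * norm (g y)"] by (simp add: norm_mult mult_ac)
  have "0 \<le> C" using order_trans[OF norm_ge_zero h] .
  have int: "integrable lborel (\<lambda>y. f x * g y * h x y)" for x
    by (rule Bochner_Integration.integrable_bound[OF integrable_mult_right[OF integrable_mult_right[OF integrable_norm[OF g]], of C "norm (f x)"]])
      (use bound \<open>0 \<le> C\<close> in auto)
  then show "AE x in lborel. integrable lborel (\<lambda>y. case (x, y) of (x, y) \<Rightarrow> f x * g y * h x y)"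
    by simp
  have "norm (LINT y|lborel. norm (f x * g y * h x y)) \<le> norm (C * norm (f x) * (LINT y|lborel. norm (g y)))" for x
  proof -
    have "(LINT y|lborel. norm (f x * g y * h x y)) \<le> (LINT y|lborel. C * (norm (f x) * norm (g y)))"
      using integrable_norm[OF int[of x]] g bound by (intro integral_mono) auto
    then show ?thesis using \<open>0 \<le> C\<close> by (simp add: norm_mult mult.assoc)
  qed
  then show "integrable lborel (\<lambda>x. LINT y|lborel. norm (case (x, y) of (x, y) \<Rightarrow> f x * g y * h x y))"
    using f by (intro Bochner_Integration.integrable_bound[OF integrable_mult_left[OF integrable_mult_right[OF integrable_norm[OF f], of C],
            of "LINT y|lborel. norm (g y)"]])
      auto
qed

lemma continuous_on_schwartz: "f \<in> schwartz \<Longrightarrow> continuous_on S f"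
  by (meson continuous_at_imp_continuous_on differentiable_imp_continuous_within schwartz_differentiable)

lemma measurable_schwartz: "f \<in> schwartz \<Longrightarrow> f \<in> borel_measurable borel"
  by (intro borel_measurable_continuous_onI continuous_on_schwartz)

lemma integrable_schwartz: "f \<in> schwartz \<Longrightarrow> integrable lborel f"
  by (intro integrable_rapid schwartz_rapid measurable_schwartz)

text \<open>
  The parameter \<open>c\<close> covers the Fourier transform and its inverse, whose properties can thus be proved
  together.
\<close>

definition ft :: "real \<Rightarrow> (real^'n::finite \<Rightarrow> complex) \<Rightarrow> real^'n \<Rightarrow> complex" where
  "ft c f \<xi> = (LINT x|lborel. f x * cis (c * (x \<bullet> \<xi>)))"

lemma fourier_eq_ft: "fourier = ft (- 2 * pi)"
  by (intro ext) (simp add: fourier_def ft_def)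

lemma inv_fourier_eq_ft: "inv_fourier = ft (2 * pi)"
  by (intro ext) (simp add: inv_fourier_def ft_def inner_commute)

lemma integrable_mult_cis:
  fixes f :: "real^'n::finite \<Rightarrow> complex"
  shows "integrable lborel f \<Longrightarrow> integrable lborel (\<lambda>x. f x * cis (c * (x \<bullet> \<xi>)))"
  by (rule Bochner_Integration.integrable_bound[of _ f]) (auto simp: norm_mult)

lemma norm_ft_le: "norm (ft c f \<xi>) \<le> (LINT x|lborel. norm (f x))"
  unfolding ft_def by (rule order_trans[OF integral_norm_bound]) (simp add: norm_mult)

lemma norm_cis_taylor: "norm (cis t - 1 - \<i> * of_real t) \<le> t\<^sup>2"
proof -
  have "2 * norm (cis t - 1 - \<i> * of_real t) \<le> t\<^sup>2"
    using iexp_approx1[of t 1] by (simp add: cis_conv_exp power2_eq_square algebra_simps)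
  then show ?thesis using norm_ge_zero[of "cis t - 1 - \<i> * of_real t"] by linarith
qed

text \<open>
  The remainder of the first-order expansion of \<open>cis\<close> is quadratic, and the second moments of a
  Schwartz function are finite.
\<close>

lemma ft_has_derivative:
  fixes f :: "real^'n::finite \<Rightarrow> complex"
  assumes f: "f \<in> schwartz"
  shows "(ft c f has_derivative (\<lambda>h. LINT x|lborel. (\<i> * of_real (c * (x \<bullet> h))) * (f x * cis (c * (x \<bullet> \<xi>))))) (at \<xi>)"
proof -
  have [measurable]: "f \<in> borel_measurable borel" using f by (rule measurable_schwartz)
  let ?D = "\<lambda>h. LINT x|lborel. (\<i> * of_real (c * (x \<bullet> h))) * (f x * cis (c * (x \<bullet> \<xi>)))"
  let ?T = "\<lambda>h x. f x * cis (c * (x \<bullet> (\<xi> + h))) - f x * cis (c * (x \<bullet> \<xi>)) - (\<i> * of_real (c * (x \<bullet> h))) * (f x * cis (c * (x \<bullet> \<xi>)))"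
  have intn: "integrable lborel (\<lambda>x. of_real (norm x ^ k) * f x)" for k
  proof (rule integrable_rapid)
    show "rapid (\<lambda>x. of_real (norm x ^ k) * f x)"
      by (rule rapid_mult[of _ 1 k]) (auto intro: schwartz_rapid f power_mono simp: norm_power)
  qed measurable
  have intD: "integrable lborel (\<lambda>x. (\<i> * of_real (c * (x \<bullet> h))) * (f x * cis (c * (x \<bullet> \<xi>))))" for h
  proof (rule Bochner_Integration.integrable_bound[OF integrable_mult_left[OF intn[of 1], of "of_real (c * norm h)"]])
    show "AE x in lborel. norm (\<i> * of_real (c * (x \<bullet> h)) * (f x * cis (c * (x \<bullet> \<xi>))))
        \<le> norm (of_real (norm x ^ 1) * f x * of_real (c * norm h))"
    proof (rule AE_I2)
      fix x :: "real^'n"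
      have "\<bar>c\<bar> * \<bar>x \<bullet> h\<bar> * norm (f x) \<le> \<bar>c\<bar> * (norm x * norm h) * norm (f x)"
        by (intro mult_left_mono mult_right_mono Cauchy_Schwarz_ineq2) auto
      then show "norm (\<i> * of_real (c * (x \<bullet> h)) * (f x * cis (c * (x \<bullet> \<xi>))))
        \<le> norm (of_real (norm x ^ 1) * f x * of_real (c * norm h))"
        by (simp add: norm_mult abs_mult mult_ac)
    qed
  qed measurable
  define M where "M = c\<^sup>2 * (LINT x|lborel. norm (of_real (norm x ^ 2) * f x))"
  have bound: "norm (ft c f (\<xi> + h) - ft c f \<xi> - ?D h) \<le> M * (norm h)\<^sup>2" for h
  proof -
    have "ft c f (\<xi> + h) - ft c f \<xi> - ?D h =
      (LINT x|lborel. ?T h x)"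
      unfolding ft_def using intD[of h] integrable_schwartz[OF f]
      by (simp add: integrable_mult_cis)
    also have "norm \<dots> \<le> (LINT x|lborel. c\<^sup>2 * (norm h)\<^sup>2 * norm (of_real (norm x ^ 2) * f x))"
    proof (rule Bochner_Integration.integral_norm_bound_integral)
      show "integrable lborel (\<lambda>x. ?T h x)"
        by (intro Bochner_Integration.integrable_diff intD integrable_mult_cis integrable_schwartz f)
      show "integrable lborel (\<lambda>x. c\<^sup>2 * (norm h)\<^sup>2 * norm (of_real (norm x ^ 2) * f x))"
        by (intro integrable_mult_right integrable_norm intn)
      fix x :: "real^'n"
      have "?T h x
        = f x * cis (c * (x \<bullet> \<xi>)) * (cis (c * (x \<bullet> h)) - 1 - \<i> * of_real (c * (x \<bullet> h)))"
        by (simp add: inner_add_right distrib_left flip: cis_mult) (simp add: algebra_simps)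
      then have "norm (?T h x)
        \<le> norm (f x) * (c * (x \<bullet> h))\<^sup>2"
        using norm_cis_taylor[of "c * (x \<bullet> h)"] by (simp add: norm_mult mult_left_mono)
      also have "\<dots> \<le> norm (f x) * (c\<^sup>2 * ((norm x)\<^sup>2 * (norm h)\<^sup>2))"
        using Cauchy_Schwarz_ineq2[of x h]
        by (intro mult_left_mono) (auto simp: power_mult_distrib abs_le_square_iff[symmetric] abs_mult simp flip: power_mult_distrib intro!: mult_left_mono)
      finally show "norm (?T h x)
        \<le> c\<^sup>2 * (norm h)\<^sup>2 * norm (of_real (norm x ^ 2) * f x)"
        by (simp add: norm_mult norm_power mult_ac)
    qed
    finally show ?thesis by (simp add: M_def mult_ac)
  qed
  have "linear ?D"
  proof (rule linearI)
    fix h k show "?D (h + k) = ?D h + ?D k"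
      using intD[of h] intD[of k]
      by (subst Bochner_Integration.integral_add[symmetric])
        (auto intro!: Bochner_Integration.integral_cong simp: inner_add_right algebra_simps)
  next
    fix a :: real and h show "?D (a *\<^sub>R h) = a *\<^sub>R ?D h"
      by (subst integral_scaleR_right[symmetric])
        (auto intro!: Bochner_Integration.integral_cong simp: scaleR_conv_of_real[where 'a = complex] algebra_simps)
  qed
  moreover have "(\<lambda>h. norm (ft c f (\<xi> + h) - ft c f \<xi> - ?D h) / norm h) \<midarrow>0\<rightarrow> 0"
  proof (rule tendsto_sandwich[OF _ _ tendsto_const])
    show "\<forall>\<^sub>F h in at 0. norm (ft c f (\<xi> + h) - ft c f \<xi> - ?D h) / norm h \<le> M * norm h"
      using bound unfolding eventually_at
      by (intro exI[of _ 1]) (auto simp: divide_le_eq power2_eq_square mult.assoc)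
    show "((\<lambda>h::real^'n. M * norm h) \<longlongrightarrow> 0) (at 0)"
      by (intro tendsto_mult_right_zero tendsto_norm_zero tendsto_ident_at)
  qed auto
  ultimately show ?thesis
    unfolding has_derivative_at by (simp add: linear_conv_bounded_linear)
qed

lemma partial_deriv_ft:
  fixes f :: "real^'n::finite \<Rightarrow> complex"
  assumes "f \<in> schwartz"
  shows "partial_deriv i (ft c f) = ft c (\<lambda>x. (\<i> * of_real c * of_real (x $ i)) * f x)"
  using partial_deriv_eqI[OF ft_has_derivative[OF assms]]
  by (auto simp: fun_eq_iff ft_def inner_axis mult_ac)

lemma has_vector_derivative_imp_difference_quotient:
  fixes g :: "real \<Rightarrow> 'a::real_normed_vector"
  assumes "(g has_vector_derivative d) (at 0)"
  shows "((\<lambda>h. (1 / h) *\<^sub>R (g h - g 0)) \<longlongrightarrow> d) (at 0)"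
proof -
  have "((\<lambda>h. norm (g h - g 0 - h *\<^sub>R d) / norm h) \<longlongrightarrow> 0) (at 0)"
    using assms unfolding has_vector_derivative_def has_derivative_at by simp
  moreover have "\<forall>\<^sub>F h in at 0. norm (g h - g 0 - h *\<^sub>R d) / norm h = norm ((1 / h) *\<^sub>R (g h - g 0) - d)"
    unfolding eventually_at
  proof (intro exI[of _ 1] conjI ballI impI)
    fix h :: real assume "h \<noteq> 0 \<and> dist h 0 < 1"
    then have "(1 / h) *\<^sub>R (g h - g 0) - d = (1 / h) *\<^sub>R (g h - g 0 - h *\<^sub>R d)"
      by (simp add: scaleR_diff_right)
    then show "norm (g h - g 0 - h *\<^sub>R d) / norm h = norm ((1 / h) *\<^sub>R (g h - g 0) - d)" by simp
  qed simp
  ultimately have "((\<lambda>h. norm ((1 / h) *\<^sub>R (g h - g 0) - d)) \<longlongrightarrow> 0) (at 0)"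
    by (rule Lim_transform_eventually)
  then show ?thesis by (rule LIM_zero_cancel[OF tendsto_norm_zero_cancel])
qed

text \<open>
  Provides an integrable majorant for difference quotients, which involve values of the derivative
  at points near \<open>x\<close>.
\<close>

lemma rapid_bound_nearby:
  assumes "rapid (g :: real^'n::finite \<Rightarrow> complex)"
  obtains D where "\<And>x y. norm (x - y) \<le> 1 \<Longrightarrow> norm (g y) \<le> D * (1 / (1 + norm x) ^ N)"
proof -
  obtain C where C: "\<And>x. (1 + norm x) ^ N * norm (g x) \<le> C"
    using assms unfolding rapid_def by meson
  have "norm (g y) \<le> (2 ^ N * C) * (1 / (1 + norm x) ^ N)" if "norm (x - y) \<le> 1" for x y
  proof -
    have "norm x \<le> norm y + norm (x - y)" by (rule norm_triangle_sub)
    with that have "1 + norm x \<le> 2 * (1 + norm y)" using norm_ge_zero[of y] by argo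
    then have "(1 + norm x) ^ N \<le> 2 ^ N * (1 + norm y) ^ N"
      unfolding power_mult_distrib[symmetric] by (intro power_mono) auto
    then have "(1 + norm x) ^ N * norm (g y) \<le> 2 ^ N * (1 + norm y) ^ N * norm (g y)"
      by (rule mult_right_mono) simp
    also have "\<dots> \<le> 2 ^ N * C"
      using mult_left_mono[OF C[of y], of "2 ^ N"] by (simp add: mult.assoc)
    finally have "norm (g y) * (1 + norm x) ^ N \<le> 2 ^ N * C" by (simp only: mult.commute)
    moreover have "0 < (1 + norm x) ^ N" by (intro zero_less_power add_pos_nonneg) auto
    ultimately show ?thesis by (simp only: times_divide_eq_right mult_1_right pos_le_divide_eq)
  qed
  then show ?thesis by (rule that)
qed

lemma norm_difference_quotient_le:
  fixes g :: "real \<Rightarrow> 'a::real_normed_vector"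
  assumes "0 < t" and deriv: "\<And>s. (g has_vector_derivative g' s) (at s within {0..t})"
    and bound: "\<And>s. s \<in> {0..t} \<Longrightarrow> norm (g' s) \<le> B"
  shows "norm ((1 / t) *\<^sub>R (g t - g 0)) \<le> B"
proof -
  have "norm (g t - g 0) \<le> B * norm (t - 0)"
  proof (rule differentiable_bound[where S = "{0..t}" and f' = "\<lambda>s h. h *\<^sub>R g' s"])
    fix s assume s: "s \<in> {0..t}"
    show "(g has_derivative (\<lambda>h. h *\<^sub>R g' s)) (at s within {0..t})"
      using deriv unfolding has_vector_derivative_def .
    show "onorm (\<lambda>h. h *\<^sub>R g' s) \<le> B"
      using bound[OF s] by (intro onorm_le) (simp add: mult.commute[of B] mult_left_mono)
  qed (use \<open>0 < t\<close> in auto)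
  then show ?thesis using \<open>0 < t\<close> by (simp add: pos_divide_le_eq)
qed

text \<open>
  The integral of a difference quotient vanishes by translation invariance, and difference quotients
  converge dominatedly to the derivative. This is integration by parts without boundary terms.
\<close>

lemma integral_partial_deriv_schwartz:
  fixes f :: "real^'n::finite \<Rightarrow> complex"
  assumes f: "f \<in> schwartz"
  shows "(LINT x|lborel. partial_deriv i f x) = 0"
proof -
  have [measurable]: "f \<in> borel_measurable borel" using f by (rule measurable_schwartz)
  note df = partial_deriv_schwartz[OF f, of i]
  have [measurable]: "partial_deriv i f \<in> borel_measurable borel" using df by (rule measurable_schwartz)
  let ?e = "axis i 1 :: real^'n" and ?N = "2 * CARD('n)"
  obtain D where D: "\<And>x y. norm (x - y) \<le> 1 \<Longrightarrow> norm (partial_deriv i f y) \<le> D * (1 / (1 + norm x) ^ ?N)"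
    using rapid_bound_nearby[OF schwartz_rapid[OF df]] by blast
  have deriv: "((\<lambda>t. f (x + t *\<^sub>R ?e)) has_vector_derivative partial_deriv i f (x + t *\<^sub>R ?e)) (at t within S)" for x t S
  proof -
    obtain f' where f': "(f has_derivative f') (at (x + t *\<^sub>R ?e))"
      using schwartz_differentiable[OF f] unfolding differentiable_def by blast
    have "((\<lambda>t. x + t *\<^sub>R ?e) has_derivative (\<lambda>h. h *\<^sub>R ?e)) (at t within S)"
      by (auto intro!: derivative_eq_intros)
    from has_derivative_compose[OF this f'] show ?thesis
      unfolding has_vector_derivative_def partial_deriv_eqI[OF f']
      by (simp add: linear_scale[OF has_derivative_linear[OF f']])
  qed
  define t where "t k = 1 / real (Suc k)" for k
  have t: "0 < t k" "t k \<le> 1" for k by (auto simp: t_def)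
  have t0: "t \<longlonglongrightarrow> 0" unfolding t_def using lim_1_over_n[where 'a=real] LIMSEQ_Suc by fastforce
  have zero: "(LINT x|lborel. (1 / t k) *\<^sub>R (f (x + t k *\<^sub>R ?e) - f x)) = 0" for k
  proof -
    have int: "integrable lborel f" using f by (rule integrable_schwartz)
    have "integrable lborel (\<lambda>x. f (t k *\<^sub>R ?e + 1 *\<^sub>R x))"
      using int by (subst integrable_lborel_affine_iff) auto
    moreover have "(LINT x|lborel. f x) = (LINT x|lborel. f (t k *\<^sub>R ?e + 1 *\<^sub>R x))"
      by (subst integral_lborel_affine[of f 1 "t k *\<^sub>R ?e"]) auto
    ultimately show ?thesis using int by (simp add: add.commute)
  qed
  have "(\<lambda>k. LINT x|lborel. (1 / t k) *\<^sub>R (f (x + t k *\<^sub>R ?e) - f x)) \<longlonglongrightarrow> (LINT x|lborel. partial_deriv i f x)"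
  proof (rule integral_dominated_convergence)
    show "integrable lborel (\<lambda>x::real^'n. D * (1 / (1 + norm x) ^ ?N))"
      by (intro integrable_mult_right integrable_inverse_one_plus_norm_power)
    show "AE x in lborel. (\<lambda>k. (1 / t k) *\<^sub>R (f (x + t k *\<^sub>R ?e) - f x)) \<longlonglongrightarrow> partial_deriv i f x"
    proof (rule AE_I2)
      fix x
      have "((\<lambda>h. (1 / h) *\<^sub>R (f (x + h *\<^sub>R ?e) - f x)) \<longlongrightarrow> partial_deriv i f x) (at 0)"
        using has_vector_derivative_imp_difference_quotient[OF deriv[of x 0 UNIV, simplified]] by simp
      then show "(\<lambda>k. (1 / t k) *\<^sub>R (f (x + t k *\<^sub>R ?e) - f x)) \<longlonglongrightarrow> partial_deriv i f x"
        by (rule filterlim_compose) (use t(1)[THEN less_imp_neq] t0 in \<open>auto simp: filterlim_at intro!: always_eventually\<close>)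
    qed
    show "AE x in lborel. norm ((1 / t k) *\<^sub>R (f (x + t k *\<^sub>R ?e) - f x)) \<le> D * (1 / (1 + norm x) ^ ?N)" for k
    proof (rule AE_I2)
      fix x :: "real^'n"
      have "norm (x - (x + s *\<^sub>R ?e)) \<le> 1" if "s \<in> {0..t k}" for s
        using that t(2)[of k] by simp
      then have "norm (partial_deriv i f (x + s *\<^sub>R ?e)) \<le> D * (1 / (1 + norm x) ^ ?N)" if "s \<in> {0..t k}" for s
        using that D by blast
      then have "norm ((1 / t k) *\<^sub>R (f (x + t k *\<^sub>R ?e) - f (x + 0 *\<^sub>R ?e))) \<le> D * (1 / (1 + norm x) ^ ?N)"
        by (rule norm_difference_quotient_le[OF t(1)[of k] deriv[of x]])
      then show "norm ((1 / t k) *\<^sub>R (f (x + t k *\<^sub>R ?e) - f x)) \<le> D * (1 / (1 + norm x) ^ ?N)"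
        by simp
    qed
  qed measurable
  then show ?thesis unfolding zero by (rule LIMSEQ_unique[OF _ tendsto_const])
qed

text \<open>The derivative of the product of \<open>f\<close> with the character \<open>cis (c * (x \<bullet> \<xi>))\<close> has integral 0.\<close>

lemma ft_partial_deriv:
  fixes f :: "real^'n::finite \<Rightarrow> complex"
  assumes f: "f \<in> schwartz"
  shows "ft c (partial_deriv i f) \<xi> = - (\<i> * of_real (c * \<xi> $ i)) * ft c f \<xi>"
proof -
  let ?e = "\<lambda>x. cis (x \<bullet> (c *\<^sub>R \<xi>))"
  have e: "?e \<in> slow" by (rule slow.cis)
  have pe: "partial_deriv i ?e x = \<i> * of_real (c * \<xi> $ i) * ?e x" for x
  proof -
    have "((\<lambda>x. x \<bullet> (c *\<^sub>R \<xi>)) has_derivative (\<lambda>h. h \<bullet> (c *\<^sub>R \<xi>))) (at x)"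
      by (intro has_derivative_inner_left has_derivative_ident)
    from partial_deriv_eqI[OF has_derivative_cis[OF this]] show ?thesis
      by (simp add: inner_axis' scaleR_conv_of_real[where 'a = complex] mult_ac)
  qed
  have "partial_deriv i (\<lambda>x. f x * ?e x) = (\<lambda>x. partial_deriv i f x * ?e x + f x * partial_deriv i ?e x)"
    using schwartz_differentiable[OF f] slow_props[OF e] by (intro partial_deriv_mult) auto
  then have eq: "partial_deriv i (\<lambda>x. f x * ?e x) x = partial_deriv i f x * cis (c * (x \<bullet> \<xi>))
      + (\<i> * of_real (c * \<xi> $ i)) * (f x * cis (c * (x \<bullet> \<xi>)))" for x
    by (simp only: pe) (simp add: mult_ac)
  have "(\<lambda>x. f x * ?e x) \<in> schwartz" using slow_mult_schwartz[OF e f] by (simp add: mult.commute)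
  from integral_partial_deriv_schwartz[OF this, of i]
  have zero: "(LINT x|lborel. partial_deriv i f x * cis (c * (x \<bullet> \<xi>)) + (\<i> * of_real (c * \<xi> $ i)) * (f x * cis (c * (x \<bullet> \<xi>)))) = 0"
    unfolding eq .
  have "(LINT x|lborel. partial_deriv i f x * cis (c * (x \<bullet> \<xi>)) + (\<i> * of_real (c * \<xi> $ i)) * (f x * cis (c * (x \<bullet> \<xi>))))
    = ft c (partial_deriv i f) \<xi> + (\<i> * of_real (c * \<xi> $ i)) * ft c f \<xi>"
  proof -
    have "integrable lborel (\<lambda>x. partial_deriv i f x * cis (c * (x \<bullet> \<xi>)))"
      by (rule integrable_mult_cis[OF integrable_schwartz[OF partial_deriv_schwartz[OF f]]])
    moreover have "integrable lborel (\<lambda>x. (\<i> * of_real (c * \<xi> $ i)) * (f x * cis (c * (x \<bullet> \<xi>))))"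
      by (rule integrable_mult_right[OF integrable_mult_cis[OF integrable_schwartz[OF f]]])
    ultimately show ?thesis
      unfolding ft_def by (subst Bochner_Integration.integral_add) (simp_all only: integral_mult_right_zero)
  qed
  then have "ft c (partial_deriv i f) \<xi> + (\<i> * of_real (c * \<xi> $ i)) * ft c f \<xi> = 0"
    using zero by (rule trans[OF sym])
  then show ?thesis unfolding mult_minus_left by (rule eq_neg_iff_add_eq_0[THEN iffD2])
qed

text \<open>
  Each factor \<open>\<xi> $ i\<close> can be absorbed into the transform by passing to a partial derivative of \<open>f\<close>;
  the induction is on the number of such factors.
\<close>

lemma rapid_ft:
  fixes f :: "real^'n::finite \<Rightarrow> complex"
  assumes "c \<noteq> 0" "f \<in> schwartz"
  shows "rapid (ft c f)"
  unfolding rapid_def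
proof
  fix k
  show "\<exists>C. \<forall>\<xi>. (1 + norm \<xi>) ^ k * norm (ft c f \<xi>) \<le> C"
    using \<open>f \<in> schwartz\<close>
  proof (induction k arbitrary: f)
    case 0
    show ?case using norm_ft_le[of c f] by auto
  next
    case (Suc k)
    from Suc.IH[OF Suc.prems] obtain C where C: "\<And>\<xi>. (1 + norm \<xi>) ^ k * norm (ft c f \<xi>) \<le> C" by blast
    have "\<forall>i. \<exists>C. \<forall>\<xi>. (1 + norm \<xi>) ^ k * norm (ft c (partial_deriv i f) \<xi>) \<le> C"
      using Suc.IH partial_deriv_schwartz Suc.prems by blast
    then obtain D where D: "\<And>i \<xi>. (1 + norm \<xi>) ^ k * norm (ft c (partial_deriv i f) \<xi>) \<le> D i" by metis
    have "(1 + norm \<xi>) ^ Suc k * norm (ft c f \<xi>) \<le> C + (\<Sum>i\<in>UNIV. D i / \<bar>c\<bar>)" for \<xi>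
    proof -
      let ?a = "(1 + norm \<xi>) ^ k * norm (ft c f \<xi>)"
      have "(1 + norm \<xi>) ^ Suc k * norm (ft c f \<xi>) = ?a + norm \<xi> * ?a"
        by (simp add: algebra_simps)
      also have "\<dots> \<le> ?a + (\<Sum>i\<in>UNIV. \<bar>\<xi> $ i\<bar>) * ?a"
        by (intro add_left_mono mult_right_mono norm_le_l1_cart) auto
      also have "\<dots> = ?a + (\<Sum>i\<in>UNIV. \<bar>\<xi> $ i\<bar> * ?a)" by (simp add: sum_distrib_right)
      also have "\<dots> \<le> C + (\<Sum>i\<in>UNIV. D i / \<bar>c\<bar>)"
      proof (intro add_mono C sum_mono)
        fix i
        have "(1 + norm \<xi>) ^ k * norm (ft c (partial_deriv i f) \<xi>) \<le> D i" by (rule D)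
        then have "\<bar>c\<bar> * (\<bar>\<xi> $ i\<bar> * ?a) \<le> D i"
          unfolding ft_partial_deriv[OF Suc.prems] by (simp add: norm_mult abs_mult mult_ac)
        then show "\<bar>\<xi> $ i\<bar> * ?a \<le> D i / \<bar>c\<bar>"
          using \<open>c \<noteq> 0\<close> by (simp add: field_simps)
      qed
      finally show ?thesis .
    qed
    then show ?case by blast
  qed
qed

text \<open>
  The range of the transform is a class as required for coinduction, since a derivative of the
  transform of \<open>f\<close> is the transform of \<open>f\<close> multiplied by a coordinate.
\<close>

lemma ft_schwartz:
  fixes f :: "real^'n::finite \<Rightarrow> complex"
  assumes "c \<noteq> 0" "f \<in> schwartz"
  shows "ft c f \<in> schwartz"
proof (rule schwartz_coinduct[where X = "\<lambda>g. \<exists>f\<in>schwartz. g = ft c f"])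
  show "\<exists>g\<in>schwartz. ft c f = ft c g" using assms by blast
next
  fix g x assume "\<exists>f\<in>schwartz. g = ft c f"
  then show "g differentiable (at x)"
    using ft_has_derivative unfolding differentiable_def by blast
next
  fix g i assume "\<exists>f\<in>schwartz. g = ft c f"
  then obtain f where f: "f \<in> schwartz" "g = ft c f" by blast
  have "(\<lambda>x. (\<i> * of_real c * of_real (x $ i)) * f x) \<in> schwartz"
    by (intro slow_mult_schwartz slow.mult slow.const slow.coord f)
  then show "\<exists>f\<in>schwartz. partial_deriv i g = ft c f"
    unfolding f(2) partial_deriv_ft[OF f(1)] by blast
next
  fix g assume "\<exists>f\<in>schwartz. g = ft c f"
  then show "rapid g" using rapid_ft[OF \<open>c \<noteq> 0\<close>] by blast
qed

text \<open>A Gaussian is a multiple of a heat kernel, at the time \<open>R\<close> introduced in the proof.\<close>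

lemma ft_gaussian:
  fixes z :: "real^'n::finite"
  assumes "c\<^sup>2 = (2 * pi)\<^sup>2" "0 < r"
  shows "ft c (\<lambda>\<xi>. of_real (exp (- c\<^sup>2 * r * (norm \<xi>)\<^sup>2))) z = of_real (heat r z)"
proof -
  define R where "R = 1 / (4 * (c\<^sup>2 * r))"
  have c: "0 < c\<^sup>2" using assms(1) by simp
  then have R: "0 < R" using assms by (simp add: R_def)
  have eq: "exp (- c\<^sup>2 * r * (norm \<xi>)\<^sup>2) = sqrt (4 * pi * R) ^ CARD('n) * heat R \<xi>" for \<xi> :: "real^'n"
    using R c assms(2) by (simp add: heat_def R_def)
  have "ft c (\<lambda>\<xi>. of_real (exp (- c\<^sup>2 * r * (norm \<xi>)\<^sup>2))) z =
     of_real (sqrt (4 * pi * R) ^ CARD('n)) * (LINT \<xi>|lborel. of_real (heat R \<xi>) * cis (c * (\<xi> \<bullet> z)))"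
    unfolding ft_def eq by (simp add: mult.assoc)
  also have "\<dots> = of_real (sqrt (4 * pi * R) ^ CARD('n) * exp (- c\<^sup>2 * R * (norm z)\<^sup>2))"
    unfolding integral_heat_cis[OF R] by simp
  also have "sqrt (4 * pi * R) = 1 / sqrt (4 * pi * r)"
  proof -
    have "4 * pi * R = 1 / (4 * pi * r)"
      using assms(2) unfolding R_def assms(1) by (simp add: power2_eq_square field_simps)
    then show ?thesis by (simp add: real_sqrt_divide)
  qed
  also have "- c\<^sup>2 * R * (norm z)\<^sup>2 = - (norm z)\<^sup>2 / (4 * r)"
    using c by (simp add: R_def)
  finally show ?thesis by (simp add: heat_def power_divide)
qed

text \<open>
  A Gaussian factor in \<open>\<xi>\<close> makes the double integral absolutely convergent. Exchanging the integrals
  turns this factor into a heat kernel, so the regularised inverse transform is the heat smoothing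
  of \<open>f\<close>; both sides converge as the time tends to 0.
\<close>

lemma ft_inversion:
  fixes f :: "real^'n::finite \<Rightarrow> complex"
  assumes c: "c\<^sup>2 = (2 * pi)\<^sup>2" and f: "f \<in> schwartz"
  shows "ft (- c) (ft c f) = f"
proof
  fix x
  have c0: "c \<noteq> 0" using c by auto
  have [measurable]: "f \<in> borel_measurable borel" using f by (rule measurable_schwartz)
  have F: "ft c f \<in> schwartz" using ft_schwartz[OF c0 f] .
  have [measurable]: "ft c f \<in> borel_measurable borel" using F by (rule measurable_schwartz)
  define r where "r k = 1 / real (Suc k)" for k
  have r: "0 < r k" for k by (auto simp: r_def)
  have r0: "r \<longlonglongrightarrow> 0" unfolding r_def using lim_1_over_n[where 'a=real] LIMSEQ_Suc by fastforce
  let ?g = "\<lambda>k \<xi>::real^'n. complex_of_real (exp (- c\<^sup>2 * r k * (norm \<xi>)\<^sup>2))"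
  have g: "integrable lborel (?g k)" for k
    using gaussian_schwartz[of "c\<^sup>2 * r k"] r[of k] c0 by (intro integrable_schwartz) simp
  have eq: "(LINT \<xi>|lborel. ft c f \<xi> * cis (- c * (\<xi> \<bullet> x)) * ?g k \<xi>) = (LINT z|lborel. f (x + z) * of_real (heat (r k) z))" for k
  proof -
    have "(LINT \<xi>|lborel. ft c f \<xi> * cis (- c * (\<xi> \<bullet> x)) * ?g k \<xi>) =
      (LINT \<xi>|lborel. (LINT y|lborel. f y * ?g k \<xi> * cis (c * ((y - x) \<bullet> \<xi>))))"
    proof (rule Bochner_Integration.integral_cong[OF refl])
      fix \<xi> :: "real^'n"
      have eqy: "f y * ?g k \<xi> * cis (c * ((y - x) \<bullet> \<xi>)) = (cis (- c * (\<xi> \<bullet> x)) * ?g k \<xi>) * (f y * cis (c * (y \<bullet> \<xi>)))" for y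
      proof -
        have "cis (c * ((y - x) \<bullet> \<xi>)) = cis (- c * (\<xi> \<bullet> x)) * cis (c * (y \<bullet> \<xi>))"
          unfolding cis_mult by (simp add: inner_diff_left inner_commute algebra_simps)
        then show ?thesis by (simp add: mult_ac)
      qed
      show "ft c f \<xi> * cis (- c * (\<xi> \<bullet> x)) * ?g k \<xi> = (LINT y|lborel. f y * ?g k \<xi> * cis (c * ((y - x) \<bullet> \<xi>)))"
        by (simp only: ft_def eqy integral_mult_right_zero) (simp only: mult_ac)
    qed
    also have "\<dots> = (LINT y|lborel. (LINT \<xi>|lborel. f y * ?g k \<xi> * cis (c * ((y - x) \<bullet> \<xi>))))"
    proof (rule lborel_pair.Fubini_integral, rule integrable_pair_mult_bounded)
      show "integrable lborel f" by (rule integrable_schwartz[OF f])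
      show "integrable lborel (?g k)" by (rule g)
      show "(\<lambda>(y, \<xi>). cis (c * ((y - x) \<bullet> \<xi>))) \<in> borel_measurable (borel \<Otimes>\<^sub>M borel)"
        by measurable
      show "norm (cis (c * ((y - x) \<bullet> \<xi>))) \<le> 1" for y \<xi> by simp
    qed
    also have "\<dots> = (LINT y|lborel. f y * of_real (heat (r k) (y - x)))"
    proof (rule Bochner_Integration.integral_cong[OF refl])
      fix y
      have "(LINT \<xi>|lborel. f y * ?g k \<xi> * cis (c * ((y - x) \<bullet> \<xi>))) = f y * ft c (?g k) (y - x)"
        unfolding ft_def integral_mult_right_zero[symmetric] by (simp only: inner_commute[of _ "y - x"] mult.assoc)
      then show "(LINT \<xi>|lborel. f y * ?g k \<xi> * cis (c * ((y - x) \<bullet> \<xi>))) = f y * of_real (heat (r k) (y - x))"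
        unfolding ft_gaussian[OF c r] .
    qed
    also have "\<dots> = (LINT z|lborel. f (x + z) * of_real (heat (r k) z))"
      by (subst integral_lborel_affine[of _ 1 x]) auto
    finally show ?thesis .
  qed
  obtain B where B: "\<And>x. norm (f x) \<le> B"
    using schwartz_rapid[OF f] unfolding rapid_def by (metis mult_1 power_0)
  have "isCont f x" using continuous_on_schwartz[OF f, of UNIV] by (simp add: continuous_on_eq_continuous_at)
  then have "(\<lambda>k. LINT z|lborel. f (x + z) * of_real (heat (r k) z)) \<longlonglongrightarrow> f x"
    by (intro heat_approximate_identity[OF _ B]) (auto simp: r r0)
  moreover have "(\<lambda>k. LINT \<xi>|lborel. ft c f \<xi> * cis (- c * (\<xi> \<bullet> x)) * ?g k \<xi>) \<longlonglongrightarrow> (LINT \<xi>|lborel. ft c f \<xi> * cis (- c * (\<xi> \<bullet> x)))"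
  proof (rule integral_dominated_convergence[where w = "\<lambda>\<xi>. norm (ft c f \<xi>)"])
    show "AE \<xi> in lborel. (\<lambda>k. ft c f \<xi> * cis (- c * (\<xi> \<bullet> x)) * ?g k \<xi>) \<longlonglongrightarrow> ft c f \<xi> * cis (- c * (\<xi> \<bullet> x))"
    proof (rule AE_I2)
      fix \<xi> :: "real^'n"
      have "(\<lambda>k. ft c f \<xi> * cis (- c * (\<xi> \<bullet> x)) * ?g k \<xi>) \<longlonglongrightarrow> ft c f \<xi> * cis (- c * (\<xi> \<bullet> x)) * of_real (exp (- c\<^sup>2 * 0 * (norm \<xi>)\<^sup>2))"
        by (intro tendsto_intros r0)
      then show "(\<lambda>k. ft c f \<xi> * cis (- c * (\<xi> \<bullet> x)) * ?g k \<xi>) \<longlonglongrightarrow> ft c f \<xi> * cis (- c * (\<xi> \<bullet> x))" by simp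
    qed
    show "AE \<xi> in lborel. norm (ft c f \<xi> * cis (- c * (\<xi> \<bullet> x)) * ?g k \<xi>) \<le> norm (ft c f \<xi>)" for k
      using r[of k] by (intro AE_I2) (simp add: norm_mult mult_left_le)
    show "integrable lborel (\<lambda>\<xi>. norm (ft c f \<xi>))" by (intro integrable_norm integrable_schwartz F)
  qed measurable
  ultimately show "ft (- c) (ft c f) x = f x"
    unfolding eq by (simp add: ft_def LIMSEQ_unique)
qed

section \<open>Functions are determined by their integrals against Schwartz functions\<close>

text \<open>
  Indicators of open sets are monotone limits of continuous functions, and open sets generate the
  Borel sets.
\<close>

lemma integral_zero_if_annihilates_continuous:
  fixes H :: "'a::euclidean_space \<Rightarrow> complex"
  assumes H: "integrable lborel H"
    and zero: "\<And>h::'a \<Rightarrow> complex. \<lbrakk>continuous_on UNIV h; \<And>x. norm (h x) \<le> 1\<rbrakk> \<Longrightarrow> (LINT x|lborel. H x * h x) = 0"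
  shows "AE x in lborel. H x = 0"
proof -
  have [measurable]: "H \<in> borel_measurable borel" using H by auto
  have open_zero: "(LINT x|lborel. indicator U x *\<^sub>R H x) = 0" if "open U" for U :: "'a set"
  proof (cases "U = UNIV")
    case True
    then show ?thesis using zero[of "\<lambda>x. 1"] by simp
  next
    case False
    define h where "h k x = complex_of_real (min 1 (real k * infdist x (- U)))" for k x
    have meas: "h k \<in> borel_measurable borel" and cont: "continuous_on UNIV (h k)" for k
      unfolding h_def by (intro borel_measurable_continuous_onI continuous_intros)+
    have nonneg: "0 \<le> min 1 (real k * infdist x (- U))" for k x by (simp add: infdist_nonneg)
    have le: "norm (h k x) \<le> 1" for k x
      unfolding h_def norm_of_real using nonneg[of k x] by simp
    have "(\<lambda>k. LINT x|lborel. H x * h k x) \<longlonglongrightarrow> (LINT x|lborel. indicator U x *\<^sub>R H x)"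
    proof (rule integral_dominated_convergence[where w = "\<lambda>x. norm (H x)"])
      show "AE x in lborel. (\<lambda>k. H x * h k x) \<longlonglongrightarrow> indicator U x *\<^sub>R H x"
      proof (rule AE_I2)
        fix x
        have "(\<lambda>k. h k x) \<longlonglongrightarrow> of_real (indicator U x)"
        proof (cases "x \<in> U")
          case True
          have "closed (- U)" "- U \<noteq> {}" using that False by auto
          then have pos: "0 < infdist x (- U)"
            using True in_closed_iff_infdist_zero[of "- U" x] infdist_nonneg[of x "- U"] by force
          obtain N where N: "1 / infdist x (- U) \<le> real N" using real_arch_simple by blast
          have "h k x = 1" if "N \<le> k" for k
          proof -
            have "1 / infdist x (- U) \<le> real k" using N that by linarith
            then show ?thesis using pos by (simp add: h_def field_simps min_def)
          qed
          then show ?thesis using True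
            by (intro tendsto_eventually) (auto simp: eventually_sequentially)
        next
          case False
          then show ?thesis by (simp add: h_def)
        qed
        from tendsto_mult[OF tendsto_const[of "H x"] this]
        show "(\<lambda>k. H x * h k x) \<longlonglongrightarrow> indicator U x *\<^sub>R H x"
          by (simp add: scaleR_conv_of_real mult.commute)
      qed
      show "AE x in lborel. norm (H x * h k x) \<le> norm (H x)" for k
        using le by (intro AE_I2) (simp add: norm_mult mult_left_le)
    qed (use that H meas in \<open>measurable, auto\<close>)
    then show ?thesis
      unfolding zero[OF cont le] by (rule LIMSEQ_unique[OF tendsto_const, symmetric])
  qed
  have zero_on: "set_lebesgue_integral lborel A H = 0" if "A \<in> sets borel" for A
  proof -
    have int: "set_integrable lborel A H" if "A \<in> sets borel" for A
      unfolding set_integrable_def using H that by (intro integrable_mult_indicator) auto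
    have Int_stable: "Int_stable {S::'a set. open S}" by (auto simp: Int_stable_def)
    have sets: "sets borel = sigma_sets UNIV {S::'a set. open S}"
      unfolding borel_def by (rule sets_measure_of) auto
    have "A \<in> sigma_sets UNIV {S::'a set. open S}" using that sets by auto
    have "{S::'a set. open S} \<subseteq> Pow UNIV" by simp
    from Int_stable \<open>{S::'a set. open S} \<subseteq> Pow UNIV\<close> \<open>A \<in> sigma_sets UNIV {S::'a set. open S}\<close>
    show ?thesis
    proof (induction rule: sigma_sets_induct_disjoint)
      case (basic A)
      then show ?case using open_zero[of A] by (simp add: set_lebesgue_integral_def)
    next
      case empty
      show ?case by (simp add: set_lebesgue_integral_def)
    next
      case (compl A)
      then have "A \<in> sets borel" using sets by auto
      have "set_lebesgue_integral lborel (UNIV - A) H = (LINT x|lborel. H x - indicator A x *\<^sub>R H x)"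
        unfolding set_lebesgue_integral_def
        by (intro Bochner_Integration.integral_cong) (auto simp: indicator_def)
      also have "\<dots> = (LINT x|lborel. H x) - set_lebesgue_integral lborel A H"
        using H int[OF \<open>A \<in> sets borel\<close>] unfolding set_lebesgue_integral_def set_integrable_def
        by (intro Bochner_Integration.integral_diff) auto
      finally show ?case using compl open_zero[of UNIV] by simp
    next
      case (union A)
      then have A: "A i \<in> sets borel" for i using sets by auto
      then have "set_lebesgue_integral lborel (\<Union>i. A i) H = (\<Sum>i. set_lebesgue_integral lborel (A i) H)"
        using union(1) int by (intro lebesgue_integral_countable_add) (auto simp: disjoint_family_on_def)
      then show ?case using union by simp
    qed
  qed
  show ?thesis
    using H zero_on by (intro sigma_finite_measure.density_zero[OF sigma_finite_lborel]) auto
qed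

text \<open>Young's inequality, applied to the factors after normalisation.\<close>

lemma holder_nn_integral:
  fixes f g :: "'a \<Rightarrow> real"
  assumes pq: "1 < p" "1 < q" "1 / p + 1 / q = 1"
    and [measurable]: "f \<in> borel_measurable M" "g \<in> borel_measurable M"
    and nonneg: "\<And>x. 0 \<le> f x" "\<And>x. 0 \<le> g x" "0 \<le> A" "0 \<le> B"
    and f: "(\<integral>\<^sup>+x. ennreal (f x powr p) \<partial>M) \<le> ennreal A"
    and g: "(\<integral>\<^sup>+x. ennreal (g x powr q) \<partial>M) \<le> ennreal B"
  shows "(\<integral>\<^sup>+x. ennreal (f x * g x) \<partial>M) \<le> ennreal (A powr (1 / p) * B powr (1 / q))"
proof (cases "A = 0 \<or> B = 0")
  case True
  have "AE x in M. f x * g x = 0"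
    using True
  proof
    assume "A = 0"
    then have "AE x in M. ennreal (f x powr p) = 0"
      using f by (subst nn_integral_0_iff_AE[symmetric]) auto
    then show ?thesis by eventually_elim (auto simp: ennreal_eq_0_iff)
  next
    assume "B = 0"
    then have "AE x in M. ennreal (g x powr q) = 0"
      using g by (subst nn_integral_0_iff_AE[symmetric]) auto
    then show ?thesis by eventually_elim (auto simp: ennreal_eq_0_iff)
  qed
  then have "(\<integral>\<^sup>+x. ennreal (f x * g x) \<partial>M) = 0"
    by (subst nn_integral_0_iff_AE) (auto elim: eventually_mono)
  then show ?thesis by simp
next
  case False
  then have pos: "0 < A" "0 < B" using nonneg by auto
  define a b where "a = A powr (1 / p)" and "b = B powr (1 / q)"
  have ab: "0 < a" "0 < b" "a powr p = A" "b powr q = B"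
    using pos pq by (auto simp: a_def b_def powr_powr)
  have "f x * g x \<le> (a * b / (p * A)) * f x powr p + (a * b / (q * B)) * g x powr q" for x
  proof -
    have "f x / a * (g x / b) \<le> (f x / a) powr p / p + (g x / b) powr q / q"
      using nonneg ab pq by (intro Youngs_inequality) auto
    then have "(a * b) * (f x / a * (g x / b)) \<le> (a * b) * ((f x / a) powr p / p + (g x / b) powr q / q)"
      using ab by (intro mult_left_mono) auto
    then show ?thesis using ab nonneg by (simp add: powr_divide field_simps)
  qed
  then have "(\<integral>\<^sup>+x. ennreal (f x * g x) \<partial>M) \<le>
     (\<integral>\<^sup>+x. ennreal (a * b / (p * A)) * ennreal (f x powr p) + ennreal (a * b / (q * B)) * ennreal (g x powr q) \<partial>M)"
    using ab pq pos by (intro nn_integral_mono) (simp flip: ennreal_mult ennreal_plus)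
  also have "\<dots> = ennreal (a * b / (p * A)) * (\<integral>\<^sup>+x. ennreal (f x powr p) \<partial>M) + ennreal (a * b / (q * B)) * (\<integral>\<^sup>+x. ennreal (g x powr q) \<partial>M)"
    by (simp add: nn_integral_add nn_integral_cmult)
  also have "\<dots> \<le> ennreal (a * b / (p * A)) * ennreal A + ennreal (a * b / (q * B)) * ennreal B"
    by (intro add_mono mult_left_mono f g) auto
  also have "\<dots> = ennreal (a * b / (p * A) * A + a * b / (q * B) * B)"
    using ab pq pos by (simp flip: ennreal_mult ennreal_plus)
  also have "a * b / (p * A) * A + a * b / (q * B) * B = a * b * (1 / p + 1 / q)"
    using pos by (simp add: field_simps)
  finally show ?thesis using pq by (simp add: a_def b_def)
qed

lemma heat_eq_gaussian:
  "heat r (x - a) = (1 / sqrt (4 * pi * r) ^ CARD('n)) * exp (- (1 / (4 * r)) * (norm (x - a :: real^'n::finite))\<^sup>2)"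
  by (simp add: heat_def)

lemma heat_le:
  assumes "0 < r"
  shows "heat r (x :: real^'n::finite) \<le> 1 / sqrt (4 * pi * r) ^ CARD('n)"
  using assms by (simp add: heat_def divide_right_mono)

text \<open>
  The function \<open>F\<close> need not be integrable, so it is first multiplied by a Gaussian. The product is
  annihilated by all heat kernels, hence, in the limit of small times, by all bounded continuous
  integrable functions; a second Gaussian factor removes the integrability requirement.
\<close>

lemma zero_if_annihilates_schwartz:
  fixes F :: "real^'n::finite \<Rightarrow> complex"
  assumes [measurable]: "F \<in> borel_measurable borel"
    and int: "\<And>\<phi>. \<phi> \<in> schwartz \<Longrightarrow> integrable lborel (\<lambda>x. F x * \<phi> x)"
    and zero: "\<And>\<phi>. \<phi> \<in> schwartz \<Longrightarrow> (LINT x|lborel. F x * \<phi> x) = 0"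
  shows "AE x in lborel. F x = 0"
proof -
  let ?\<gamma> = "\<lambda>x::real^'n. complex_of_real (exp (- 1 * (norm x)\<^sup>2))"
  define H where "H x = F x * ?\<gamma> x" for x
  have H: "integrable lborel H" unfolding H_def by (intro int gaussian_schwartz) simp
  have [measurable]: "H \<in> borel_measurable borel" using H by auto
  define r where "r k = 1 / real (Suc k)" for k
  have r: "0 < r k" for k by (auto simp: r_def)
  have r0: "r \<longlonglongrightarrow> 0" unfolding r_def using lim_1_over_n[where 'a=real] LIMSEQ_Suc by fastforce
  have heat0: "(LINT x|lborel. H x * of_real (heat (r k) (x - a))) = 0" for k a
  proof -
    let ?c = "1 / sqrt (4 * pi * r k) ^ CARD('n)"
    have "(\<lambda>x. (of_real ?c * of_real (exp (- (1 / (4 * r k)) * (norm (x - a))\<^sup>2))) * ?\<gamma> x) \<in> schwartz"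
      using r[of k] by (intro slow_mult_schwartz slow.mult slow.const slow.gauss gaussian_schwartz) auto
    from zero[OF this] show ?thesis
      unfolding H_def heat_eq_gaussian of_real_mult by (simp only: mult_ac)
  qed
  have H0: "(LINT x|lborel. H x * h x) = 0"
    if cont: "continuous_on UNIV h" and le: "\<And>x. norm (h x) \<le> 1" and h: "integrable lborel h" for h :: "real^'n \<Rightarrow> complex"
  proof -
    have [measurable]: "h \<in> borel_measurable borel" using cont by (rule borel_measurable_continuous_onI)
    have smooth0: "(LINT x|lborel. H x * (LINT z|lborel. h (x + z) * of_real (heat (r k) z))) = 0" for k
    proof -
      have "(LINT x|lborel. H x * (LINT z|lborel. h (x + z) * of_real (heat (r k) z))) =
        (LINT x|lborel. (LINT y|lborel. H x * h y * of_real (heat (r k) (x - y))))"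
      proof (rule Bochner_Integration.integral_cong[OF refl])
        fix x
        have "(LINT y|lborel. H x * h y * of_real (heat (r k) (x - y))) = H x * (LINT y|lborel. h y * of_real (heat (r k) (x - y)))"
          by (simp add: mult.assoc)
        also have "(LINT y|lborel. h y * of_real (heat (r k) (x - y))) = (LINT z|lborel. h (x + z) * of_real (heat (r k) z))"
          by (subst integral_lborel_affine[of _ 1 x]) (auto simp: heat_def)
        finally show "H x * (LINT z|lborel. h (x + z) * of_real (heat (r k) z)) = (LINT y|lborel. H x * h y * of_real (heat (r k) (x - y)))" ..
      qed
      also have "\<dots> = (LINT y|lborel. (LINT x|lborel. H x * h y * of_real (heat (r k) (x - y))))"
      proof (rule lborel_pair.Fubini_integral[symmetric], rule integrable_pair_mult_bounded[OF H h])
        show "(\<lambda>(x, y). complex_of_real (heat (r k) (x - y))) \<in> borel_measurable (borel \<Otimes>\<^sub>M borel)"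
          by measurable
        show "norm (complex_of_real (heat (r k) (x - y))) \<le> 1 / sqrt (4 * pi * r k) ^ CARD('n)" for x y :: "real^'n"
          using heat_le[OF r[of k], of "x - y"] r[of k] by (simp add: less_imp_le)
      qed
      also have "\<dots> = (LINT y|lborel. h y * (LINT x|lborel. H x * of_real (heat (r k) (x - y))))"
        by (subst integral_mult_right_zero[symmetric]) (simp only: mult_ac)
      also have "\<dots> = 0" unfolding heat0 by simp
      finally show ?thesis .
    qed
    have "(\<lambda>k. LINT x|lborel. H x * (LINT z|lborel. h (x + z) * of_real (heat (r k) z))) \<longlonglongrightarrow> (LINT x|lborel. H x * h x)"
    proof (rule integral_dominated_convergence[where w = "\<lambda>x. norm (H x)"])
      show "AE x in lborel. (\<lambda>k. H x * (LINT z|lborel. h (x + z) * of_real (heat (r k) z))) \<longlonglongrightarrow> H x * h x"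
        using cont by (intro AE_I2 tendsto_mult tendsto_const heat_approximate_identity[OF _ le])
          (auto simp: r r0 continuous_on_eq_continuous_at)
      show "AE x in lborel. norm (H x * (LINT z|lborel. h (x + z) * of_real (heat (r k) z))) \<le> norm (H x)" for k
      proof (rule AE_I2)
        fix x
        have "norm (LINT z|lborel. h (x + z) * of_real (heat (r k) z)) \<le> (LINT z|lborel. heat (r k) (z :: real^'n))"
        proof (rule order_trans[OF integral_norm_bound integral_mono'])
          show "integrable lborel (heat (r k) :: real^'n \<Rightarrow> real)" using r[of k] by simp
          show "norm (h (x + z) * of_real (heat (r k) z)) \<le> heat (r k) z" for z
            using le[of "x + z"] r[of k] by (simp add: norm_mult mult_left_le_one_le less_imp_le)
        qed (use r[of k] in \<open>simp add: less_imp_le\<close>)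
        then show "norm (H x * (LINT z|lborel. h (x + z) * of_real (heat (r k) z))) \<le> norm (H x)"
          using r[of k] by (simp add: norm_mult mult_left_le)
      qed
    qed (use H in \<open>measurable, auto\<close>)
    then show ?thesis unfolding smooth0 by (rule LIMSEQ_unique[OF tendsto_const, symmetric])
  qed
  have "AE x in lborel. H x * ?\<gamma> x = 0"
  proof (rule integral_zero_if_annihilates_continuous)
    show "integrable lborel (\<lambda>x. H x * ?\<gamma> x)"
      by (rule Bochner_Integration.integrable_bound[OF H]) (auto simp: norm_mult mult_left_le)
    fix h :: "real^'n \<Rightarrow> complex" assume h: "continuous_on UNIV h" "\<And>x. norm (h x) \<le> 1"
    then have [measurable]: "h \<in> borel_measurable borel" by (intro borel_measurable_continuous_onI)
    have "integrable lborel ?\<gamma>" by (intro integrable_schwartz gaussian_schwartz) simp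
    then have "integrable lborel (\<lambda>x. ?\<gamma> x * h x)"
      by (rule Bochner_Integration.integrable_bound) (auto simp: norm_mult h mult_left_le)
    moreover have "continuous_on UNIV (\<lambda>x. ?\<gamma> x * h x)" by (intro continuous_intros h)
    moreover have "norm (?\<gamma> x * h x) \<le> 1" for x
      unfolding norm_mult using h(2)[of x] by (intro mult_le_one) auto
    ultimately have "(LINT x|lborel. H x * (?\<gamma> x * h x)) = 0" by (intro H0)
    then show "(LINT x|lborel. H x * ?\<gamma> x * h x) = 0" by (simp only: mult.assoc)
  qed
  then show ?thesis by eventually_elim (simp add: H_def)
qed

section \<open>The inverse symbol as a Laplace transform\<close>

lemma borel_measurable_rGamma [measurable]: "(rGamma :: real \<Rightarrow> real) \<in> borel_measurable borel"
  by (intro borel_measurable_continuous_onI continuous_intros)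

text \<open>
  The Laplace transform at \<open>c\<close> of the inner function \<open>r powr (t - 1) * exp (- lam * r) / Gamma t\<close> is
  \<open>(lam + c) powr (- t)\<close>; integrating over \<open>t \<ge> s\<close> produces the factor \<open>1 / ln (lam + c)\<close>.
\<close>

definition laplace_weight :: "real \<Rightarrow> real \<Rightarrow> real \<Rightarrow> ennreal" where
  "laplace_weight s lam r =
     (\<integral>\<^sup>+t. ennreal (r powr (t - 1) * exp (- lam * r) * rGamma t) * indicator {s..} t \<partial>lborel)"

definition laplace_measure :: "real \<Rightarrow> real \<Rightarrow> real measure" where
  "laplace_measure s lam = density lborel (\<lambda>r. laplace_weight s lam r * indicator {0<..} r)"

lemma measurable_laplace_weight [measurable]: "laplace_weight s lam \<in> borel_measurable borel"
  unfolding laplace_weight_def[abs_def] by measurable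

lemma sets_laplace_measure [measurable_cong, simp]: "sets (laplace_measure s lam) = sets borel"
  by (simp add: laplace_measure_def)

lemma space_laplace_measure [simp]: "space (laplace_measure s lam) = UNIV"
  by (simp add: laplace_measure_def)

lemma AE_laplace_measure_pos: "AE r in laplace_measure s lam. 0 < r"
  unfolding laplace_measure_def by (subst AE_density) (auto simp: indicator_def)

lemma nn_integral_gamma:
  fixes a t :: real
  assumes "0 < a" "0 < t"
  shows "(\<integral>\<^sup>+r. ennreal (r powr (t - 1) * exp (- a * r) * rGamma t) * indicator {0<..} r \<partial>lborel) = ennreal (a powr (- t))"
proof -
  have pos: "0 < rGamma t" using Gamma_real_pos[OF \<open>0 < t\<close>] by (simp add: rGamma_inverse_Gamma)
  have eq: "ennreal (r powr (t - 1) * exp (- a * r) * rGamma t) * indicator {0<..} r =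
     ennreal (a powr (- t) * rGamma t) * (ennreal a * ennreal (indicator {0..} (0 + a * r) * (0 + a * r) powr (t - 1) / exp (0 + a * r)))" for r
  proof (cases "0 < r")
    case True
    have "r powr (t - 1) * exp (- a * r) * rGamma t = a powr (- t) * rGamma t * (a * ((a * r) powr (t - 1) / exp (a * r)))"
      using True assms by (simp add: powr_mult exp_minus powr_diff powr_minus field_simps)
    then show ?thesis using True assms pos
      by (simp flip: ennreal_mult add: less_imp_le)
  next
    case False
    then have "r < 0 \<or> r = 0" by auto
    then show ?thesis using assms by (auto simp: mult_less_0_iff indicator_def not_le)
  qed
  have "(\<integral>\<^sup>+r. ennreal (r powr (t - 1) * exp (- a * r) * rGamma t) * indicator {0<..} r \<partial>lborel) =
    ennreal (a powr (- t) * rGamma t) * (ennreal \<bar>a\<bar> * (\<integral>\<^sup>+r. ennreal (indicator {0..} (0 + a * r) * (0 + a * r) powr (t - 1) / exp (0 + a * r)) \<partial>lborel))"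
    unfolding eq using assms by (simp add: nn_integral_cmult)
  also have "\<dots> = ennreal (a powr (- t) * rGamma t) * ennreal (Gamma t)"
    unfolding Gamma_conv_nn_integral_real[OF \<open>0 < t\<close>]
    using assms by (subst nn_integral_real_affine[symmetric]) auto
  also have "\<dots> = ennreal (a powr (- t))"
    using pos Gamma_real_pos[OF \<open>0 < t\<close>] by (simp flip: ennreal_mult add: rGamma_inverse_Gamma less_imp_le)
  finally show ?thesis .
qed

text \<open>The part of the Gamma integral over \<open>[1, 2]\<close> is bounded below uniformly in the exponent.\<close>

lemma rGamma_le:
  assumes "0 < t"
  shows "rGamma t \<le> 2 * exp (2::real)"
proof -
  have "ennreal (exp (- 2) / 2) = (\<integral>\<^sup>+x. ennreal (exp (- 2) / 2) * indicator {1..2::real} x \<partial>lborel)"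
    by (subst nn_integral_cmult_indicator) auto
  also have "\<dots> \<le> (\<integral>\<^sup>+x. ennreal (indicator {0..} x * x powr (t - 1) / exp x) \<partial>lborel)"
  proof (rule nn_integral_mono)
    fix x :: real
    show "ennreal (exp (- 2) / 2) * indicator {1..2} x \<le> ennreal (indicator {0..} x * x powr (t - 1) / exp x)"
    proof (cases "x \<in> {1..2}")
      case True
      have "exp (- 2) * (1 / 2) \<le> exp (- x) * x powr (t - 1)"
      proof (intro mult_mono)
        have "1 / 2 \<le> x powr (- 1)" using True by (simp add: powr_minus_divide field_simps)
        also have "\<dots> \<le> x powr (t - 1)" using True assms by (intro powr_mono) auto
        finally show "1 / 2 \<le> x powr (t - 1)" .
      qed (use True in auto)
      also have "exp (- x) * x powr (t - 1) = x powr (t - 1) / exp x"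
        by (simp add: exp_minus field_simps)
      finally have "exp (- 2) / 2 \<le> x powr (t - 1) / exp x" by simp
      from ennreal_leI[OF this] show ?thesis using True by simp
    qed simp
  qed
  also have "\<dots> = ennreal (Gamma t)" using Gamma_conv_nn_integral_real[OF assms] by simp
  finally have "exp (- 2) / 2 \<le> Gamma t"
    using Gamma_real_pos[OF assms] by (simp add: ennreal_le_iff)
  then show ?thesis
    using Gamma_real_pos[OF assms] by (simp add: rGamma_inverse_Gamma exp_minus field_simps)
qed

lemma nn_integral_powr_exponent:
  fixes a s :: real
  assumes "1 < a"
  shows "(\<integral>\<^sup>+t. ennreal (a powr (- t)) * indicator {s..} t \<partial>lborel) = ennreal (a powr (- s) / ln a)"
proof -
  have "(\<integral>\<^sup>+t. ennreal (a powr (- t)) * indicator {s..} t \<partial>lborel) = ennreal (0 - (- (a powr (- s)) / ln a))"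
  proof (rule nn_integral_FTC_atLeast)
    show "((\<lambda>t. - (a powr (- t)) / ln a) has_real_derivative a powr (- t)) (at t)" for t
      using assms by (auto intro!: derivative_eq_intros simp: field_simps)
    have "((\<lambda>t. a powr (- t)) \<longlongrightarrow> 0) at_top" using assms by real_asymp
    from tendsto_divide[OF tendsto_minus[OF this] tendsto_const[of "ln a"]] assms
    show "((\<lambda>t. - (a powr (- t)) / ln a) \<longlongrightarrow> 0) at_top" by simp
  qed (use assms in auto)
  then show ?thesis by simp
qed

lemma nn_integral_laplace_measure_exp:
  assumes "0 < s" "1 < lam" "0 \<le> c"
  shows "(\<integral>\<^sup>+r. ennreal (exp (- c * r)) \<partial>laplace_measure s lam) = ennreal ((lam + c) powr (- s) / ln (lam + c))"
proof -
  have "(\<integral>\<^sup>+r. ennreal (exp (- c * r)) \<partial>laplace_measure s lam) =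
    (\<integral>\<^sup>+r. (\<integral>\<^sup>+t. ennreal (r powr (t - 1) * exp (- (lam + c) * r) * rGamma t) * indicator {0<..} r * indicator {s..} t \<partial>lborel) \<partial>lborel)"
    unfolding laplace_measure_def
  proof (subst nn_integral_density, measurable, rule nn_integral_cong)
    fix r :: real
    have "ennreal (r powr (t - 1) * exp (- (lam + c) * r) * rGamma t) * indicator {0<..} r * indicator {s..} t =
      (ennreal (r powr (t - 1) * exp (- lam * r) * rGamma t) * indicator {s..} t) * (indicator {0<..} r * ennreal (exp (- c * r)))" for t
    proof -
      have "exp (- (lam + c) * r) = exp (- lam * r) * exp (- c * r)"
        by (simp add: algebra_simps flip: exp_add)
      then have "r powr (t - 1) * exp (- (lam + c) * r) * rGamma t = (r powr (t - 1) * exp (- lam * r) * rGamma t) * exp (- c * r)"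
        by (simp only: mult_ac)
      then show ?thesis
        by (simp only: ennreal_mult''[OF exp_ge_zero]) (simp only: mult_ac)
    qed
    then show "laplace_weight s lam r * indicator {0<..} r * ennreal (exp (- c * r)) =
      (\<integral>\<^sup>+t. ennreal (r powr (t - 1) * exp (- (lam + c) * r) * rGamma t) * indicator {0<..} r * indicator {s..} t \<partial>lborel)"
      unfolding laplace_weight_def by (simp only:) (subst nn_integral_multc, auto simp: mult.assoc)
  qed
  also have "\<dots> = (\<integral>\<^sup>+t. (\<integral>\<^sup>+r. ennreal (r powr (t - 1) * exp (- (lam + c) * r) * rGamma t) * indicator {0<..} r * indicator {s..} t \<partial>lborel) \<partial>lborel)"
    by (rule lborel_pair.Fubini') measurable
  also have "\<dots> = (\<integral>\<^sup>+t. ennreal ((lam + c) powr (- t)) * indicator {s..} t \<partial>lborel)"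
  proof (rule nn_integral_cong)
    fix t :: real
    show "(\<integral>\<^sup>+r. ennreal (r powr (t - 1) * exp (- (lam + c) * r) * rGamma t) * indicator {0<..} r * indicator {s..} t \<partial>lborel) =
       ennreal ((lam + c) powr (- t)) * indicator {s..} t"
      using assms by (cases "s \<le> t") (simp_all add: nn_integral_gamma[of "lam + c" t, simplified])
  qed
  also have "\<dots> = ennreal ((lam + c) powr (- s) / ln (lam + c))"
    using assms by (intro nn_integral_powr_exponent) auto
  finally show ?thesis .
qed

lemma emeasure_laplace_measure:
  assumes "0 < s" "1 < lam"
  shows "emeasure (laplace_measure s lam) UNIV = ennreal (lam powr (- s) / ln lam)"
  using nn_integral_laplace_measure_exp[of s lam 0] assms by simp

lemma finite_laplace_measure:
  assumes "0 < s" "1 < lam"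
  shows "finite_measure (laplace_measure s lam)"
  by (rule finite_measureI) (simp add: emeasure_laplace_measure assms)

text \<open>
  This is where the logarithm enters: integration over all powers \<open>t \<ge> s\<close> gains the factor
  \<open>1 / ln (1 / r)\<close> over the weight \<open>r powr (s - 1)\<close> that belongs to the symbol without logarithm.
\<close>

lemma laplace_weight_le:
  assumes "0 < s" "0 < lam" "0 < r" "r < 1"
  shows "laplace_weight s lam r \<le> ennreal (2 * exp 2 * (r powr (s - 1) / ln (1 / r)))"
proof -
  have "laplace_weight s lam r \<le> (\<integral>\<^sup>+t. ennreal (2 * exp 2 / r) * (ennreal ((1 / r) powr (- t)) * indicator {s..} t) \<partial>lborel)"
    unfolding laplace_weight_def
  proof (rule nn_integral_mono)
    fix t :: real
    show "ennreal (r powr (t - 1) * exp (- lam * r) * rGamma t) * indicator {s..} t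
      \<le> ennreal (2 * exp 2 / r) * (ennreal ((1 / r) powr (- t)) * indicator {s..} t)"
    proof (cases "s \<le> t")
      case True
      have "r powr (t - 1) * exp (- lam * r) * rGamma t \<le> r powr (t - 1) * 1 * (2 * exp 2)"
        using True assms Gamma_real_pos[of t]
        by (intro mult_mono rGamma_le) (auto simp: rGamma_inverse_Gamma less_imp_le)
      also have "\<dots> = (2 * exp 2 / r) * (1 / r) powr (- t)"
        using assms by (simp add: powr_diff powr_minus powr_divide)
      finally show ?thesis using True assms by (simp flip: ennreal_mult add: ennreal_leI)
    qed simp
  qed
  also have "\<dots> = ennreal (2 * exp 2 / r) * ennreal ((1 / r) powr (- s) / ln (1 / r))"
    using assms by (subst nn_integral_cmult) (auto simp: nn_integral_powr_exponent)
  also have "\<dots> = ennreal (2 * exp 2 * (r powr (s - 1) / ln (1 / r)))"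
  proof -
    have "0 < ln (1 / r)" using assms by (subst ln_gt_zero_iff) auto
    then show ?thesis
      using assms by (subst ennreal_mult[symmetric]) (simp_all add: powr_diff powr_minus powr_divide field_simps del: ln_div ln_divide_pos)
  qed
  finally show ?thesis .
qed

section \<open>The kernel of the inverse operator\<close>

text \<open>
  Uniformity in \<open>r\<close> provides a majorant for all integrals of the heat kernel in \<open>r\<close> at points away
  from the origin.
\<close>

lemma heat_bounded_away_from_0:
  assumes "0 < d"
  obtains C where "\<And>r x. 0 < r \<Longrightarrow> d \<le> norm (x :: real^'n::finite) \<Longrightarrow> heat r x \<le> C"
proof
  fix r :: real and x :: "real^'n" assume r: "0 < r" and x: "d \<le> norm x"
  let ?n = "CARD('n)" and ?b = "d\<^sup>2 / 4"
  have b: "0 < ?b" using assms by simp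
  have "heat r x = (1 / sqrt (4 * pi)) ^ ?n * (sqrt (1 / r) ^ ?n * exp (- (norm x)\<^sup>2 / (4 * r)))"
    using r by (simp add: heat_def real_sqrt_mult real_sqrt_divide power_mult_distrib power_divide)
  also have "\<dots> \<le> (1 / sqrt (4 * pi)) ^ ?n * ((1 + (1 / r) ^ ?n) * exp (- ?b * (1 / r)))"
  proof (intro mult_left_mono mult_mono)
    show "sqrt (1 / r) ^ ?n \<le> 1 + (1 / r) ^ ?n"
    proof (cases "1 / r \<le> 1")
      case True
      then have "sqrt (1 / r) ^ ?n \<le> 1" using r by (intro power_le_one) auto
      then show ?thesis using r by (smt (verit) zero_le_power zero_le_divide_1_iff)
    next
      case False
      then have "sqrt (1 / r) \<le> 1 / r" using r by (intro real_le_lsqrt) (auto simp: power2_eq_square mult_le_cancel_left1 field_simps)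
      then have "sqrt (1 / r) ^ ?n \<le> (1 / r) ^ ?n" using r by (intro power_mono) auto
      then show ?thesis by simp
    qed
    have "d\<^sup>2 \<le> (norm x)\<^sup>2" using assms x by (intro power_mono) auto
    then have "d\<^sup>2 / (4 * r) \<le> (norm x)\<^sup>2 / (4 * r)" using r by (intro divide_right_mono) auto
    then show "exp (- (norm x)\<^sup>2 / (4 * r)) \<le> exp (- ?b * (1 / r))" by simp
  qed (use r in auto)
  also have "\<dots> \<le> (1 / sqrt (4 * pi)) ^ ?n * (1 + fact ?n / ?b ^ ?n)"
  proof (intro mult_left_mono)
    have "(1 / r) ^ ?n * exp (- ?b * (1 / r)) \<le> fact ?n / ?b ^ ?n"
      using b r by (intro power_mult_exp_neg_le) auto
    moreover have "exp (- ?b * (1 / r)) \<le> 1" using b r by simp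
    ultimately show "(1 + (1 / r) ^ ?n) * exp (- ?b * (1 / r)) \<le> 1 + fact ?n / ?b ^ ?n"
      unfolding distrib_right mult_1_left by linarith
  qed simp
  finally show "heat r x \<le> (1 / sqrt (4 * pi)) ^ ?n * (1 + fact ?n / ?b ^ ?n)" .
qed

text \<open>The integral may diverge at the origin, where the value is then the default 0.\<close>

definition log_kernel :: "real \<Rightarrow> real \<Rightarrow> real^'n::finite \<Rightarrow> real" where
  "log_kernel s lam x = (LINT r|laplace_measure s lam. heat r x)"

context
  fixes s lam :: real
  assumes s: "0 < s" and lam: "1 < lam"
begin

interpretation finite_measure "laplace_measure s lam"
  using s lam by (rule finite_laplace_measure)

interpretation L: pair_sigma_finite "laplace_measure s lam" "lborel :: (real^'n::finite) measure" ..

lemma measurable_heat_pair: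
  "(\<lambda>(r, x). heat r x) \<in> borel_measurable (laplace_measure s lam \<Otimes>\<^sub>M (borel :: (real^'n::finite) measure))"
  unfolding heat_def[abs_def] by measurable

lemma integrable_heat_laplace:
  assumes "x \<noteq> (0 :: real^'n::finite)"
  shows "integrable (laplace_measure s lam) (\<lambda>r. heat r x)"
proof -
  obtain C where C: "\<And>r y. 0 < r \<Longrightarrow> norm x \<le> norm (y :: real^'n) \<Longrightarrow> heat r y \<le> C"
    using heat_bounded_away_from_0[of "norm x"] assms by auto
  have "AE r in laplace_measure s lam. norm (heat r x) \<le> C"
    using AE_laplace_measure_pos by eventually_elim (use C in \<open>simp add: less_imp_le\<close>)
  then show ?thesis
    using measurable_heat_pair by (intro integrable_const_bound) (auto simp: heat_def)
qed

lemma log_kernel_nonneg: "0 \<le> log_kernel s lam x"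
  unfolding log_kernel_def
  by (rule Bochner_Integration.integral_nonneg_AE) (use AE_laplace_measure_pos in \<open>eventually_elim, simp\<close>)

lemma log_kernel_eq_nn_integral:
  assumes "x \<noteq> (0 :: real^'n::finite)"
  shows "ennreal (log_kernel s lam x) = (\<integral>\<^sup>+r. ennreal (heat r x) \<partial>laplace_measure s lam)"
proof -
  have "AE r in laplace_measure s lam. 0 \<le> heat r x"
    using AE_laplace_measure_pos by eventually_elim simp
  with integrable_heat_laplace[OF assms] show ?thesis
    unfolding log_kernel_def by (rule nn_integral_eq_integral[symmetric])
qed

lemma isCont_log_kernel:
  assumes "x \<noteq> (0 :: real^'n::finite)"
  shows "isCont (log_kernel s lam) x"
  unfolding continuous_at_sequentially
proof (intro allI impI)
  fix y assume y: "y \<longlonglongrightarrow> x"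
  have "0 < norm x / 2" using assms by simp
  then obtain C where C: "\<And>r y. 0 < r \<Longrightarrow> norm x / 2 \<le> norm (y :: real^'n) \<Longrightarrow> heat r y \<le> C"
    using heat_bounded_away_from_0 by blast
  have "\<forall>\<^sub>F k in sequentially. norm x / 2 < norm (y k)"
    using tendsto_norm[OF y] \<open>0 < norm x / 2\<close> by (intro order_tendstoD(1)) auto
  then obtain N where N: "\<And>k. N \<le> k \<Longrightarrow> norm x / 2 \<le> norm (y k)"
    unfolding eventually_sequentially by (meson less_imp_le)
  show "(log_kernel s lam \<circ> y) \<longlonglongrightarrow> log_kernel s lam x"
    unfolding comp_def log_kernel_def
  proof (rule LIMSEQ_offset[where k = N], rule integral_dominated_convergence[where w = "\<lambda>_. C"])
    have yN: "(\<lambda>k. y (k + N)) \<longlonglongrightarrow> x" using y by (rule LIMSEQ_ignore_initial_segment)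
    show "AE r in laplace_measure s lam. (\<lambda>k. heat r (y (k + N))) \<longlonglongrightarrow> heat r x"
      using AE_laplace_measure_pos
    proof eventually_elim
      case (elim r)
      then show ?case unfolding heat_def by (intro tendsto_intros yN) auto
    qed
    show "AE r in laplace_measure s lam. norm (heat r (y (k + N))) \<le> C" for k
      using AE_laplace_measure_pos by eventually_elim (use C N in \<open>simp add: less_imp_le\<close>)
  qed (auto simp: heat_def)
qed

lemma measurable_log_kernel [measurable]:
  "(log_kernel s lam :: real^'n::finite \<Rightarrow> real) \<in> borel_measurable borel"
proof -
  have "(\<lambda>x::real^'n. LINT r|laplace_measure s lam. heat r x) \<in> borel_measurable borel"
  proof (rule borel_measurable_lebesgue_integral)
    show "(\<lambda>(x::real^'n, r). heat r x) \<in> borel_measurable (borel \<Otimes>\<^sub>M laplace_measure s lam)"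
      unfolding heat_def by measurable
  qed
  then show ?thesis by (simp add: log_kernel_def[abs_def])
qed

lemma log_kernel_norm:
  fixes x y :: "real^'n::finite"
  shows "norm x = norm y \<Longrightarrow> log_kernel s lam x = log_kernel s lam y"
  by (simp add: log_kernel_def heat_def)

lemma nn_integral_log_kernel:
  "(\<integral>\<^sup>+x. ennreal (log_kernel s lam (x :: real^'n::finite)) \<partial>lborel) = ennreal (lam powr (- s) / ln lam)"
proof -
  have "(\<integral>\<^sup>+x. ennreal (log_kernel s lam (x :: real^'n)) \<partial>lborel) =
     (\<integral>\<^sup>+x. (\<integral>\<^sup>+r. ennreal (heat r (x :: real^'n)) \<partial>laplace_measure s lam) \<partial>lborel)"
    using AE_lborel_singleton[of "0 :: real^'n"]
    by (intro nn_integral_cong_AE) (auto simp: log_kernel_eq_nn_integral elim!: eventually_mono)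
  also have "\<dots> = (\<integral>\<^sup>+r. (\<integral>\<^sup>+x. ennreal (heat r (x :: real^'n)) \<partial>lborel) \<partial>laplace_measure s lam)"
    by (rule L.Fubini') (unfold heat_def, measurable)
  also have "\<dots> = (\<integral>\<^sup>+r. 1 \<partial>laplace_measure s lam)"
  proof (rule nn_integral_cong_AE)
    show "AE r in laplace_measure s lam. (\<integral>\<^sup>+x. ennreal (heat r (x :: real^'n)) \<partial>lborel) = 1"
      using AE_laplace_measure_pos by eventually_elim (simp add: nn_integral_eq_integral less_imp_le)
  qed
  finally show ?thesis using emeasure_laplace_measure[OF s lam] by simp
qed

lemma integrable_log_kernel: "integrable lborel (log_kernel s lam :: real^'n::finite \<Rightarrow> real)"
  by (rule integrableI_nonneg) (auto simp: nn_integral_log_kernel log_kernel_nonneg)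

text \<open>
  Fubini's theorem reduces the transform of the kernel to those of the heat kernels, that is, to the
  Laplace transform of \<open>laplace_measure\<close>.
\<close>

lemma fourier_log_kernel:
  fixes \<xi> :: "real^'n::finite"
  shows "(LINT x|lborel. complex_of_real (log_kernel s lam x) * cis (c * (x \<bullet> \<xi>))) =
     of_real ((lam + c\<^sup>2 * (norm \<xi>)\<^sup>2) powr (- s) / ln (lam + c\<^sup>2 * (norm \<xi>)\<^sup>2))"
proof -
  have meas: "(\<lambda>(r, x::real^'n). complex_of_real (heat r x) * cis (c * (x \<bullet> \<xi>))) \<in> borel_measurable (laplace_measure s lam \<Otimes>\<^sub>M lborel)"
    unfolding heat_def by measurable
  have int: "integrable (laplace_measure s lam \<Otimes>\<^sub>M lborel) (\<lambda>(r, x::real^'n). complex_of_real (heat r x) * cis (c * (x \<bullet> \<xi>)))"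
  proof (rule L.Fubini_integrable[OF meas])
    have eq: "AE r in laplace_measure s lam. (LINT x|lborel. norm (complex_of_real (heat r (x::real^'n)) * cis (c * (x \<bullet> \<xi>)))) = 1"
      using AE_laplace_measure_pos
      by eventually_elim (simp add: norm_mult less_imp_le)
    show "integrable (laplace_measure s lam) (\<lambda>r. LINT x|lborel. norm (case (r, x::real^'n) of (r, x) \<Rightarrow> complex_of_real (heat r x) * cis (c * (x \<bullet> \<xi>))))"
      using eq by (subst integrable_cong_AE[where g = "\<lambda>_. 1"]) (unfold heat_def, auto)
    show "AE r in laplace_measure s lam. integrable lborel (\<lambda>x::real^'n. case (r, x) of (r, x) \<Rightarrow> complex_of_real (heat r x) * cis (c * (x \<bullet> \<xi>)))"
      using AE_laplace_measure_pos
      by eventually_elim (auto intro!: integrable_mult_cis)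
  qed
  have "(LINT x|lborel. complex_of_real (log_kernel s lam x) * cis (c * (x \<bullet> \<xi>))) =
     (LINT x|lborel. (LINT r|laplace_measure s lam. complex_of_real (heat r x) * cis (c * (x \<bullet> \<xi>))))"
    by (simp add: log_kernel_def)
  also have "\<dots> = (LINT r|laplace_measure s lam. (LINT x|lborel. complex_of_real (heat r x) * cis (c * (x \<bullet> \<xi>))))"
    using int by (rule L.Fubini_integral)
  also have "\<dots> = (LINT r|laplace_measure s lam. complex_of_real (exp (- (c\<^sup>2 * (norm \<xi>)\<^sup>2) * r)))"
  proof (rule integral_cong_AE)
    show "AE r in laplace_measure s lam. (LINT x|lborel. complex_of_real (heat r x) * cis (c * (x \<bullet> \<xi>))) =
        complex_of_real (exp (- (c\<^sup>2 * (norm \<xi>)\<^sup>2) * r))"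
      using AE_laplace_measure_pos by eventually_elim (simp add: integral_heat_cis mult_ac)
  qed (unfold heat_def, measurable)
  also have "\<dots> = of_real (LINT r|laplace_measure s lam. exp (- (c\<^sup>2 * (norm \<xi>)\<^sup>2) * r))"
    by (rule integral_complex_of_real)
  also have "(LINT r|laplace_measure s lam. exp (- (c\<^sup>2 * (norm \<xi>)\<^sup>2) * r)) =
     (lam + c\<^sup>2 * (norm \<xi>)\<^sup>2) powr (- s) / ln (lam + c\<^sup>2 * (norm \<xi>)\<^sup>2)"
  proof -
    have "1 < lam + c\<^sup>2 * (norm \<xi>)\<^sup>2" using lam by (smt (verit) zero_le_mult_iff zero_le_power2)
    then show ?thesis
      using s lam by (subst integral_eq_nn_integral) (simp_all add: nn_integral_laplace_measure_exp[OF s lam, of "c\<^sup>2 * (norm \<xi>)\<^sup>2", simplified])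
  qed
  finally show ?thesis .
qed

end

section \<open>Integrability of the kernel to the conjugate exponent\<close>

text \<open>
  Small times \<open>r\<close> mean \<open>r < exp (- 1)\<close> below, so that powers of \<open>ln (1 / r)\<close> are monotone in the
  exponent and stay away from the pole at \<open>r = 1\<close>.
\<close>

lemma one_less_ln_inverse:
  fixes r :: real
  assumes "0 < r" "r < exp (- 1)"
  shows "1 < ln (1 / r)"
proof -
  have "ln r < - 1" using assms by (metis exp_gt_zero exp_less_cancel_iff exp_ln)
  then show ?thesis using assms by (simp add: ln_div)
qed

text \<open>The antiderivative is \<open>ln (1 / r) powr (1 - q) / (q - 1)\<close>, which tends to 0 at 0.\<close>

lemma nn_integral_inverse_log_power_finite:
  assumes "1 < (q::real)"
  shows "(\<integral>\<^sup>+r. ennreal (1 / r * ln (1 / r) powr (- q)) * indicator {0<..<exp (- 1)} r \<partial>lborel) < \<infinity>"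
proof -
  let ?f = "\<lambda>r::real. 1 / r * ln (1 / r) powr (- q)"
  let ?F = "\<lambda>r::real. ln (1 / r) powr (1 - q) / (q - 1)"
  have "set_integrable lborel (einterval (ereal 0) (ereal (exp (- 1)))) ?f"
  proof (rule interval_integral_FTC_nonneg(1))
    fix r :: real assume "ereal 0 < ereal r" "ereal r < ereal (exp (- 1))"
    then have r: "0 < r" "r < exp (- 1)" by auto
    have l: "1 < ln (1 / r)" using one_less_ln_inverse r by blast
    have "((\<lambda>r. ln (1 / r)) has_real_derivative (- 1 / r)) (at r)"
      using r by (auto intro!: derivative_eq_intros simp: power2_eq_square)
    from DERIV_powr[OF this, of "\<lambda>_. 1 - q" 0] l
    have "((\<lambda>r. ln (1 / r) powr (1 - q)) has_real_derivative ln (1 / r) powr (1 - q) * ((- 1 / r) * (1 - q) / ln (1 / r))) (at r)"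
      by simp
    from DERIV_cdivide[OF this, of "q - 1"]
    moreover have "ln (1 / r) powr (1 - q) * ((- 1 / r) * (1 - q) / ln (1 / r)) / (q - 1) = ?f r"
    proof -
      have "\<bar>ln (1 / r)\<bar> = ln (1 / r)" using l by simp
      then show ?thesis
        using l assms r by (simp add: powr_diff powr_minus divide_simps)
    qed
    ultimately show "(?F has_real_derivative ?f r) (at r)"
      by (simp only:)
    show "isCont ?f r"
      using l r by (intro continuous_intros) (auto simp: ln_div)
  next
    have "(?F \<longlongrightarrow> 0) (at_right 0)" using assms by real_asymp
    then show "((?F \<circ> real_of_ereal) \<longlongrightarrow> 0) (at_right (ereal 0))"
      by (simp only: ereal_tendsto_simps)
    have "isCont ?F (exp (- 1))" using assms by (intro continuous_intros) (auto simp: ln_div)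
    then have "(?F \<longlongrightarrow> ?F (exp (- 1))) (at_left (exp (- 1)))"
      by (simp only: isCont_def filterlim_at_split)
    then show "((?F \<circ> real_of_ereal) \<longlongrightarrow> ?F (exp (- 1))) (at_left (ereal (exp (- 1))))"
      by (simp only: ereal_tendsto_simps)
  qed auto
  then have "integrable lborel (\<lambda>r. indicator {0<..<exp (- 1)} r *\<^sub>R ?f r)"
    by (simp add: set_integrable_def einterval_eq)
  then have "(\<integral>\<^sup>+r. ennreal (norm (indicator {0<..<exp (- 1)} r *\<^sub>R ?f r)) \<partial>lborel) < \<infinity>"
    unfolding integrable_iff_bounded by blast
  also have "(\<integral>\<^sup>+r. ennreal (norm (indicator {0<..<exp (- 1)} r *\<^sub>R ?f r)) \<partial>lborel) =
     (\<integral>\<^sup>+r. ennreal (?f r) * indicator {0<..<exp (- 1)} r \<partial>lborel)"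
    by (intro nn_integral_cong) (auto simp: indicator_def)
  finally show ?thesis .
qed

lemma powr_mult_exp_neg_le:
  fixes u k :: real assumes "0 < k" "0 < u"
  shows "exp (- u) \<le> k powr k * u powr (- k)"
proof -
  have "u / k \<le> exp (u / k)" using exp_ge_add_one_self[of "u / k"] by linarith
  then have "(u / k) powr k \<le> exp (u / k) powr k" using assms by (intro powr_mono2) auto
  also have "\<dots> = exp u" using assms by (simp add: powr_def)
  finally have "u powr k \<le> k powr k * exp u" using assms by (simp add: powr_divide field_simps)
  then show ?thesis using assms by (simp add: exp_minus powr_minus field_simps)
qed

text \<open>
  The substitution of \<open>\<rho> * r\<close> for \<open>r\<close> extracts the power of \<open>\<rho>\<close>; for \<open>\<rho> = 1\<close> the exponential makes the
  integrand bounded on \<open>[0, 1]\<close>.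
\<close>

lemma nn_integral_powr_exp_inverse:
  fixes \<beta> :: real
  assumes "0 < \<beta>"
  obtains E where "0 \<le> E" and "\<And>\<rho>. 0 < \<rho> \<Longrightarrow>
    (\<integral>\<^sup>+r. ennreal (r powr (- \<beta> - 1) * exp (- \<rho> / (4 * r))) * indicator {0<..} r \<partial>lborel) \<le> ennreal (E * \<rho> powr (- \<beta>))"
proof -
  let ?k = "\<beta> + 1"
  let ?f = "\<lambda>\<rho> r. ennreal (r powr (- \<beta> - 1) * exp (- \<rho> / (4 * r))) * indicator {0<..} r"
  define C where "C = ?k powr ?k * 4 powr ?k"
  have "(\<integral>\<^sup>+r. ?f 1 r \<partial>lborel) \<le> (\<integral>\<^sup>+r. ennreal C * indicator {0..1} r + ennreal (r powr (- \<beta> - 1)) * indicator {1..} r \<partial>lborel)"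
  proof (rule nn_integral_mono)
    fix r :: real
    show "?f 1 r \<le> ennreal C * indicator {0..1} r + ennreal (r powr (- \<beta> - 1)) * indicator {1..} r"
    proof (cases "0 < r \<and> r < 1")
      case True
      have "r powr (- \<beta> - 1) * exp (- (1 / (4 * r))) \<le> r powr (- \<beta> - 1) * (?k powr ?k * (1 / (4 * r)) powr (- ?k))"
        using True assms by (intro mult_left_mono powr_mult_exp_neg_le) auto
      also have "\<dots> = C"
      proof -
        have "(1 / (4 * r)) powr (- ?k) = 4 powr ?k * r powr ?k"
        proof -
          have "1 / (4 * r) = (4 * r) powr (- 1)" using True by (simp add: powr_minus_divide)
          then show ?thesis using True by (simp only: powr_powr) (simp add: powr_mult add.commute)
        qed
        moreover have "r powr (- \<beta> - 1) * r powr ?k = 1"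
          using True by (simp flip: powr_add)
        ultimately show ?thesis by (simp add: C_def)
      qed
      finally show ?thesis using True by (simp add: ennreal_leI)
    next
      case False
      have "r powr (- \<beta> - 1) * exp (- 1 / (4 * r)) \<le> r powr (- \<beta> - 1)" if "1 \<le> r"
        using that by (intro mult_left_le) auto
      then show ?thesis using False by (cases "1 \<le> r") (auto intro!: ennreal_leI add_increasing)
    qed
  qed
  also have "\<dots> = ennreal C + (\<integral>\<^sup>+r. ennreal (r powr (- \<beta> - 1)) * indicator {1..} r \<partial>lborel)"
    by (subst nn_integral_add) (auto simp: nn_integral_cmult_indicator)
  also have "(\<integral>\<^sup>+r. ennreal (r powr (- \<beta> - 1)) * indicator {1..} r \<partial>lborel) = ennreal (1 / \<beta>)"
    using nn_integral_has_integral_lebesgue'[OF _ has_integral_powr_to_inf[of "- \<beta> - 1" 1]] assms by simp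
  finally have "(\<integral>\<^sup>+r. ?f 1 r \<partial>lborel) \<le> ennreal (C + 1 / \<beta>)"
    using assms by (simp add: C_def)
  moreover define E where "E = C + 1 / \<beta>"
  ultimately have fin: "(\<integral>\<^sup>+r. ?f 1 r \<partial>lborel) \<le> ennreal E" by simp
  have E: "0 \<le> E" using assms by (simp add: E_def C_def)
  show ?thesis
  proof
    show "0 \<le> E" by (rule E)
    fix \<rho> :: real assume \<rho>: "0 < \<rho>"
    have "(\<integral>\<^sup>+r. ?f \<rho> r \<partial>lborel) = ennreal \<bar>\<rho>\<bar> * (\<integral>\<^sup>+r. ?f \<rho> (0 + \<rho> * r) \<partial>lborel)"
      using \<rho> by (intro nn_integral_real_affine) auto
    also have "(\<integral>\<^sup>+r. ?f \<rho> (0 + \<rho> * r) \<partial>lborel) = (\<integral>\<^sup>+r. ennreal (\<rho> powr (- \<beta> - 1)) * ?f 1 r \<partial>lborel)"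
    proof (rule nn_integral_cong)
      fix r :: real
      show "?f \<rho> (0 + \<rho> * r) = ennreal (\<rho> powr (- \<beta> - 1)) * ?f 1 r"
        using \<rho> by (cases "0 < r") (auto simp: powr_mult zero_less_mult_iff field_simps simp flip: ennreal_mult)
    qed
    also have "\<dots> = ennreal (\<rho> powr (- \<beta> - 1)) * (\<integral>\<^sup>+r. ?f 1 r \<partial>lborel)"
      by (rule nn_integral_cmult) auto
    also have "ennreal \<bar>\<rho>\<bar> * \<dots> \<le> ennreal \<bar>\<rho>\<bar> * (ennreal (\<rho> powr (- \<beta> - 1)) * ennreal E)"
      by (intro mult_left_mono fin) auto
    also have "\<dots> = ennreal (E * \<rho> powr (- \<beta>))"
      using \<rho> assms by (simp add: E powr_diff mult_ac flip: ennreal_mult)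
    finally show "(\<integral>\<^sup>+r. ?f \<rho> r \<partial>lborel) \<le> ennreal (E * \<rho> powr (- \<beta>))" .
  qed
qed

lemma nn_integral_abs_powr_gaussian_finite:
  fixes a :: real
  assumes "0 < a" "a < 1"
  shows "(\<integral>\<^sup>+t. ennreal (\<bar>t\<bar> powr (- a) * exp (- t\<^sup>2 / 4)) \<partial>lborel) < \<infinity>"
proof -
  let ?h = "\<lambda>t::real. ennreal (t powr (- a)) * indicator {0..1} t"
  have h: "(\<integral>\<^sup>+t. ?h t \<partial>lborel) = ennreal (1 / (1 - a))"
    using nn_integral_has_integral_lebesgue'[OF _ has_integral_powr_from_0[of "- a" 1]] assms by simp
  have h': "(\<integral>\<^sup>+t. ?h (- t) \<partial>lborel) = ennreal (1 / (1 - a))"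
    using nn_integral_real_affine[of ?h "-1" 0] h by simp
  have g: "(\<integral>\<^sup>+t. ennreal (normal_density 0 (sqrt 2) t) \<partial>lborel) = 1"
    by (subst nn_integral_eq_integral) auto
  have "(\<integral>\<^sup>+t. ennreal (\<bar>t\<bar> powr (- a) * exp (- t\<^sup>2 / 4)) \<partial>lborel) \<le>
     (\<integral>\<^sup>+t. ?h t + ?h (- t) + ennreal (sqrt (4 * pi)) * ennreal (normal_density 0 (sqrt 2) t) \<partial>lborel)"
  proof (rule nn_integral_mono)
    fix t :: real
    have gd: "exp (- t\<^sup>2 / 4) = sqrt (4 * pi) * normal_density 0 (sqrt 2) t"
      by (simp add: normal_density_def)
    show "ennreal (\<bar>t\<bar> powr (- a) * exp (- t\<^sup>2 / 4)) \<le> ?h t + ?h (- t) + ennreal (sqrt (4 * pi)) * ennreal (normal_density 0 (sqrt 2) t)"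
    proof (cases "\<bar>t\<bar> \<le> 1")
      case True
      have "ennreal (\<bar>t\<bar> powr (- a) * exp (- t\<^sup>2 / 4)) \<le> ennreal (\<bar>t\<bar> powr (- a))"
        by (intro ennreal_leI mult_left_le) auto
      also have "\<dots> \<le> ?h t + ?h (- t)"
        using True by (cases "0 \<le> t") (auto simp: add_increasing2 add_increasing)
      finally show ?thesis by (rule order_trans) (simp add: add_increasing2)
    next
      case False
      then have "\<bar>t\<bar> powr (- a) \<le> 1" using assms
        by (smt (verit) powr_mono powr_zero_eq_one)
      then have "\<bar>t\<bar> powr (- a) * exp (- t\<^sup>2 / 4) \<le> exp (- t\<^sup>2 / 4)"
        by (intro mult_left_le_one_le) auto
      then have "ennreal (\<bar>t\<bar> powr (- a) * exp (- t\<^sup>2 / 4)) \<le> ennreal (sqrt (4 * pi)) * ennreal (normal_density 0 (sqrt 2) t)"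
        unfolding gd by (simp add: ennreal_leI flip: ennreal_mult)
      then show ?thesis by (rule order_trans) (simp add: add_increasing)
    qed
  qed
  also have "\<dots> = ennreal (1 / (1 - a)) + ennreal (1 / (1 - a)) + ennreal (sqrt (4 * pi))"
    by (simp add: nn_integral_add nn_integral_cmult h h' g)
  also have "\<dots> < \<infinity>" by simp
  finally show ?thesis .
qed

lemma AE_inner_Basis_nonzero: "AE x in lborel. \<forall>b\<in>Basis. (x::'a::euclidean_space) \<bullet> b \<noteq> 0"
proof (rule AE_finite_allI[OF finite_Basis])
  fix b :: 'a assume b: "b \<in> Basis"
  have "negligible {x. x \<bullet> b = 0}" using b by (rule negligible_standard_hyperplane)
  then have "AE x in lebesgue. x \<notin> {x. x \<bullet> b = 0}"
    unfolding negligible_iff_null_sets by (rule AE_not_in)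
  then show "AE x in lborel. x \<bullet> b \<noteq> 0" by (simp add: AE_completion_iff)
qed

text \<open>
  Since \<open>2 s = n / p\<close>, the singularity \<open>|x| powr (- 2 s)\<close> is at most the product of the
  \<open>|x \<bullet> b| powr (- 1 / p)\<close>, each of which is integrable at 0 in one dimension.
\<close>

lemma nn_integral_norm_powr_gaussian_finite:
  fixes p s :: real
  assumes "1 < p" "real CARD('n::finite) = 2 * s * p"
  shows "(\<integral>\<^sup>+x. ennreal (norm x powr (- 2 * s) * exp (- (norm x)\<^sup>2 / 4)) \<partial>(lborel :: (real^'n) measure)) < \<infinity>"
proof -
  let ?f = "\<lambda>t::real. \<bar>t\<bar> powr (- (1 / p)) * exp (- t\<^sup>2 / 4)"
  have le: "norm x powr (- 2 * s) * exp (- (norm x)\<^sup>2 / 4) \<le> (\<Prod>b\<in>Basis. ?f (x \<bullet> b))"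
    if nz: "\<forall>b\<in>Basis. x \<bullet> b \<noteq> 0" for x :: "real^'n"
  proof -
    have "0 < norm x" using nz SOME_Basis by fastforce
    have "norm x powr (- 2 * s) = (\<Prod>b\<in>(Basis :: (real^'n) set). norm x powr (- (1 / p)))"
      using assms \<open>0 < norm x\<close> by (simp add: powr_realpow[symmetric] powr_powr)
    also have "\<dots> \<le> (\<Prod>b\<in>Basis. \<bar>x \<bullet> b\<bar> powr (- (1 / p)))"
      using assms nz by (intro prod_mono conjI powr_mono2' Basis_le_norm) auto
    finally have "norm x powr (- 2 * s) \<le> (\<Prod>b\<in>Basis. \<bar>x \<bullet> b\<bar> powr (- (1 / p)))" .
    moreover have "exp (- (norm x)\<^sup>2 / 4) = (\<Prod>b\<in>Basis. exp (- (x \<bullet> b)\<^sup>2 / 4))"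
      by (simp add: norm_power2_eq_sum exp_sum[symmetric] sum_negf sum_divide_distrib)
    ultimately show ?thesis by (simp only: prod.distrib) (intro mult_right_mono prod_nonneg, auto)
  qed
  have "(\<integral>\<^sup>+x. ennreal (norm x powr (- 2 * s) * exp (- (norm x)\<^sup>2 / 4)) \<partial>(lborel :: (real^'n) measure))
    \<le> (\<integral>\<^sup>+x. (\<Prod>b\<in>Basis. ennreal (?f (x \<bullet> b))) \<partial>(lborel :: (real^'n) measure))"
  proof (rule nn_integral_mono_AE)
    show "AE x in (lborel :: (real^'n) measure). ennreal (norm x powr (- 2 * s) * exp (- (norm x)\<^sup>2 / 4))
        \<le> (\<Prod>b\<in>Basis. ennreal (?f (x \<bullet> b)))"
      using AE_inner_Basis_nonzero
      by eventually_elim (subst prod_ennreal, simp, rule ennreal_leI, rule le)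
  qed
  also have "\<dots> = (\<Prod>b\<in>(Basis :: (real^'n) set). (\<integral>\<^sup>+t. ennreal (?f t) \<partial>lborel))"
    by (rule nn_integral_lborel_prod) auto
  also have "\<dots> < \<infinity>"
    using nn_integral_abs_powr_gaussian_finite[of "1 / p"] assms by (simp add: power_less_top_ennreal)
  finally show ?thesis .
qed

lemma nn_integral_norm_powr_heat:
  fixes p s r :: real
  assumes "real CARD('n::finite) = 2 * s * p" "0 < r"
  shows "(\<integral>\<^sup>+x. ennreal (norm x powr (- 2 * s) * exp (- (norm x)\<^sup>2 / (4 * r))) \<partial>(lborel :: (real^'n) measure)) =
    ennreal (r powr (s * (p - 1))) * (\<integral>\<^sup>+x. ennreal (norm x powr (- 2 * s) * exp (- (norm x)\<^sup>2 / 4)) \<partial>(lborel :: (real^'n) measure))"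
proof -
  let ?f = "\<lambda>r (x :: real^'n). ennreal (norm x powr (- 2 * s) * exp (- (norm x)\<^sup>2 / (4 * r)))"
  have "(\<integral>\<^sup>+x. ?f r x \<partial>lborel) = ennreal (\<bar>sqrt r\<bar> ^ DIM(real^'n)) * (\<integral>\<^sup>+x. ?f r (0 + sqrt r *\<^sub>R x) \<partial>lborel)"
    using assms by (intro nn_integral_lborel_affine) auto
  also have "(\<integral>\<^sup>+x. ?f r (0 + sqrt r *\<^sub>R x) \<partial>lborel) = (\<integral>\<^sup>+x. ennreal (r powr (- s)) * ?f 1 x \<partial>lborel)"
  proof (rule nn_integral_cong)
    fix x :: "real^'n"
    have "norm (0 + sqrt r *\<^sub>R x) powr (- 2 * s) = r powr (- s) * norm x powr (- 2 * s)"
      using assms by (simp add: powr_mult powr_half_sqrt[symmetric] powr_powr)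
    moreover have "(norm (0 + sqrt r *\<^sub>R x))\<^sup>2 / (4 * r) = (norm x)\<^sup>2 / 4"
      using assms by (simp add: power_mult_distrib)
    ultimately show "?f r (0 + sqrt r *\<^sub>R x) = ennreal (r powr (- s)) * ?f 1 x"
      by (simp add: mult.assoc flip: ennreal_mult)
  qed
  also have "\<dots> = ennreal (r powr (- s)) * (\<integral>\<^sup>+x. ?f 1 x \<partial>lborel)"
    by (rule nn_integral_cmult) auto
  also have "ennreal (\<bar>sqrt r\<bar> ^ DIM(real^'n)) * \<dots> = ennreal (r powr (s * p) * r powr (- s)) * (\<integral>\<^sup>+x. ?f 1 x \<partial>lborel)"
  proof -
    have "\<bar>sqrt r\<bar> ^ DIM(real^'n) = r powr (s * p)"
      using assms by (simp add: powr_realpow[symmetric] powr_half_sqrt[symmetric] powr_powr)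
    then show ?thesis by (simp add: ennreal_mult mult.assoc)
  qed
  also have "r powr (s * p) * r powr (- s) = r powr (s * (p - 1))"
    by (simp add: algebra_simps flip: powr_add)
  finally show ?thesis by simp
qed

lemma powr_add_le:
  fixes a b q :: real
  assumes "0 \<le> a" "0 \<le> b" "0 \<le> q"
  shows "(a + b) powr q \<le> 2 powr q * (a powr q + b powr q)"
proof -
  have "(a + b) powr q \<le> (2 * max a b) powr q" using assms by (intro powr_mono2) auto
  also have "\<dots> = 2 powr q * max a b powr q" using assms by (simp add: powr_mult)
  also have "\<dots> \<le> 2 powr q * (a powr q + b powr q)" by (intro mult_left_mono) (auto simp: max_def)
  finally show ?thesis .
qed

text \<open>
  The second factor that Hoelder's inequality produces from the small times in the integral for the
  kernel.
\<close>

definition singular_majorant :: "real \<Rightarrow> real \<Rightarrow> real^'n::finite \<Rightarrow> ennreal" where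
  "singular_majorant q \<beta> x = (\<integral>\<^sup>+r. ennreal (r powr (- \<beta> - 1) * exp (- (norm x)\<^sup>2 / (4 * r)) * ln (1 / r) powr (- q)) *
     indicator {0<..<exp (- 1)} r \<partial>lborel)"

lemma measurable_singular_majorant [measurable]: "singular_majorant q \<beta> \<in> borel_measurable borel"
  unfolding singular_majorant_def[abs_def] by measurable

text \<open>After integration over \<open>x\<close>, scaling leaves exactly \<open>\<integral> dr / (r ln (1/r) powr q)\<close> over small times.\<close>

lemma nn_integral_singular_majorant_finite:
  fixes p s q :: real
  assumes "1 < p" "real CARD('n::finite) = 2 * s * p" "1 < q"
  shows "(\<integral>\<^sup>+x. ennreal (norm x powr (- 2 * s)) * singular_majorant q (s * (p - 1)) x \<partial>(lborel :: (real^'n) measure)) < \<infinity>"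
proof -
  let ?\<beta> = "s * (p - 1)"
  let ?D = "\<integral>\<^sup>+x. ennreal (norm x powr (- 2 * s) * exp (- (norm x)\<^sup>2 / 4)) \<partial>(lborel :: (real^'n) measure)"
  let ?g = "\<lambda>r. ennreal (r powr (- ?\<beta> - 1) * ln (1 / r) powr (- q)) * indicator {0<..<exp (- 1)} r"
  have "(\<integral>\<^sup>+x. ennreal (norm x powr (- 2 * s)) * singular_majorant q ?\<beta> x \<partial>(lborel :: (real^'n) measure)) =
    (\<integral>\<^sup>+x. (\<integral>\<^sup>+r. ?g r * ennreal (norm x powr (- 2 * s) * exp (- (norm x)\<^sup>2 / (4 * r))) \<partial>lborel) \<partial>(lborel :: (real^'n) measure))"
    unfolding singular_majorant_def
    by (subst nn_integral_cmult[symmetric])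
      (auto intro!: nn_integral_cong simp: indicator_def mult_ac simp flip: ennreal_mult)
  also have "\<dots> = (\<integral>\<^sup>+r. (\<integral>\<^sup>+x. ?g r * ennreal (norm x powr (- 2 * s) * exp (- (norm x)\<^sup>2 / (4 * r))) \<partial>(lborel :: (real^'n) measure)) \<partial>lborel)"
    by (rule lborel_pair.Fubini') measurable
  also have "\<dots> = (\<integral>\<^sup>+r. ?D * (ennreal (1 / r * ln (1 / r) powr (- q)) * indicator {0<..<exp (- 1)} r) \<partial>lborel)"
  proof (rule nn_integral_cong)
    fix r :: real
    show "(\<integral>\<^sup>+x. ?g r * ennreal (norm x powr (- 2 * s) * exp (- (norm x)\<^sup>2 / (4 * r))) \<partial>(lborel :: (real^'n) measure)) =
      ?D * (ennreal (1 / r * ln (1 / r) powr (- q)) * indicator {0<..<exp (- 1)} r)"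
    proof (cases "0 < r \<and> r < exp (- 1)")
      case True
      have "r powr (- ?\<beta> - 1) * r powr ?\<beta> = 1 / r"
        using True by (simp add: powr_minus_divide flip: powr_add)
      then have eq: "r powr (- ?\<beta> - 1) * ln (1 / r) powr (- q) * r powr ?\<beta> = 1 / r * ln (1 / r) powr (- q)"
        by (metis mult.commute mult.left_commute)
      have "(\<integral>\<^sup>+x. ?g r * ennreal (norm x powr (- 2 * s) * exp (- (norm x)\<^sup>2 / (4 * r))) \<partial>(lborel :: (real^'n) measure)) =
        ?g r * (ennreal (r powr ?\<beta>) * ?D)"
        using True assms by (subst nn_integral_cmult) (simp_all only: nn_integral_norm_powr_heat, measurable)
      also have "\<dots> = ?D * ennreal (r powr (- ?\<beta> - 1) * ln (1 / r) powr (- q) * r powr ?\<beta>)"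
        using True by (simp add: ennreal_mult mult_ac)
      finally show ?thesis unfolding eq using True by simp
    qed auto
  qed
  also have "\<dots> = ?D * (\<integral>\<^sup>+r. ennreal (1 / r * ln (1 / r) powr (- q)) * indicator {0<..<exp (- 1)} r \<partial>lborel)"
    by (rule nn_integral_cmult) auto
  also have "\<dots> < \<infinity>"
    using nn_integral_inverse_log_power_finite[OF assms(3)] nn_integral_norm_powr_gaussian_finite[OF assms(1,2)]
    by (simp add: ennreal_mult_less_top)
  finally show ?thesis .
qed

definition singular_part :: "real \<Rightarrow> real^'n::finite \<Rightarrow> ennreal" where
  "singular_part s x =
     (\<integral>\<^sup>+r. ennreal (r powr (s - 1) / ln (1 / r) * heat r x) * indicator {0<..<exp (- 1)} r \<partial>lborel)"

text \<open>
  Minkowski's integral inequality would only leave the divergent \<open>\<integral> dr / (r ln (1/r))\<close>. Instead let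
  \<open>k r = r powr (- \<beta> - 1) * exp (- |x|\<^sup>2 / (4 r))\<close> with \<open>\<beta> = s (p - 1)\<close>, which up to a constant is the
  integrand without its logarithm, and apply Hoelder's inequality in \<open>r\<close> to the product of
  \<open>k r powr (1 / p)\<close> and \<open>k r powr (1 / q) / ln (1 / r)\<close>. Then the logarithm appears with the power
  \<open>q > 1\<close>, and the first factor contributes a power of \<open>|x|\<close>.
\<close>

lemma singular_part_bound:
  fixes p s q :: real
  assumes "0 < s" "1 < p" "real CARD('n::finite) = 2 * s * p" and q: "q = p / (p - 1)"
  obtains C where "0 \<le> C" and "\<And>x::real^'n. x \<noteq> 0 \<Longrightarrow>
     singular_part s x < \<infinity> \<and>
     ennreal (enn2real (singular_part s x) powr q)
       \<le> ennreal C * (ennreal (norm x powr (- 2 * s)) * singular_majorant q (s * (p - 1)) x)"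
proof -
  let ?\<beta> = "s * (p - 1)"
  have \<beta>: "0 < ?\<beta>" using assms by simp
  have q1: "1 < q" "1 / p + 1 / q = 1" "q / p = 1 / (p - 1)"
    unfolding q using assms by (auto simp: field_simps)
  obtain E where E: "0 \<le> E" "\<And>\<rho>. 0 < \<rho> \<Longrightarrow>
    (\<integral>\<^sup>+r. ennreal (r powr (- ?\<beta> - 1) * exp (- \<rho> / (4 * r))) * indicator {0<..} r \<partial>lborel) \<le> ennreal (E * \<rho> powr (- ?\<beta>))"
    using nn_integral_powr_exp_inverse[OF \<beta>] by blast
  define G where "G = 1 / sqrt (4 * pi) ^ CARD('n)"
  have G: "0 \<le> G" by (simp add: G_def)
  have main: "singular_part s x < \<infinity> \<and>
     ennreal (enn2real (singular_part s x) powr q)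
       \<le> ennreal (G powr q * E powr (q / p)) * (ennreal (norm x powr (- 2 * s)) * singular_majorant q ?\<beta> x)"
    if "x \<noteq> 0" for x :: "real^'n"
  proof -
    let ?\<rho> = "(norm x)\<^sup>2"
    have \<rho>: "0 < ?\<rho>" using that by simp
    define k where "k r = r powr (- ?\<beta> - 1) * exp (- ?\<rho> / (4 * r))" for r
    define f where "f r = indicator {0<..<exp (- 1)} r * k r powr (1 / p)" for r
    define g where "g r = indicator {0<..<exp (- 1)} r * (k r powr (1 / q) / ln (1 / r))" for r
    have meas: "f \<in> borel_measurable lborel" "g \<in> borel_measurable lborel"
      unfolding f_def[abs_def] g_def[abs_def] k_def by measurable
    have kpos: "0 < k r" if "0 < r" for r using that by (simp add: k_def)
    (* A bounds the integral of f powr p *)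
    define A where "A = E * ?\<rho> powr (- ?\<beta>)"
    have A: "0 \<le> A" using E by (simp add: A_def)
    have "singular_majorant q ?\<beta> x \<le> (\<integral>\<^sup>+r. ennreal (k r) * indicator {0<..} r \<partial>lborel)"
      unfolding singular_majorant_def
    proof (rule nn_integral_mono)
      fix r :: real
      show "ennreal (r powr (- ?\<beta> - 1) * exp (- ?\<rho> / (4 * r)) * ln (1 / r) powr (- q)) * indicator {0<..<exp (- 1)} r
        \<le> ennreal (k r) * indicator {0<..} r"
      proof (cases "0 < r \<and> r < exp (- 1)")
        case True
        then have "ln (1 / r) powr (- q) \<le> 1 powr (- q)" using one_less_ln_inverse[of r] q1 by (intro powr_mono2') auto
        then have "k r * ln (1 / r) powr (- q) \<le> k r" using True kpos[of r] by (intro mult_left_le) auto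
        then show ?thesis using True by (simp add: k_def ennreal_leI)
      qed auto
    qed
    also have "\<dots> \<le> ennreal A" unfolding k_def A_def using E(2)[OF \<rho>] .
    finally have "singular_majorant q ?\<beta> x < \<infinity>" by (rule le_less_trans) simp
    then obtain B where B: "0 \<le> B" "singular_majorant q ?\<beta> x = ennreal B"
      by (metis ennreal_cases infinity_ennreal_def less_irrefl)
    have "(\<integral>\<^sup>+r. ennreal (f r * g r) \<partial>lborel) \<le> ennreal (A powr (1 / p) * B powr (1 / q))"
    proof (rule holder_nn_integral[OF \<open>1 < p\<close> q1(1,2) meas])
      show "0 \<le> f r" for r by (simp add: f_def)
      show "0 \<le> g r" for r
      proof (cases "0 < r \<and> r < exp (- 1)")
        case True
        then have "0 \<le> ln (1 / r)" using one_less_ln_inverse[of r] by linarith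
        then show ?thesis
          unfolding g_def by (intro mult_nonneg_nonneg divide_nonneg_nonneg powr_ge_zero indicator_pos_le)
      qed (auto simp: g_def)
      show "(\<integral>\<^sup>+r. ennreal (f r powr p) \<partial>lborel) \<le> ennreal A"
      proof -
        have "(\<integral>\<^sup>+r. ennreal (f r powr p) \<partial>lborel) \<le> (\<integral>\<^sup>+r. ennreal (k r) * indicator {0<..} r \<partial>lborel)"
          using kpos assms by (intro nn_integral_mono) (auto simp: f_def indicator_def powr_powr less_imp_le)
        also have "\<dots> \<le> ennreal A" unfolding k_def A_def using E(2)[OF \<rho>] .
        finally show ?thesis .
      qed
      show "(\<integral>\<^sup>+r. ennreal (g r powr q) \<partial>lborel) \<le> ennreal B"
        unfolding B(2)[symmetric] singular_majorant_def
      proof (rule nn_integral_mono)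
        fix r :: real
        show "ennreal (g r powr q) \<le> ennreal (r powr (- ?\<beta> - 1) * exp (- ?\<rho> / (4 * r)) * ln (1 / r) powr (- q)) * indicator {0<..<exp (- 1)} r"
        proof (cases "0 < r \<and> r < exp (- 1)")
          case True
          then have "g r powr q = k r * ln (1 / r) powr (- q)"
            using one_less_ln_inverse[of r] kpos[of r] q1 by (simp add: g_def powr_divide powr_powr powr_minus_divide)
          then show ?thesis using True by (simp add: k_def)
        qed (auto simp: g_def)
      qed
    qed (use A B in auto)
    moreover have eq: "singular_part s x = ennreal G * (\<integral>\<^sup>+r. ennreal (f r * g r) \<partial>lborel)"
      unfolding singular_part_def
    proof (subst nn_integral_cmult[symmetric])
      show "(\<lambda>r. ennreal (f r * g r)) \<in> borel_measurable lborel" using meas by measurable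
      show "(\<integral>\<^sup>+r. ennreal (r powr (s - 1) / ln (1 / r) * heat r x) * indicator {0<..<exp (- 1)} r \<partial>lborel) = (\<integral>\<^sup>+r. ennreal G * ennreal (f r * g r) \<partial>lborel)"
      proof (rule nn_integral_cong)
        fix r :: real
        show "ennreal (r powr (s - 1) / ln (1 / r) * heat r x) * indicator {0<..<exp (- 1)} r = ennreal G * ennreal (f r * g r)"
        proof (cases "0 < r \<and> r < exp (- 1)")
          case True
          have "sqrt (4 * pi * r) ^ CARD('n) = sqrt (4 * pi) ^ CARD('n) * r powr (s * p)"
          proof -
            have "sqrt r ^ CARD('n) = r powr (s * p)"
              using True assms by (simp add: powr_realpow[symmetric] powr_half_sqrt[symmetric] powr_powr)
            then show ?thesis by (simp add: real_sqrt_mult power_mult_distrib)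
          qed
          then have "r powr (s - 1) / ln (1 / r) * heat r x = G * (r powr (s - 1) / r powr (s * p) * exp (- ?\<rho> / (4 * r)) / ln (1 / r))"
            by (simp add: heat_def G_def)
          also have "r powr (s - 1) / r powr (s * p) = r powr (- ?\<beta> - 1)"
            by (simp add: algebra_simps flip: powr_diff)
          also have "r powr (- ?\<beta> - 1) * exp (- ?\<rho> / (4 * r)) = k r powr (1 / p) * k r powr (1 / q)"
            using kpos[of r] True q1(2) by (simp add: k_def flip: powr_add)
          finally have "r powr (s - 1) / ln (1 / r) * heat r x = G * (f r * g r)"
            using True by (simp add: f_def g_def)
          then show ?thesis using True G by (simp add: ennreal_mult')
        qed (auto simp: f_def)
      qed
    qed
    ultimately have le: "singular_part s x \<le> ennreal (G * (A powr (1 / p) * B powr (1 / q)))"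
      using G by (simp add: ennreal_mult' mult_left_mono)
    then have "enn2real (singular_part s x) \<le> G * (A powr (1 / p) * B powr (1 / q))"
      using G by (intro enn2real_leI) auto
    then have "enn2real (singular_part s x) powr q
        \<le> (G * (A powr (1 / p) * B powr (1 / q))) powr q"
      using q1 by (intro powr_mono2) auto
    also have "\<dots> = G powr q * E powr (q / p) * (norm x powr (- 2 * s) * B)"
    proof -
      have "A powr (q / p) = E powr (q / p) * norm x powr (- 2 * s)"
      proof -
        have "?\<rho> = norm x powr 2" using that by simp
        then have "(?\<rho> powr (- ?\<beta>)) powr (q / p) = norm x powr (2 * (- ?\<beta> * (q / p)))"
          by (simp only: powr_powr mult.assoc)
        also have "2 * (- ?\<beta> * (q / p)) = - 2 * s"
          unfolding q1(3) using assms(2) by simp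
        finally show ?thesis unfolding A_def using E by (simp add: powr_mult)
      qed
      then show ?thesis using G A B q1 by (simp add: powr_mult powr_powr)
    qed
    finally show ?thesis
      using le B G by (auto simp: ennreal_mult[symmetric] intro!: ennreal_leI intro: le_less_trans)
  qed
  show ?thesis
    using main by (intro that[of "G powr q * E powr (q / p)"]) auto
qed

text \<open>
  The times \<open>r < exp (- 1)\<close> contribute at most a multiple of \<open>singular_part\<close>. The contribution of the
  other times is bounded, and it is integrable since the whole kernel is.
\<close>

lemma log_kernel_Lq:
  fixes p s q lam :: real
  assumes "0 < s" "1 < lam" "1 < p" "real CARD('n::finite) = 2 * s * p" and q: "q = p / (p - 1)"
  shows "(\<integral>\<^sup>+x. ennreal (log_kernel s lam x powr q) \<partial>(lborel :: (real^'n) measure)) < \<infinity>"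
proof -
  let ?\<mu> = "laplace_measure s lam"
  let ?S = "\<lambda>x::real^'n. singular_part s x"
  let ?M = "\<lambda>x::real^'n. ennreal (norm x powr (- 2 * s)) * singular_majorant q (s * (p - 1)) x"
  have q1: "1 < q" unfolding q using assms by simp
  obtain C where C: "0 \<le> C" "\<And>x. x \<noteq> 0 \<Longrightarrow> ?S x < \<infinity> \<and> ennreal (enn2real (?S x) powr q) \<le> ennreal C * ?M x"
    using singular_part_bound[OF assms(1,3,4) q] by blast
  define T where "T = 1 / sqrt (4 * pi * exp (- 1)) ^ CARD('n)"
  define m where "m = lam powr (- s) / ln lam"
  have T: "0 \<le> T" and m: "0 \<le> m" using assms by (auto simp: T_def m_def)
  have pointwise: "log_kernel s lam x powr q \<le> 2 powr q * ((2 * exp 2) powr q * enn2real (?S x) powr q + (T * m) powr (q - 1) * log_kernel s lam x)"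
    if x: "x \<noteq> 0" for x :: "real^'n"
  proof -
    let ?I0 = "\<integral>\<^sup>+r. ennreal (heat r x) * indicator {..<exp (- 1)} r \<partial>?\<mu>"
    let ?I1 = "\<integral>\<^sup>+r. ennreal (heat r x) * indicator {exp (- 1)..} r \<partial>?\<mu>"
    have hm [measurable]: "(\<lambda>r. heat r x) \<in> borel_measurable borel" unfolding heat_def by measurable
    have K: "ennreal (log_kernel s lam x) = (\<integral>\<^sup>+r. ennreal (heat r x) \<partial>?\<mu>)"
      using log_kernel_eq_nn_integral[OF assms(1,2) x] .
    have split: "(\<integral>\<^sup>+r. ennreal (heat r x) \<partial>?\<mu>) = ?I0 + ?I1"
      by (subst nn_integral_add[symmetric]) (auto intro!: nn_integral_cong simp: indicator_def)
    have "?I0 = (\<integral>\<^sup>+r. laplace_weight s lam r * indicator {0<..} r * (ennreal (heat r x) * indicator {..<exp (- 1)} r) \<partial>lborel)"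
      unfolding laplace_measure_def by (rule nn_integral_density) auto
    also have "\<dots> \<le> (\<integral>\<^sup>+r. ennreal (2 * exp 2) * (ennreal (r powr (s - 1) / ln (1 / r) * heat r x) * indicator {0<..<exp (- 1)} r) \<partial>lborel)"
    proof (rule nn_integral_mono)
      fix r :: real
      show "laplace_weight s lam r * indicator {0<..} r * (ennreal (heat r x) * indicator {..<exp (- 1)} r)
        \<le> ennreal (2 * exp 2) * (ennreal (r powr (s - 1) / ln (1 / r) * heat r x) * indicator {0<..<exp (- 1)} r)"
      proof (cases "0 < r \<and> r < exp (- 1)")
        case True
        moreover have "exp (- 1) < (1::real)" by simp
        ultimately have r: "0 < r" "r < 1" by linarith+
        then have "0 < ln (1 / r)" by (subst ln_gt_zero_iff) auto
        have "laplace_weight s lam r * ennreal (heat r x) \<le> ennreal (2 * exp 2 * (r powr (s - 1) / ln (1 / r))) * ennreal (heat r x)"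
          using assms r by (intro mult_right_mono laplace_weight_le) auto
        also have "\<dots> = ennreal (2 * exp 2) * ennreal (r powr (s - 1) / ln (1 / r) * heat r x)"
          using r \<open>0 < ln (1 / r)\<close> by (simp add: mult.assoc flip: ennreal_mult'')
        finally show ?thesis using True by simp
      qed (auto simp: indicator_def)
    qed
    also have "\<dots> = ennreal (2 * exp 2) * ?S x"
      unfolding singular_part_def by (rule nn_integral_cmult) measurable
    finally have I0: "?I0 \<le> ennreal (2 * exp 2) * ?S x" .
    have S: "?S x = ennreal (enn2real (?S x))" using C(2)[OF x] by simp
    have "?I0 \<le> ennreal (2 * exp 2 * enn2real (?S x))"
      using I0 unfolding ennreal_mult'[OF mult_nonneg_nonneg[OF zero_le_numeral exp_ge_zero]] S[symmetric] .
    then have i0: "enn2real ?I0 \<le> 2 * exp 2 * enn2real (?S x)" by (intro enn2real_leI) auto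
    have "?I1 \<le> (\<integral>\<^sup>+r. ennreal T \<partial>?\<mu>)"
    proof (rule nn_integral_mono)
      fix r :: real
      show "ennreal (heat r x) * indicator {exp (- 1)..} r \<le> ennreal T"
      proof (cases "exp (- 1) \<le> r")
        case True
        moreover have "0 < exp (- 1 :: real)" by simp
        ultimately have r: "0 < r" by linarith
        have "heat r x \<le> 1 / sqrt (4 * pi * r) ^ CARD('n)" by (rule heat_le[OF r])
        also have "\<dots> \<le> T" unfolding T_def using True by (intro divide_left_mono power_mono mult_pos_pos zero_less_power) (auto simp: r)
        finally show ?thesis using True by (simp add: ennreal_leI)
      qed simp
    qed
    also have "\<dots> = ennreal (T * m)"
      using emeasure_laplace_measure[OF assms(1,2)] T m by (simp add: ennreal_mult flip: m_def)
    finally have I1: "?I1 \<le> ennreal (T * m)" .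
    have fin: "?I0 < \<infinity>" "?I1 < \<infinity>"
      using K split by (auto simp: less_top[symmetric])
    have "enn2real (ennreal (log_kernel s lam x)) = enn2real (?I0 + ?I1)"
      unfolding K split ..
    moreover have "enn2real (?I0 + ?I1) = enn2real ?I0 + enn2real ?I1"
      using fin by (intro enn2real_plus) (simp_all only: infinity_ennreal_def)
    ultimately have K': "log_kernel s lam x = enn2real ?I0 + enn2real ?I1"
      by (simp only: enn2real_ennreal[OF log_kernel_nonneg[OF assms(1,2)]])
    have "enn2real ?I1 powr q \<le> (T * m) powr (q - 1) * log_kernel s lam x"
    proof -
      have "enn2real ?I1 \<le> T * m" using I1 T m by (intro enn2real_leI) auto
      then have "enn2real ?I1 powr (q - 1) * enn2real ?I1 \<le> (T * m) powr (q - 1) * log_kernel s lam x"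
        using q1 K' T m by (intro mult_mono powr_mono2) auto
      moreover have "enn2real ?I1 powr q = enn2real ?I1 powr (q - 1) * enn2real ?I1"
        using q1 by (cases "enn2real ?I1 = 0") (auto simp: powr_diff)
      ultimately show ?thesis by simp
    qed
    moreover have "enn2real ?I0 powr q \<le> (2 * exp 2) powr q * enn2real (?S x) powr q"
    proof -
      have "enn2real ?I0 powr q \<le> (2 * exp 2 * enn2real (?S x)) powr q"
        using q1 i0 by (intro powr_mono2) auto
      then show ?thesis by (simp add: powr_mult)
    qed
    ultimately have *: "2 powr q * (enn2real ?I0 powr q + enn2real ?I1 powr q) \<le>
       2 powr q * ((2 * exp 2) powr q * enn2real (?S x) powr q + (T * m) powr (q - 1) * log_kernel s lam x)"
      by (intro mult_left_mono add_mono) auto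
    have "log_kernel s lam x powr q \<le> 2 powr q * (enn2real ?I0 powr q + enn2real ?I1 powr q)"
      unfolding K' using q1 by (intro powr_add_le) auto
    from this * show ?thesis by (rule order_trans)
  qed
  have "ennreal (log_kernel s lam x powr q) \<le> ennreal (2 powr q * (2 * exp 2) powr q * C) * ?M x
      + ennreal (2 powr q * (T * m) powr (q - 1)) * ennreal (log_kernel s lam x)" if x: "x \<noteq> 0" for x :: "real^'n"
  proof -
    have "ennreal (log_kernel s lam x powr q) \<le> ennreal (2 powr q * ((2 * exp 2) powr q * enn2real (?S x) powr q + (T * m) powr (q - 1) * log_kernel s lam x))"
      using pointwise[OF x] by (rule ennreal_leI)
    also have "\<dots> = ennreal (2 powr q * (2 * exp 2) powr q) * ennreal (enn2real (?S x) powr q)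
      + ennreal (2 powr q * (T * m) powr (q - 1)) * ennreal (log_kernel s lam x)"
      using log_kernel_nonneg[OF assms(1,2), of x] by (simp add: distrib_left mult.assoc flip: ennreal_mult ennreal_plus)
    also have "\<dots> \<le> ennreal (2 powr q * (2 * exp 2) powr q) * (ennreal C * ?M x)
      + ennreal (2 powr q * (T * m) powr (q - 1)) * ennreal (log_kernel s lam x)"
      using C(2)[OF x] by (intro add_mono mult_left_mono) auto
    also have "ennreal (2 powr q * (2 * exp 2) powr q) * (ennreal C * ?M x) = ennreal (2 powr q * (2 * exp 2) powr q * C) * ?M x"
      using C by (simp add: ennreal_mult' mult.assoc)
    finally show ?thesis .
  qed
  then have "(\<integral>\<^sup>+x. ennreal (log_kernel s lam x powr q) \<partial>(lborel :: (real^'n) measure)) \<le>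
     (\<integral>\<^sup>+x. ennreal (2 powr q * (2 * exp 2) powr q * C) * ?M x + ennreal (2 powr q * (T * m) powr (q - 1)) * ennreal (log_kernel s lam x) \<partial>lborel)"
    using AE_lborel_singleton[of "0 :: real^'n"]
    by (intro nn_integral_mono_AE) (auto elim!: eventually_mono)
  also have "\<dots> = ennreal (2 powr q * (2 * exp 2) powr q * C) * (\<integral>\<^sup>+x. ?M x \<partial>lborel) + ennreal (2 powr q * (T * m) powr (q - 1)) * (\<integral>\<^sup>+x. ennreal (log_kernel s lam (x :: real^'n)) \<partial>lborel)"
    using measurable_log_kernel[OF assms(1,2), where 'n = 'n] by (simp add: nn_integral_add nn_integral_cmult)
  also have "\<dots> < \<infinity>"
    using nn_integral_singular_majorant_finite[OF assms(3,4) q1]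
    by (simp add: nn_integral_log_kernel[OF assms(1,2)] ennreal_mult_less_top)
  finally show ?thesis .
qed

section \<open>Convolution with a kernel\<close>

lemma powr_diff_le_add:
  fixes a b q :: real
  assumes "0 \<le> a" "0 \<le> b" "0 < q"
  shows "\<bar>a - b\<bar> powr q \<le> a powr q + b powr q"
proof -
  have "\<bar>a - b\<bar> powr q \<le> max a b powr q" using assms by (intro powr_mono2) auto
  also have "\<dots> \<le> a powr q + b powr q" by (auto simp: max_def)
  finally show ?thesis .
qed

lemma holder_integral:
  fixes k :: "'a \<Rightarrow> real" and g :: "'a \<Rightarrow> complex"
  assumes pq: "1 < p" "1 < q" "1 / p + 1 / q = 1"
    and [measurable]: "k \<in> borel_measurable M" "g \<in> borel_measurable M"
    and k: "integrable M (\<lambda>x. \<bar>k x\<bar> powr q)" and g: "integrable M (\<lambda>x. norm (g x) powr p)"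
  shows "integrable M (\<lambda>x. of_real (k x) * g x)"
    and "norm (LINT x|M. of_real (k x) * g x) \<le> (LINT x|M. \<bar>k x\<bar> powr q) powr (1 / q) * (LINT x|M. norm (g x) powr p) powr (1 / p)"
proof -
  let ?A = "LINT x|M. \<bar>k x\<bar> powr q" and ?B = "LINT x|M. norm (g x) powr p"
  have "(\<integral>\<^sup>+x. ennreal (\<bar>k x\<bar> * norm (g x)) \<partial>M) \<le> ennreal (?A powr (1 / q) * ?B powr (1 / p))"
    using pq k g by (intro holder_nn_integral) (auto simp: add.commute nn_integral_eq_integral)
  then have le: "(\<integral>\<^sup>+x. ennreal (norm (of_real (k x) * g x)) \<partial>M) \<le> ennreal (?A powr (1 / q) * ?B powr (1 / p))"
    by (simp add: norm_mult)
  then have "(\<integral>\<^sup>+x. ennreal (norm (of_real (k x) * g x)) \<partial>M) < \<infinity>" by (rule le_less_trans) simp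
  then show int: "integrable M (\<lambda>x. of_real (k x) * g x)"
    by (intro integrableI_bounded) auto
  have "norm (LINT x|M. of_real (k x) * g x) \<le> (LINT x|M. norm (of_real (k x) * g x))"
    by (rule integral_norm_bound)
  also have "\<dots> \<le> ?A powr (1 / q) * ?B powr (1 / p)"
    using le integrable_norm[OF int] by (simp add: nn_integral_eq_integral)
  finally show "norm (LINT x|M. of_real (k x) * g x) \<le> ?A powr (1 / q) * ?B powr (1 / p)" .
qed

text \<open>
  Fatou's lemma for \<open>K (x + h) powr q + K x powr q - |K (x + h) - K x| powr q\<close>: off the
  origin it converges pointwise to \<open>2 K x powr q\<close>, and the integrals of the first two terms do not depend on \<open>h\<close>.
\<close>

lemma Lq_convergence_of_translates:
  fixes K :: "real^'n::finite \<Rightarrow> real"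
  assumes q: "0 < q" and [measurable]: "K \<in> borel_measurable borel" and nonneg: "\<And>x. 0 \<le> K x"
    and cont: "\<And>x. x \<noteq> 0 \<Longrightarrow> isCont K x" and Lq: "integrable lborel (\<lambda>x. K x powr q)"
    and h: "h \<longlonglongrightarrow> 0"
  shows "(\<lambda>k. LINT x|lborel. \<bar>K (x + h k) - K x\<bar> powr q) \<longlonglongrightarrow> 0"
proof -
  define I where "I = (LINT x|lborel. K x powr q)"
  define d where "d k = (LINT x|lborel. \<bar>K (x + h k) - K x\<bar> powr q)" for k
  define u where "u k x = K (x + h k) powr q + K x powr q - \<bar>K (x + h k) - K x\<bar> powr q" for k x
  have trans: "integrable lborel (\<lambda>x. K (x + a) powr q)" "(LINT x|lborel. K (x + a) powr q) = I" for a
  proof -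
    have "integrable lborel (\<lambda>x. K (a + 1 *\<^sub>R x) powr q)"
      using Lq by (subst integrable_lborel_affine_iff) auto
    then show "integrable lborel (\<lambda>x. K (x + a) powr q)" by (simp add: add.commute)
    show "(LINT x|lborel. K (x + a) powr q) = I"
      unfolding I_def by (subst integral_lborel_affine[of "\<lambda>x. K x powr q" 1 a]) (auto simp: add.commute)
  qed
  have u0: "0 \<le> u k x" for k x
    unfolding u_def using powr_diff_le_add[OF nonneg nonneg q, of "x + h k" x] by simp
  have dint: "integrable lborel (\<lambda>x. \<bar>K (x + h k) - K x\<bar> powr q)" for k
    by (rule Bochner_Integration.integrable_bound[OF Bochner_Integration.integrable_add[OF trans(1)[of "h k"] Lq]])
      (use powr_diff_le_add[OF nonneg nonneg q] in \<open>auto intro: order_trans[OF _ abs_ge_self]\<close>)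
  have uint: "integrable lborel (u k)" "(LINT x|lborel. u k x) = 2 * I - d k" for k
    unfolding u_def[abs_def] d_def using trans[of "h k"] Lq dint[of k] by (simp_all add: I_def)
  have d0: "0 \<le> d k" for k unfolding d_def by simp
  have dle: "d k \<le> 2 * I" for k
    using Bochner_Integration.integral_nonneg[of lborel "u k"] u0 uint(2)[of k] by simp
  have lim: "AE x in lborel. liminf (\<lambda>k. ennreal (u k x)) = ennreal (2 * K x powr q)"
    using AE_lborel_singleton[of "0 :: real^'n"]
  proof eventually_elim
    case (elim x)
    have "(\<lambda>k. x + h k) \<longlonglongrightarrow> x + 0" by (intro tendsto_intros h)
    then have "(\<lambda>k. K (x + h k)) \<longlonglongrightarrow> K x"
      using isCont_tendsto_compose[OF cont[OF elim], of "\<lambda>k. x + h k" sequentially] by simp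
    then have "(\<lambda>k. u k x) \<longlonglongrightarrow> K x powr q + K x powr q - \<bar>K x - K x\<bar> powr q"
      unfolding u_def using q nonneg by (intro tendsto_intros) auto
    then have "(\<lambda>k. ennreal (u k x)) \<longlonglongrightarrow> ennreal (2 * K x powr q)"
      by (intro tendsto_ennrealI) (simp add: q)
    then show ?case by (intro lim_imp_Liminf) auto
  qed
  have "ennreal (2 * I) = (\<integral>\<^sup>+x. ennreal (2 * K x powr q) \<partial>lborel)"
    using Lq by (subst nn_integral_eq_integral) (auto simp: I_def)
  also have "\<dots> = (\<integral>\<^sup>+x. liminf (\<lambda>k. ennreal (u k x)) \<partial>lborel)"
    using lim by (intro nn_integral_cong_AE) (auto elim: eventually_mono)
  also have "\<dots> \<le> liminf (\<lambda>k. \<integral>\<^sup>+x. ennreal (u k x) \<partial>lborel)"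
    by (rule nn_integral_liminf) (unfold u_def, measurable)
  also have "\<dots> = liminf (\<lambda>k. ennreal (2 * I - d k))"
    using uint u0 by (simp add: nn_integral_eq_integral)
  finally have fatou: "ennreal (2 * I) \<le> liminf (\<lambda>k. ennreal (2 * I - d k))" .
  have "d \<longlonglongrightarrow> 0"
  proof (rule LIMSEQ_I)
    fix e :: real assume e: "0 < e"
    have "0 \<le> I" unfolding I_def by simp
    show "\<exists>N. \<forall>k\<ge>N. norm (d k - 0) < e"
    proof (cases "I = 0")
      case True
      then have "d k = 0" for k using d0[of k] dle[of k] by simp
      then show ?thesis using e by auto
    next
      case False
      then have "ennreal (2 * I - e) < ennreal (2 * I)" using e \<open>0 \<le> I\<close> by (intro ennreal_lessI) auto
      then have "\<forall>\<^sub>F k in sequentially. ennreal (2 * I - e) < ennreal (2 * I - d k)"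
        using fatou less_LiminfD less_le_trans by blast
      then obtain N where N: "\<And>k. N \<le> k \<Longrightarrow> ennreal (2 * I - e) < ennreal (2 * I - d k)"
        unfolding eventually_sequentially by blast
      have "d k < e" if "N \<le> k" for k
        using N[OF that] by (smt (verit) ennreal_leI linorder_not_less)
      then show ?thesis using d0 by auto
    qed
  qed
  then show ?thesis by (simp add: d_def[abs_def])
qed

text \<open>
  Integrability to the exponent \<open>q\<close> governs the size and the regularity of the convolution with \<open>L^p\<close>
  functions, and integrability to the exponent 1 its norm in \<open>L^p\<close>.
\<close>

locale convolution_kernel =
  fixes K :: "real^'n::finite \<Rightarrow> real" and p q :: real
  assumes pq: "1 < p" "1 < q" "1 / p + 1 / q = 1"
    and meas [measurable]: "K \<in> borel_measurable borel"
    and nonneg: "0 \<le> K x"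
    and radial: "norm x = norm y \<Longrightarrow> K x = K y"
    and cont: "x \<noteq> 0 \<Longrightarrow> isCont K x"
    and L1: "integrable lborel K"
    and Lq: "integrable lborel (\<lambda>x. K x powr q)"
begin

definition modulus :: "real^'n \<Rightarrow> real" where
  "modulus h = (LINT x|lborel. \<bar>K (x + h) - K x\<bar> powr q) powr (1 / q)"

lemma modulus_tendsto_0: "(modulus \<longlongrightarrow> 0) (at 0)"
  unfolding tendsto_at_iff_sequentially comp_def
proof (intro allI impI)
  fix h :: "nat \<Rightarrow> real^'n" assume h: "h \<longlonglongrightarrow> 0"
  have "(\<lambda>k. LINT x|lborel. \<bar>K (x + h k) - K x\<bar> powr q) \<longlonglongrightarrow> 0"
    using pq nonneg cont Lq h by (intro Lq_convergence_of_translates) auto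
  then have "(\<lambda>k. (LINT x|lborel. \<bar>K (x + h k) - K x\<bar> powr q) powr (1 / q)) \<longlonglongrightarrow> 0 powr (1 / q)"
    using pq by (intro tendsto_powr2) auto
  then show "(\<lambda>k. modulus (h k)) \<longlonglongrightarrow> 0" by (simp add: modulus_def)
qed

definition conv :: "(real^'n \<Rightarrow> complex) \<Rightarrow> real^'n \<Rightarrow> complex" where
  "conv g x = (LINT y|lborel. of_real (K (x - y)) * g y)"

definition Lp_fun :: "(real^'n \<Rightarrow> complex) \<Rightarrow> bool" where
  "Lp_fun g \<longleftrightarrow> g \<in> borel_measurable borel \<and> integrable lborel (\<lambda>x. norm (g x) powr p)"

definition pnorm :: "(real^'n \<Rightarrow> complex) \<Rightarrow> real" where
  "pnorm g = (LINT x|lborel. norm (g x) powr p) powr (1 / p)"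

definition qnorm_kernel :: real where
  "qnorm_kernel = (LINT x|lborel. K x powr q) powr (1 / q)"

lemma pnorm_nonneg: "0 \<le> pnorm g" by (simp add: pnorm_def)

lemma integrable_shifted_kernel:
  "integrable lborel (\<lambda>y. \<bar>K (x - y)\<bar> powr q)"
  "(LINT y|lborel. \<bar>K (x - y)\<bar> powr q) = (LINT x|lborel. K x powr q)"
proof -
  have "integrable lborel (\<lambda>y. K (x + (- 1) *\<^sub>R y) powr q)"
    using Lq by (subst integrable_lborel_affine_iff) auto
  then show "integrable lborel (\<lambda>y. \<bar>K (x - y)\<bar> powr q)" using nonneg by simp
  show "(LINT y|lborel. \<bar>K (x - y)\<bar> powr q) = (LINT x|lborel. K x powr q)"
    using nonneg by (subst integral_lborel_affine[of "\<lambda>x. K x powr q" "-1" x]) auto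
qed

lemma
  assumes "Lp_fun g"
  shows integrable_conv: "integrable lborel (\<lambda>y. of_real (K (x - y)) * g y)"
    and norm_conv_le: "norm (conv g x) \<le> qnorm_kernel * pnorm g"
proof -
  note H = holder_integral[OF pq, of "\<lambda>y. K (x - y)" lborel g]
  have "(\<lambda>y. K (x - y)) \<in> borel_measurable lborel" "g \<in> borel_measurable lborel"
    "integrable lborel (\<lambda>x. norm (g x) powr p)"
    using assms by (auto simp: Lp_fun_def)
  with H integrable_shifted_kernel[of x]
  show "integrable lborel (\<lambda>y. of_real (K (x - y)) * g y)" "norm (conv g x) \<le> qnorm_kernel * pnorm g"
    by (auto simp: conv_def qnorm_kernel_def pnorm_def)
qed

lemma norm_conv_diff_le:
  assumes g: "Lp_fun g"
  shows "norm (conv g x - conv g y) \<le> modulus (x - y) * pnorm g"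
proof -
  have eq: "(\<lambda>z. \<bar>K (x - z) - K (y - z)\<bar> powr q) = (\<lambda>z. (\<lambda>w. \<bar>K (w + (x - y)) - K w\<bar> powr q) (y + (- 1) *\<^sub>R z))"
    by auto
  have bound: "integrable lborel (\<lambda>w. \<bar>K (w + (x - y)) - K w\<bar> powr q)"
  proof (rule Bochner_Integration.integrable_bound)
    show "integrable lborel (\<lambda>w. K (w + (x - y)) powr q + K w powr q)"
      using Lq integrable_lborel_affine_iff[of "\<lambda>w. K w powr q" 1 "x - y"]
      by (intro Bochner_Integration.integrable_add) (auto simp: add.commute)
    show "AE w in lborel. norm (\<bar>K (w + (x - y)) - K w\<bar> powr q) \<le> norm (K (w + (x - y)) powr q + K w powr q)"
      using powr_diff_le_add[OF nonneg nonneg] pq by (auto intro: order_trans[OF _ abs_ge_self])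
  qed measurable
  have "integrable lborel (\<lambda>z. \<bar>K (x - z) - K (y - z)\<bar> powr q)"
    unfolding eq using bound by (subst integrable_lborel_affine_iff) auto
  moreover have "(LINT z|lborel. \<bar>K (x - z) - K (y - z)\<bar> powr q) = (LINT w|lborel. \<bar>K (w + (x - y)) - K w\<bar> powr q)"
    unfolding eq by (subst integral_lborel_affine[of "\<lambda>w. \<bar>K (w + (x - y)) - K w\<bar> powr q" "-1" y]) auto
  moreover have "conv g x - conv g y = (LINT z|lborel. of_real (K (x - z) - K (y - z)) * g z)"
    unfolding conv_def using integrable_conv[OF g]
    by (subst Bochner_Integration.integral_diff[symmetric]) (auto simp: algebra_simps)
  moreover have "(\<lambda>z. K (x - z) - K (y - z)) \<in> borel_measurable lborel" by measurable
  ultimately show ?thesis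
    using holder_integral(2)[OF pq, of "\<lambda>z. K (x - z) - K (y - z)" lborel g] g
    by (simp add: modulus_def pnorm_def Lp_fun_def)
qed

text \<open>The modulus of continuity of the convolution depends on \<open>g\<close> only through its norm.\<close>

lemma equicontinuous_conv:
  assumes "0 < e"
  obtains d where "0 < d" "\<And>g x y. Lp_fun g \<Longrightarrow> pnorm g \<le> B \<Longrightarrow> norm (x - y) < d \<Longrightarrow> norm (conv g x - conv g y) < e"
proof -
  have e': "0 < e / (\<bar>B\<bar> + 1)" using assms by simp
  then obtain d where d: "0 < d" "\<And>h. h \<noteq> 0 \<Longrightarrow> norm h < d \<Longrightarrow> \<bar>modulus h\<bar> < e / (\<bar>B\<bar> + 1)"
    using modulus_tendsto_0 unfolding LIM_eq by force
  have "norm (conv g x - conv g y) < e" if g: "Lp_fun g" "pnorm g \<le> B" "norm (x - y) < d" for g x y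
  proof (cases "x = y")
    case False
    have "norm (conv g x - conv g y) \<le> modulus (x - y) * pnorm g" by (rule norm_conv_diff_le[OF g(1)])
    also have "\<dots> \<le> modulus (x - y) * (\<bar>B\<bar> + 1)"
      using g(2) by (intro mult_left_mono) (auto simp: modulus_def)
    also have "\<dots> < e"
    proof -
      have "0 \<le> modulus (x - y)" by (simp add: modulus_def)
      then have "modulus (x - y) < e / (\<bar>B\<bar> + 1)" using d(2)[of "x - y"] False g(3) by simp
      then show ?thesis by (simp add: pos_less_divide_eq)
    qed
    finally show ?thesis .
  qed (use assms in simp)
  with d(1) show ?thesis by (rule that)
qed

lemma continuous_conv:
  assumes g: "Lp_fun g"
  shows "continuous_on UNIV (conv g)"
  unfolding continuous_on_iff dist_norm
proof (intro ballI allI impI)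
  fix x and e :: real assume "0 < e"
  then obtain d where "0 < d" "\<And>h x y. Lp_fun h \<Longrightarrow> pnorm h \<le> pnorm g \<Longrightarrow> norm (x - y) < d \<Longrightarrow> norm (conv h x - conv h y) < e"
    using equicontinuous_conv[of e "pnorm g"] by blast
  then show "\<exists>d>0. \<forall>y\<in>UNIV. norm (y - x) < d \<longrightarrow> norm (conv g y - conv g x) < e"
    using g by blast
qed

text \<open>
  Hoelder's inequality for the measure \<open>K (x - y) dy\<close>, whose total mass does not depend on \<open>x\<close>,
  bounds \<open>|conv g x| powr p\<close> by a multiple of the convolution of \<open>K\<close> with \<open>|g| powr p\<close>.
\<close>

lemma young_inequality:
  obtains C where "0 \<le> C" "\<And>g. Lp_fun g \<Longrightarrow> integrable lborel (\<lambda>x. norm (conv g x) powr p) \<and>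
     (LINT x|lborel. norm (conv g x) powr p) \<le> C * (LINT x|lborel. norm (g x) powr p)"
proof -
  (* the additional 1 keeps the bound positive when K vanishes almost everywhere *)
  define \<kappa> where "\<kappa> = (LINT x|lborel. K x) + 1"
  have \<kappa>: "1 \<le> \<kappa>" using nonneg by (simp add: \<kappa>_def)
  have shift: "(\<integral>\<^sup>+y. ennreal (K (x - y)) \<partial>lborel) \<le> ennreal \<kappa>" "(\<integral>\<^sup>+x. ennreal (K (x - y)) \<partial>lborel) \<le> ennreal \<kappa>" for x y
  proof -
    have K: "(\<integral>\<^sup>+x. ennreal (K x) \<partial>lborel) \<le> ennreal \<kappa>"
      using L1 nonneg by (subst nn_integral_eq_integral) (auto simp: \<kappa>_def ennreal_leI)
    show "(\<integral>\<^sup>+y. ennreal (K (x - y)) \<partial>lborel) \<le> ennreal \<kappa>"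
      using K nn_integral_lborel_affine[of "\<lambda>x. ennreal (K x)" "-1" x] by simp
    show "(\<integral>\<^sup>+x. ennreal (K (x - y)) \<partial>lborel) \<le> ennreal \<kappa>"
      using K nn_integral_lborel_affine[of "\<lambda>x. ennreal (K x)" 1 "- y"] by (simp add: add.commute)
  qed
  have main: "integrable lborel (\<lambda>x. norm (conv g x) powr p) \<and>
     (LINT x|lborel. norm (conv g x) powr p) \<le> (\<kappa> powr (p / q) * \<kappa>) * (LINT x|lborel. norm (g x) powr p)" if g: "Lp_fun g" for g
  proof -
    have [measurable]: "g \<in> borel_measurable borel" using g by (simp add: Lp_fun_def)
    have [measurable]: "conv g \<in> borel_measurable borel"
      using continuous_conv[OF g] by (rule borel_measurable_continuous_onI)
    let ?J = "\<lambda>x. \<integral>\<^sup>+y. ennreal (K (x - y) * norm (g y) powr p) \<partial>lborel"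
    let ?G = "LINT x|lborel. norm (g x) powr p"
    have pointwise: "ennreal (norm (conv g x) powr p) \<le> ennreal (\<kappa> powr (p / q)) * ?J x" for x
    proof (cases "?J x = \<infinity>")
      case True
      have "0 < \<kappa> powr (p / q)" using \<kappa> by simp
      then show ?thesis unfolding True by (simp add: ennreal_mult_top)
    next
      case False
      then obtain J where J: "0 \<le> J" "?J x = ennreal J"
        by (cases "?J x") auto
      have "(\<integral>\<^sup>+y. ennreal ((K (x - y) powr (1 / p) * norm (g y)) * (K (x - y) powr (1 / q))) \<partial>lborel) \<le> ennreal (J powr (1 / p) * \<kappa> powr (1 / q))"
        using pq \<kappa> J nonneg shift(1)[of x]
        by (intro holder_nn_integral) (auto simp: powr_mult powr_powr)
      also have "(\<lambda>y. (K (x - y) powr (1 / p) * norm (g y)) * (K (x - y) powr (1 / q))) = (\<lambda>y. norm (of_real (K (x - y)) * g y))"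
      proof
        fix y
        have "K (x - y) powr (1 / p) * K (x - y) powr (1 / q) = K (x - y)"
          using nonneg[of "x - y"] pq by (simp flip: powr_add)
        then show "(K (x - y) powr (1 / p) * norm (g y)) * (K (x - y) powr (1 / q)) = norm (of_real (K (x - y)) * g y)"
          using nonneg[of "x - y"] by (simp add: norm_mult mult_ac)
      qed
      finally have "ennreal (LINT y|lborel. norm (of_real (K (x - y)) * g y)) \<le> ennreal (J powr (1 / p) * \<kappa> powr (1 / q))"
        using integrable_norm[OF integrable_conv[OF g, of x]] by (subst (asm) nn_integral_eq_integral) auto
      then have "(LINT y|lborel. norm (of_real (K (x - y)) * g y)) \<le> J powr (1 / p) * \<kappa> powr (1 / q)"
        by (subst (asm) ennreal_le_iff) auto
      with integral_norm_bound have "norm (conv g x) \<le> J powr (1 / p) * \<kappa> powr (1 / q)"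
        unfolding conv_def by (rule order_trans)
      then have "norm (conv g x) powr p \<le> (J powr (1 / p) * \<kappa> powr (1 / q)) powr p"
        using pq by (intro powr_mono2) auto
      also have "\<dots> = \<kappa> powr (p / q) * J" using pq J by (simp add: powr_mult powr_powr)
      finally show ?thesis unfolding J(2) using J(1) by (simp add: ennreal_leI flip: ennreal_mult)
    qed
    have "(\<integral>\<^sup>+x. ennreal (norm (conv g x) powr p) \<partial>lborel) \<le> (\<integral>\<^sup>+x. ennreal (\<kappa> powr (p / q)) * ?J x \<partial>lborel)"
      by (rule nn_integral_mono[OF pointwise])
    also have "\<dots> = ennreal (\<kappa> powr (p / q)) * (\<integral>\<^sup>+x. ?J x \<partial>lborel)"
      by (rule nn_integral_cmult) measurable
    also have "(\<integral>\<^sup>+x. ?J x \<partial>lborel) = (\<integral>\<^sup>+y. (\<integral>\<^sup>+x. ennreal (K (x - y) * norm (g y) powr p) \<partial>lborel) \<partial>lborel)"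
      by (rule lborel_pair.Fubini') measurable
    also have "\<dots> = (\<integral>\<^sup>+y. (\<integral>\<^sup>+x. ennreal (K (x - y)) \<partial>lborel) * ennreal (norm (g y) powr p) \<partial>lborel)"
      using nonneg by (intro nn_integral_cong) (simp add: ennreal_mult' nn_integral_multc)
    also have "\<dots> \<le> (\<integral>\<^sup>+y. ennreal \<kappa> * ennreal (norm (g y) powr p) \<partial>lborel)"
      by (intro nn_integral_mono mult_right_mono shift) auto
    also have "\<dots> = ennreal \<kappa> * ennreal ?G"
      using g by (subst nn_integral_cmult) (auto simp: Lp_fun_def nn_integral_eq_integral)
    also have "ennreal (\<kappa> powr (p / q)) * (ennreal \<kappa> * ennreal ?G) = ennreal ((\<kappa> powr (p / q) * \<kappa>) * ?G)"
      using \<kappa> by (simp add: mult.assoc flip: ennreal_mult)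
    finally have le: "(\<integral>\<^sup>+x. ennreal (norm (conv g x) powr p) \<partial>lborel) \<le> ennreal ((\<kappa> powr (p / q) * \<kappa>) * ?G)"
      by (simp add: mult_left_mono)
    then have "(\<integral>\<^sup>+x. ennreal (norm (conv g x) powr p) \<partial>lborel) < \<infinity>" by (rule le_less_trans) simp
    then have int: "integrable lborel (\<lambda>x. norm (conv g x) powr p)" by (intro integrableI_nonneg) auto
    moreover have "0 \<le> (\<kappa> powr (p / q) * \<kappa>) * ?G" using \<kappa> by (intro mult_nonneg_nonneg) auto
    ultimately show ?thesis using le by (simp add: nn_integral_eq_integral)
  qed
  show ?thesis using \<kappa> main by (intro that[of "\<kappa> powr (p / q) * \<kappa>"]) auto
qed

end

section \<open>Elements of the space as convolutions\<close>

lemma is_function_apply: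
  assumes "is_function u f" "\<phi> \<in> schwartz"
  shows "u \<phi> = (LINT x|lborel. f x * \<phi> x)"
proof -
  have "u = (\<lambda>\<phi>\<in>schwartz. LINT x|lborel. f x * \<phi> x)"
    using assms(1) by (simp only: is_function_def)
  from fun_cong[OF this, of \<phi>] show ?thesis
    using assms(2) by (simp only: restrict_apply')
qed

lemma is_function_unique:
  fixes u :: "'n::finite distrib"
  assumes F: "is_function u F" and G: "is_function u G"
  shows "AE x in lborel. F x = G x"
proof -
  have [measurable]: "F \<in> borel_measurable borel" "G \<in> borel_measurable borel"
    using assms by (auto simp: is_function_def)
  have "AE x in lborel. F x - G x = 0"
  proof (rule zero_if_annihilates_schwartz)
    fix \<phi> :: "real^'n \<Rightarrow> complex" assume \<phi>: "\<phi> \<in> schwartz"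
    have int: "integrable lborel (\<lambda>x. F x * \<phi> x)" "integrable lborel (\<lambda>x. G x * \<phi> x)"
      using assms \<phi> by (auto simp: is_function_def)
    then show "integrable lborel (\<lambda>x. (F x - G x) * \<phi> x)" by (simp add: left_diff_distrib)
    have "u \<phi> = (LINT x|lborel. F x * \<phi> x)"
      using F \<phi> by (rule is_function_apply)
    moreover have "u \<phi> = (LINT x|lborel. G x * \<phi> x)"
      using G \<phi> by (rule is_function_apply)
    ultimately show "(LINT x|lborel. (F x - G x) * \<phi> x) = 0"
      using int by (simp add: left_diff_distrib)
  qed measurable
  then show ?thesis by eventually_elim simp
qed

lemma fourier_schwartz: "\<phi> \<in> schwartz \<Longrightarrow> fourier \<phi> \<in> schwartz"
  unfolding fourier_eq_ft by (intro ft_schwartz) auto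

lemma inv_fourier_schwartz: "\<phi> \<in> schwartz \<Longrightarrow> inv_fourier \<phi> \<in> schwartz"
  unfolding inv_fourier_eq_ft by (intro ft_schwartz) auto

lemma fourier_inv_fourier: "\<phi> \<in> schwartz \<Longrightarrow> fourier (inv_fourier \<phi>) = \<phi>"
  unfolding fourier_eq_ft inv_fourier_eq_ft using ft_inversion[of "2 * pi" \<phi>] by simp

lemma inv_fourier_fourier: "\<phi> \<in> schwartz \<Longrightarrow> inv_fourier (fourier \<phi>) = \<phi>"
  unfolding fourier_eq_ft inv_fourier_eq_ft using ft_inversion[of "- 2 * pi" \<phi>] by simp

lemma fourier_multiplier_apply:
  assumes m: "m \<in> slow" and \<phi>: "\<phi> \<in> schwartz"
  shows "fourier_multiplier m u \<phi> = u (fourier (\<lambda>\<xi>. m \<xi> * inv_fourier \<phi> \<xi>))"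
  using slow_mult_schwartz[OF m inv_fourier_schwartz[OF \<phi>]] inv_fourier_schwartz[OF \<phi>] \<phi>
  by (simp add: fourier_multiplier_def distrib_inv_fourier_def distrib_mult_def distrib_fourier_def)

text \<open>
  The test function on the left is what the multiplier with the inverse symbol makes of \<open>\<psi>\<close>; the
  multiplier \<open>m\<close> undoes this.
\<close>

lemma fourier_multiplier_inverse:
  assumes m: "m \<in> slow" "m' \<in> slow" and inv: "\<And>\<xi>. m \<xi> * m' \<xi> = 1" and \<psi>: "\<psi> \<in> schwartz"
  shows "fourier_multiplier m u (fourier (\<lambda>\<xi>. m' \<xi> * inv_fourier \<psi> \<xi>)) = u \<psi>"
proof -
  have S: "(\<lambda>\<xi>. m' \<xi> * inv_fourier \<psi> \<xi>) \<in> schwartz"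
    by (intro slow_mult_schwartz m inv_fourier_schwartz \<psi>)
  have "(\<lambda>\<xi>. m \<xi> * (m' \<xi> * inv_fourier \<psi> \<xi>)) = inv_fourier \<psi>"
    by (simp add: inv flip: mult.assoc)
  then show ?thesis
    unfolding fourier_multiplier_apply[OF m(1) fourier_schwartz[OF S]] inv_fourier_fourier[OF S]
    by (simp only: fourier_inv_fourier[OF \<psi>])
qed

definition inverse_log_symbol :: "real \<Rightarrow> real \<Rightarrow> real^'n::finite \<Rightarrow> complex" where
  "inverse_log_symbol s lam \<xi> = of_real (bracket lam \<xi> powr (- s)) * of_real (1 / ln (bracket lam \<xi>))"

lemma log_symbol_slow: "1 < lam \<Longrightarrow> log_symbol s lam \<in> slow"
  unfolding log_symbol_def[abs_def] of_real_mult by (intro slow.mult slow.powr slow.ln)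

lemma inverse_log_symbol_slow: "1 < lam \<Longrightarrow> inverse_log_symbol s lam \<in> slow"
  unfolding inverse_log_symbol_def[abs_def] by (intro slow.mult slow.powr slow.inverse_ln)

lemma log_symbol_inverse:
  assumes "1 < lam"
  shows "log_symbol s lam \<xi> * inverse_log_symbol s lam \<xi> = 1"
proof -
  have b: "1 < bracket lam \<xi>" by (rule bracket_gt_1[OF assms])
  then have "0 < ln (bracket lam \<xi>)" by simp
  then have "bracket lam \<xi> powr s * ln (bracket lam \<xi>) * (bracket lam \<xi> powr (- s) * (1 / ln (bracket lam \<xi>))) = 1"
    using b by (simp add: powr_minus)
  then show ?thesis
    unfolding log_symbol_def inverse_log_symbol_def of_real_mult[symmetric] by simp
qed

text \<open>
  The multiplier with the inverse symbol is convolution with \<open>log_kernel\<close>: insert the kernel's Fourier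
  integral for the symbol, exchange the integrals and use Fourier inversion for \<open>\<psi>\<close>.
\<close>

lemma fourier_inverse_log_symbol_mult:
  fixes \<psi> :: "real^'n::finite \<Rightarrow> complex"
  assumes s: "0 < s" and lam: "1 < lam" and \<psi>: "\<psi> \<in> schwartz"
  shows "fourier (\<lambda>\<xi>. inverse_log_symbol s lam \<xi> * inv_fourier \<psi> \<xi>) y =
    (LINT x|lborel. of_real (log_kernel s lam (y - x)) * \<psi> x)"
proof -
  let ?K = "log_kernel s lam :: real^'n \<Rightarrow> real"
  have [measurable]: "?K \<in> borel_measurable borel" by (rule measurable_log_kernel[OF s lam])
  have [measurable]: "\<psi> \<in> borel_measurable borel" using \<psi> by (rule measurable_schwartz)
  have F: "inv_fourier \<psi> \<in> schwartz" by (rule inv_fourier_schwartz[OF \<psi>])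
  have symbol: "inverse_log_symbol s lam \<xi> = (LINT z|lborel. of_real (?K z) * cis (2 * pi * (z \<bullet> \<xi>)))" for \<xi>
    unfolding fourier_log_kernel[OF s lam] inverse_log_symbol_def
    by (simp add: power_mult_distrib)
  have "fourier (\<lambda>\<xi>. inverse_log_symbol s lam \<xi> * inv_fourier \<psi> \<xi>) y =
    (LINT \<xi>|lborel. (LINT z|lborel. inv_fourier \<psi> \<xi> * of_real (?K z) * cis (- 2 * pi * (\<xi> \<bullet> (y - z)))))"
    unfolding fourier_def
  proof (rule Bochner_Integration.integral_cong[OF refl])
    fix \<xi> :: "real^'n"
    have "inv_fourier \<psi> \<xi> * of_real (?K z) * cis (- 2 * pi * (\<xi> \<bullet> (y - z))) =
      (inv_fourier \<psi> \<xi> * cis (- 2 * pi * (\<xi> \<bullet> y))) * (of_real (?K z) * cis (2 * pi * (z \<bullet> \<xi>)))" for z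
    proof -
      have "cis (- 2 * pi * (\<xi> \<bullet> (y - z))) = cis (- 2 * pi * (\<xi> \<bullet> y)) * cis (2 * pi * (z \<bullet> \<xi>))"
        unfolding cis_mult by (simp add: inner_diff_right inner_commute algebra_simps)
      then show ?thesis by (simp only: mult_ac)
    qed
    then show "inverse_log_symbol s lam \<xi> * inv_fourier \<psi> \<xi> * cis (- 2 * pi * (\<xi> \<bullet> y)) =
      (LINT z|lborel. inv_fourier \<psi> \<xi> * of_real (?K z) * cis (- 2 * pi * (\<xi> \<bullet> (y - z))))"
      by (simp only: integral_mult_right_zero symbol) (simp only: mult_ac)
  qed
  also have "\<dots> = (LINT z|lborel. (LINT \<xi>|lborel. inv_fourier \<psi> \<xi> * of_real (?K z) * cis (- 2 * pi * (\<xi> \<bullet> (y - z)))))"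
  proof (rule lborel_pair.Fubini_integral[symmetric], rule integrable_pair_mult_bounded)
    show "integrable lborel (inv_fourier \<psi>)" by (rule integrable_schwartz[OF F])
    show "integrable lborel (\<lambda>z. complex_of_real (?K z))"
      by (rule integrable_of_real[OF integrable_log_kernel[OF s lam]])
    show "(\<lambda>(\<xi>, z). cis (- 2 * pi * (\<xi> \<bullet> (y - z)))) \<in> borel_measurable (borel \<Otimes>\<^sub>M borel)" by measurable
    show "norm (cis (- 2 * pi * (\<xi> \<bullet> (y - z)))) \<le> 1" for \<xi> z by simp
  qed
  also have "\<dots> = (LINT z|lborel. of_real (?K z) * fourier (inv_fourier \<psi>) (y - z))"
    unfolding fourier_def by (subst integral_mult_right_zero[symmetric]) (simp only: mult_ac)
  also have "\<dots> = (LINT z|lborel. of_real (?K z) * \<psi> (y - z))"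
    by (simp add: fourier_inv_fourier[OF \<psi>])
  also have "\<dots> = (LINT x|lborel. of_real (?K (y - x)) * \<psi> x)"
    by (subst integral_lborel_affine[of _ "- 1" y]) auto
  finally show ?thesis .
qed

text \<open>Convolution with an even kernel is symmetric with respect to the pairing of functions.\<close>

lemma (in convolution_kernel) integral_conv_mult:
  assumes g: "Lp_fun g" and \<psi>: "\<psi> \<in> schwartz"
  shows "(LINT y|lborel. g y * (LINT x|lborel. of_real (K (y - x)) * \<psi> x)) = (LINT x|lborel. conv g x * \<psi> x)"
    and "integrable lborel (\<lambda>x. conv g x * \<psi> x)"
proof -
  have [measurable]: "g \<in> borel_measurable borel" using g by (simp add: Lp_fun_def)
  have [measurable]: "\<psi> \<in> borel_measurable borel" using \<psi> by (rule measurable_schwartz)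
  have [measurable]: "conv g \<in> borel_measurable borel"
    using continuous_conv[OF g] by (rule borel_measurable_continuous_onI)
  show "integrable lborel (\<lambda>x. conv g x * \<psi> x)"
  proof (rule Bochner_Integration.integrable_bound)
    show "integrable lborel (\<lambda>x. of_real (qnorm_kernel * pnorm g) * \<psi> x)"
      using integrable_schwartz[OF \<psi>] by simp
    show "AE x in lborel. norm (conv g x * \<psi> x) \<le> norm (of_real (qnorm_kernel * pnorm g) * \<psi> x)"
      using norm_conv_le[OF g] unfolding norm_mult norm_of_real
      by (intro AE_I2 mult_right_mono) (auto intro: order_trans[OF _ abs_ge_self] simp del: abs_mult)
  qed measurable
  (* the convolution with the modulus of g is bounded, which gives absolute convergence *)
  define g' where "g' y = complex_of_real (norm (g y))" for y
  have g': "Lp_fun g'" using g by (simp add: Lp_fun_def g'_def[abs_def])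
  let ?f = "\<lambda>x y. of_real (K (x - y)) * g y * \<psi> x"
  have int: "integrable (lborel \<Otimes>\<^sub>M lborel) (\<lambda>(x, y). ?f x y)"
  proof (rule lborel_pair.Fubini_integrable)
    show "(\<lambda>(x, y). ?f x y) \<in> borel_measurable (lborel \<Otimes>\<^sub>M lborel)" by measurable
    have inty: "integrable lborel (\<lambda>y. ?f x y)" for x using integrable_conv[OF g, of x] by simp
    then show "AE x in lborel. integrable lborel (\<lambda>y. case (x, y) of (x, y) \<Rightarrow> ?f x y)" by simp
    have "norm (LINT y|lborel. norm (?f x y)) \<le> norm (of_real (qnorm_kernel * pnorm g') * \<psi> x)" for x
    proof -
      have eq: "(LINT y|lborel. norm (?f x y)) = norm (conv g' x) * norm (\<psi> x)"
      proof -
        have "conv g' x = of_real (LINT y|lborel. K (x - y) * norm (g y))"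
          unfolding conv_def g'_def by (simp flip: of_real_mult)
        then have "norm (conv g' x) = (LINT y|lborel. K (x - y) * norm (g y))"
          using nonneg by (simp add: integral_nonneg_AE)
        then show ?thesis using nonneg by (simp add: norm_mult)
      qed
      have "norm (conv g' x) * norm (\<psi> x) \<le> \<bar>qnorm_kernel * pnorm g'\<bar> * norm (\<psi> x)"
        by (intro mult_right_mono order_trans[OF norm_conv_le[OF g'] abs_ge_self]) auto
      then show ?thesis
        unfolding eq norm_mult[of "of_real _"] norm_of_real by simp
    qed
    note bound = this
    have "integrable lborel (\<lambda>x. LINT y|lborel. norm (?f x y))"
    proof (rule Bochner_Integration.integrable_bound)
      show "integrable lborel (\<lambda>x. of_real (qnorm_kernel * pnorm g') * \<psi> x)"
        by (rule integrable_mult_right[OF integrable_schwartz[OF \<psi>]])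
      show "(\<lambda>x. LINT y|lborel. norm (?f x y)) \<in> borel_measurable lborel" by measurable
      show "AE x in lborel. norm (LINT y|lborel. norm (?f x y)) \<le> norm (of_real (qnorm_kernel * pnorm g') * \<psi> x)"
        using bound by (rule AE_I2)
    qed
    then show "integrable lborel (\<lambda>x. LINT y|lborel. norm (case (x, y) of (x, y) \<Rightarrow> ?f x y))"
      by (simp only: prod.case)
  qed
  have "(LINT y|lborel. g y * (LINT x|lborel. of_real (K (y - x)) * \<psi> x)) = (LINT y|lborel. (LINT x|lborel. ?f x y))"
    by (subst integral_mult_right_zero[symmetric]) (simp add: radial[OF norm_minus_commute] mult_ac)
  also have "\<dots> = (LINT x|lborel. (LINT y|lborel. ?f x y))"
    using int by (rule lborel_pair.Fubini_integral)
  also have "\<dots> = (LINT x|lborel. conv g x * \<psi> x)"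
    by (simp add: conv_def)
  finally show "(LINT y|lborel. g y * (LINT x|lborel. of_real (K (y - x)) * \<psi> x)) = (LINT x|lborel. conv g x * \<psi> x)" .
qed

text \<open>
  The argument \<open>dim\<close> only fixes the dimension \<open>n\<close>, which does not occur in the types of the other
  parameters.
\<close>

locale log_potential =
  fixes s p lam :: real and dim :: "'n::finite itself"
  assumes s: "0 < s" and p: "1 < p" and lam: "1 < lam" and dim: "real CARD('n) = 2 * s * p"
begin

sublocale convolution_kernel "log_kernel s lam :: real^'n \<Rightarrow> real" p "p / (p - 1)"
proof
  let ?q = "p / (p - 1)"
  show "1 < p" by (rule p)
  show "1 < ?q" "1 / p + 1 / ?q = 1" using p by (auto simp: field_simps)
  show "(log_kernel s lam :: real^'n \<Rightarrow> real) \<in> borel_measurable borel" by (rule measurable_log_kernel[OF s lam])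
  show "0 \<le> log_kernel s lam x" for x :: "real^'n" by (rule log_kernel_nonneg[OF s lam])
  show "log_kernel s lam x = log_kernel s lam y" if "norm x = norm y" for x y :: "real^'n"
    using that by (rule log_kernel_norm[OF s lam])
  show "isCont (log_kernel s lam) x" if "x \<noteq> 0" for x :: "real^'n" using that by (rule isCont_log_kernel[OF s lam])
  show "integrable lborel (log_kernel s lam :: real^'n \<Rightarrow> real)" by (rule integrable_log_kernel[OF s lam])
  show "integrable lborel (\<lambda>x::real^'n. log_kernel s lam x powr ?q)"
    using log_kernel_Lq[OF s lam p dim refl] measurable_log_kernel[OF s lam, where 'n = 'n]
    by (intro integrableI_nonneg) auto
qed

lemma Lp_norm_eq_pnorm: "Lp_norm (ennreal p) lborel g = pnorm g"
  using p by (simp add: Lp_norm_def pnorm_def)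

text \<open>
  Every test function \<open>\<psi>\<close> is the image under the operator of the test function \<open>K * \<psi>\<close>, so the value
  \<open>u \<psi>\<close> is the pairing of \<open>g\<close> with \<open>K * \<psi>\<close>, hence that of \<open>K * g\<close> with \<open>\<psi>\<close>.
\<close>

lemma log_space_representation:
  assumes u: "u \<in> (log_space p s lam :: 'n distrib set)"
  obtains g where "Lp_fun g" "pnorm g = log_norm p s lam u" "is_function u (conv g)"
proof -
  let ?P = "\<lambda>g. g \<in> Lp_space (ennreal p) lborel \<and> is_function (log_op s lam u) g"
  define g where "g = (SOME g. ?P g)"
  have "\<exists>g. ?P g" using u by (auto simp: log_space_def)
  then have g: "?P g" unfolding g_def by (rule someI_ex)
  have norm: "pnorm g = log_norm p s lam u"
    by (simp add: log_norm_def g_def Lp_norm_eq_pnorm)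
  have Lp: "Lp_fun g" using g p by (simp add: Lp_space_def Lp_fun_def)
  have ext: "u \<in> extensional schwartz" using u by (simp add: log_space_def tempered_def)
  have "u \<psi> = (LINT x|lborel. conv g x * \<psi> x)" if \<psi>: "\<psi> \<in> schwartz" for \<psi>
  proof -
    let ?\<phi> = "fourier (\<lambda>\<xi>. inverse_log_symbol s lam \<xi> * inv_fourier \<psi> \<xi>)"
    have \<phi>: "?\<phi> \<in> schwartz"
      by (intro fourier_schwartz slow_mult_schwartz inverse_log_symbol_slow inv_fourier_schwartz lam \<psi>)
    have "u \<psi> = log_op s lam u ?\<phi>"
      unfolding log_op_def
      by (rule fourier_multiplier_inverse[OF log_symbol_slow[OF lam] inverse_log_symbol_slow[OF lam]
            log_symbol_inverse[OF lam] \<psi>, symmetric])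
    also have "\<dots> = (LINT y|lborel. g y * ?\<phi> y)"
      using conjunct2[OF g] \<phi> by (rule is_function_apply)
    also have "\<dots> = (LINT x|lborel. conv g x * \<psi> x)"
      unfolding fourier_inverse_log_symbol_mult[OF s lam \<psi>] by (rule integral_conv_mult[OF Lp \<psi>])
    finally show ?thesis .
  qed
  then have "u = (\<lambda>\<phi>\<in>schwartz. LINT x|lborel. conv g x * \<phi> x)"
    using ext by (intro extensionalityI[of _ schwartz]) auto
  moreover have "conv g \<in> borel_measurable lborel"
    using borel_measurable_continuous_onI[OF continuous_conv[OF Lp]] by simp
  ultimately have "is_function u (conv g)"
    unfolding is_function_def using integral_conv_mult(2)[OF Lp] by blast
  with Lp norm show ?thesis by (rule that)
qed

end

section \<open>Compactness on bounded sets\<close>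

text \<open>A nonempty open set is not negligible.\<close>

lemma AE_eq_imp_eq_on_open:
  fixes f v :: "'a::euclidean_space \<Rightarrow> complex"
  assumes S: "open S" and f: "continuous_on S f" and v: "continuous_on S v"
    and ae: "AE x in lborel. x \<in> S \<longrightarrow> f x = v x" and x: "x \<in> S"
  shows "f x = v x"
proof (rule ccontr)
  assume ne: "f x \<noteq> v x"
  let ?T = "S \<inter> (\<lambda>x. f x - v x) -` (- {0})"
  have "open ?T"
    using S by (intro continuous_open_preimage continuous_intros f v) auto
  moreover have "x \<in> ?T" using x ne by simp
  ultimately have "\<not> negligible ?T" using open_not_negligible by blast
  moreover have "AE x in lebesgue. x \<in> S \<longrightarrow> f x = v x" using ae by (simp add: AE_completion_iff)
  then have "AE x in lebesgue. x \<notin> ?T" by eventually_elim auto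
  then have "?T \<in> null_sets lebesgue"
    using \<open>open ?T\<close> by (intro AE_iff_null_sets[THEN iffD2]) (auto simp: borel_open sets_completionI_sets)
  ultimately show False by (simp add: negligible_iff_null_sets)
qed

lemma sup_norm_le: "S \<noteq> {} \<Longrightarrow> (\<And>x. x \<in> S \<Longrightarrow> norm (f x) \<le> c) \<Longrightarrow> sup_norm S f \<le> c"
  unfolding sup_norm_def by (rule cSUP_least)

lemma sup_norm_nonneg:
  assumes "S \<noteq> {}" "\<And>x. x \<in> S \<Longrightarrow> norm (f x) \<le> c"
  shows "0 \<le> sup_norm S f"
proof -
  obtain x where x: "x \<in> S" using assms by blast
  have "norm (f x) \<le> sup_norm S f"
    unfolding sup_norm_def using assms x by (intro cSUP_upper bdd_aboveI2[of _ _ c]) auto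
  then show ?thesis using norm_ge_zero order_trans by blast
qed

lemma sup_norm_tendsto_0:
  assumes S: "S \<noteq> {}"
    and unif: "\<And>e. 0 < e \<Longrightarrow> \<exists>N. \<forall>n\<ge>N. \<forall>x\<in>S. norm (F n x) < e"
  shows "(\<lambda>n. sup_norm S (F n)) \<longlonglongrightarrow> 0"
proof (rule LIMSEQ_I)
  fix e :: real assume "0 < e"
  then obtain N where N: "\<And>n x. N \<le> n \<Longrightarrow> x \<in> S \<Longrightarrow> norm (F n x) < e / 2"
    using unif[of "e / 2"] by auto
  have "norm (sup_norm S (F n) - 0) < e" if "N \<le> n" for n
  proof -
    have le: "norm (F n x) \<le> e / 2" if "x \<in> S" for x using N[OF \<open>N \<le> n\<close> that] by simp
    have "sup_norm S (F n) \<le> e / 2" by (rule sup_norm_le[OF S le])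
    moreover have "0 \<le> sup_norm S (F n)" by (rule sup_norm_nonneg[OF S le])
    ultimately show ?thesis using \<open>0 < e\<close> by simp
  qed
  then show "\<exists>N. \<forall>n\<ge>N. norm (sup_norm S (F n) - 0) < e" by blast
qed

text \<open>On a measure space of measure 0 the essential supremum is \<open>- \<infinity>\<close>, which \<open>real_of_ereal\<close> maps to 0.\<close>

lemma Lp_norm_nonneg: "0 \<le> Lp_norm q M f"
proof (cases "q = \<infinity>")
  case True
  show ?thesis
  proof (cases "esssup M (\<lambda>x. ereal (norm (f x))) < 0")
    case neg: True
    have "AE x in M. False"
      using esssup_AE[of "\<lambda>x. ereal (norm (f x))" M]
    proof eventually_elim
      case (elim x)
      from elim neg have "ereal (norm (f x)) < 0" by (rule le_less_trans)
      then show False by simp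
    qed
    then have "esssup M (\<lambda>x. ereal (norm (f x))) \<le> - \<infinity>" if "(\<lambda>x. ereal (norm (f x))) \<in> borel_measurable M"
      using that by (intro esssup_I) auto
    moreover have "(\<lambda>x. ereal (norm (f x))) \<in> borel_measurable M"
    proof (rule ccontr)
      assume "(\<lambda>x. ereal (norm (f x))) \<notin> borel_measurable M"
      from esssup_non_measurable[OF this] neg show False by (simp add: top_ereal_def)
    qed
    ultimately have "esssup M (\<lambda>x. ereal (norm (f x))) = - \<infinity>" by simp
    then show ?thesis using True by (simp add: Lp_norm_def)
  next
    case False
    then show ?thesis using True by (simp add: Lp_norm_def real_of_ereal_pos)
  qed
qed (simp add: Lp_norm_def)

lemma Lp_infinity_bounded:
  assumes [measurable]: "f \<in> borel_measurable M" and ae: "AE x in M. norm (f x) \<le> c" and "0 \<le> c"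
  shows "f \<in> Lp_space \<infinity> M" "Lp_norm \<infinity> M f \<le> c"
proof -
  have le: "esssup M (\<lambda>x. ereal (norm (f x))) \<le> ereal c"
    using ae by (intro esssup_I) auto
  then have "esssup M (\<lambda>x. ereal (norm (f x))) < \<infinity>" by (rule le_less_trans) simp
  then show "f \<in> Lp_space \<infinity> M" by (simp add: Lp_space_def)
  show "Lp_norm \<infinity> M f \<le> c"
    using le \<open>0 \<le> c\<close> by (cases "esssup M (\<lambda>x. ereal (norm (f x)))") (auto simp: Lp_norm_def)
qed

lemma Lp_bounded_finite_measure:
  fixes M :: "'a measure"
  assumes fin: "finite_measure M" and q: "1 \<le> q"
  obtains A where "0 \<le> A" "\<And>(f :: 'a \<Rightarrow> complex) c. f \<in> borel_measurable M \<Longrightarrow> AE x in M. norm (f x) \<le> c \<Longrightarrow> 0 \<le> c \<Longrightarrow>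
     f \<in> Lp_space q M \<and> Lp_norm q M f \<le> A * c"
proof (cases q)
  case top
  show ?thesis
    by (rule that[of 1]) (use Lp_infinity_bounded in \<open>auto simp: top\<close>)
next
  case (real q')
  interpret finite_measure M by (rule fin)
  have q': "1 \<le> q'" using q real by simp
  let ?m = "measure M (space M)"
  show ?thesis
  proof (rule that[of "?m powr (1 / q')"])
    fix f :: "'a \<Rightarrow> complex" and c assume f [measurable]: "f \<in> borel_measurable M" and ae: "AE x in M. norm (f x) \<le> c" and c: "0 \<le> (c::real)"
    have ae': "AE x in M. norm (f x) powr q' \<le> c powr q'"
      using ae by eventually_elim (use q' in \<open>auto intro: powr_mono2\<close>)
    have int: "integrable M (\<lambda>x. norm (f x) powr q')"
      using ae' by (intro integrable_const_bound[of _ "c powr q'"]) auto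
    have "(LINT x|M. norm (f x) powr q') \<le> (LINT x|M. c powr q')"
      using int ae' by (intro integral_mono_AE) auto
    then have "(LINT x|M. norm (f x) powr q') powr (1 / q') \<le> (?m * c powr q') powr (1 / q')"
      using q' by (intro powr_mono2) auto
    also have "\<dots> = ?m powr (1 / q') * c" using q' c by (simp add: powr_mult powr_powr)
    finally show "f \<in> Lp_space q M \<and> Lp_norm q M f \<le> ?m powr (1 / q') * c"
      using int q' real by (simp add: Lp_space_def Lp_norm_def)
  qed simp
qed

lemma compact_embeddingI:
  assumes "\<And>u. u \<in> X \<Longrightarrow> \<exists>f\<in>Y. R u f"
    and "\<And>u f. u \<in> X \<Longrightarrow> f \<in> Y \<Longrightarrow> R u f \<Longrightarrow> norm_Y f \<le> C * norm_X u"
    and "\<And>u f B. (\<And>k. u k \<in> X) \<Longrightarrow> (\<And>k. f k \<in> Y) \<Longrightarrow> (\<And>k. R (u k) (f k)) \<Longrightarrow> (\<And>k. norm_X (u k) \<le> B) \<Longrightarrow>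
      \<exists>r g. strict_mono (r :: nat \<Rightarrow> nat) \<and> g \<in> Y \<and> (\<lambda>k. norm_Y (\<lambda>x. f (r k) x - g x)) \<longlonglongrightarrow> 0"
  shows "compact_embedding X norm_X R Y norm_Y"
  unfolding compact_embedding_def using assms by blast

context log_potential
begin

lemma restricts_to_imp_AE:
  assumes "restricts_to S u f" "is_function u v"
  shows "AE x in lborel. x \<in> S \<longrightarrow> f x = v x"
proof -
  from assms(1) obtain F where F: "is_function u F" "AE x in lborel. x \<in> S \<longrightarrow> f x = F x"
    by (auto simp: restricts_to_def)
  from F(2) is_function_unique[OF F(1) assms(2)] show ?thesis by eventually_elim simp
qed

lemma conv_measurable: "Lp_fun g \<Longrightarrow> conv g \<in> borel_measurable borel"
  by (rule borel_measurable_continuous_onI[OF continuous_conv])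

lemma equicontinuous_subsequence:
  assumes S: "compact S" and g: "\<And>k. Lp_fun (g k)" "\<And>k. pnorm (g k) \<le> B"
  obtains r h where "strict_mono (r :: nat \<Rightarrow> nat)" "continuous_on S h"
    "\<And>e. 0 < e \<Longrightarrow> \<exists>N. \<forall>k\<ge>N. \<forall>x\<in>S. norm (conv (g (r k)) x - h x) < e"
proof (rule Arzela_Ascoli[OF S, of "\<lambda>k. conv (g k)" "qnorm_kernel * B"])
  fix k x
  have "norm (conv (g k) x) \<le> qnorm_kernel * pnorm (g k)" by (rule norm_conv_le[OF g(1)])
  also have "\<dots> \<le> qnorm_kernel * B" using g(2) by (intro mult_left_mono) (auto simp: qnorm_kernel_def)
  finally show "norm (conv (g k) x) \<le> qnorm_kernel * B" .
next
  fix x and e :: real assume "0 < e"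
  then show "\<exists>d>0. \<forall>n y. y \<in> S \<and> norm (x - y) < d \<longrightarrow> norm (conv (g n) x - conv (g n) y) < e"
  proof -
    obtain d where "0 < d" "\<And>g x y. Lp_fun g \<Longrightarrow> pnorm g \<le> B \<Longrightarrow> norm (x - y) < d \<Longrightarrow> norm (conv g x - conv g y) < e"
      using equicontinuous_conv[OF \<open>0 < e\<close>, of B] by blast
    then show ?thesis using g by (intro exI[of _ d]) auto
  qed
next
  fix h r assume "continuous_on S h" "strict_mono (r :: nat \<Rightarrow> nat)"
    "\<And>e. 0 < e \<Longrightarrow> \<exists>N. \<forall>n x. n \<ge> N \<and> x \<in> S \<longrightarrow> norm (conv (g (r n)) x - h x) < e"
  then show thesis by (intro that[of r h]) blast+
qed

lemma log_space_bounded_sequence: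
  assumes "\<And>k. u k \<in> (log_space p s lam :: 'n distrib set)" "\<And>k. log_norm p s lam (u k) \<le> B"
  obtains g where "\<And>k::nat. Lp_fun (g k)" "\<And>k. pnorm (g k) \<le> B" "\<And>k. is_function (u k) (conv (g k))"
proof -
  have "\<exists>g. Lp_fun g \<and> pnorm g \<le> B \<and> is_function (u k) (conv g)" for k
    using log_space_representation[OF assms(1)] assms(2) by metis
  then show ?thesis using that by metis
qed

text \<open>
  Two continuous functions on the closure that agree almost everywhere on \<open>\<Omega>\<close> are equal, so the image of
  \<open>u\<close> is the restriction of its convolution.
\<close>

theorem compact_embedding_continuous:
  assumes \<Omega>: "bounded \<Omega>" "open \<Omega>" "\<Omega> \<noteq> {}"
  shows "compact_embedding (log_space p s lam :: 'n distrib set) (log_norm p s lam) (restricts_to \<Omega>)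
           (cont_space (closure \<Omega>)) (sup_norm (closure \<Omega>))"
proof (rule compact_embeddingI)
  have ne: "closure \<Omega> \<noteq> {}" using \<Omega> by simp
  have eq: "f x = conv g x"
    if g: "Lp_fun g" "is_function u (conv g)" and f: "restricts_to \<Omega> u f" "f \<in> cont_space (closure \<Omega>)"
      and x: "x \<in> closure \<Omega>"
    for u :: "'n distrib" and f g x
  proof -
    have cf: "continuous_on (closure \<Omega>) f" using f by (simp add: cont_space_def)
    have cv: "continuous_on (closure \<Omega>) (conv g)" using continuous_conv[OF g(1)] by (rule continuous_on_subset) simp
    have "f y = conv g y" if "y \<in> \<Omega>" for y
      using \<Omega>(2) continuous_on_subset[OF cf closure_subset] continuous_on_subset[OF cv closure_subset]
        restricts_to_imp_AE[OF f(1) g(2)] that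
      by (rule AE_eq_imp_eq_on_open)
    then have zero: "f y - conv g y = 0" if "y \<in> \<Omega>" for y using that by simp
    have "f x - conv g x = 0"
      by (rule continuous_constant_on_closure[of \<Omega> "\<lambda>x. f x - conv g x", OF continuous_on_diff[OF cf cv] zero x])
    then show ?thesis by simp
  qed
  show "\<exists>f\<in>cont_space (closure \<Omega>). restricts_to \<Omega> u f" if u: "u \<in> log_space p s lam" for u :: "'n distrib"
  proof -
    obtain g where g: "Lp_fun g" "is_function u (conv g)" using u by (rule log_space_representation)
    have "conv g \<in> cont_space (closure \<Omega>)"
      using continuous_on_subset[OF continuous_conv[OF g(1)]] by (simp add: cont_space_def)
    then show ?thesis using g(2) by (auto simp: restricts_to_def)
  qed
  show "sup_norm (closure \<Omega>) f \<le> qnorm_kernel * log_norm p s lam u"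
    if u: "u \<in> log_space p s lam" and f: "f \<in> cont_space (closure \<Omega>)" "restricts_to \<Omega> u f" for u :: "'n distrib" and f
  proof -
    obtain g where g: "Lp_fun g" "pnorm g = log_norm p s lam u" "is_function u (conv g)"
      using u by (rule log_space_representation)
    show ?thesis
      using eq[OF g(1,3) f(2,1)] norm_conv_le[OF g(1)] by (intro sup_norm_le ne) (simp add: g(2))
  qed
  fix u :: "nat \<Rightarrow> 'n distrib" and f B
  assume u: "\<And>k. u k \<in> log_space p s lam" "\<And>k. log_norm p s lam (u k) \<le> B"
    and f: "\<And>k. f k \<in> cont_space (closure \<Omega>)" "\<And>k. restricts_to \<Omega> (u k) (f k)"
  obtain g where g: "\<And>k. Lp_fun (g k)" "\<And>k. pnorm (g k) \<le> B" "\<And>k. is_function (u k) (conv (g k))"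
    by (rule log_space_bounded_sequence[of u B, OF u]) blast
  obtain r h where r: "strict_mono (r :: nat \<Rightarrow> nat)" "continuous_on (closure \<Omega>) h"
    "\<And>e. 0 < e \<Longrightarrow> \<exists>N. \<forall>k\<ge>N. \<forall>x\<in>closure \<Omega>. norm (conv (g (r k)) x - h x) < e"
    by (rule equicontinuous_subsequence[of "closure \<Omega>" g B, OF _ g(1,2)]) (use \<Omega>(1) in \<open>simp, blast\<close>)
  have "f k x = conv (g k) x" if "x \<in> closure \<Omega>" for k x
    using eq[OF g(1,3) f(2,1) that] .
  then have "(\<lambda>k. sup_norm (closure \<Omega>) (\<lambda>x. f (r k) x - h x)) \<longlonglongrightarrow> 0"
    using r(3) by (intro sup_norm_tendsto_0 ne) simp
  with r(1,2) show "\<exists>r g. strict_mono (r :: nat \<Rightarrow> nat) \<and> g \<in> cont_space (closure \<Omega>) \<and>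
      (\<lambda>k. sup_norm (closure \<Omega>) (\<lambda>x. f (r k) x - g x)) \<longlonglongrightarrow> 0"
    by (auto simp: cont_space_def)
qed

text \<open>On a set of finite measure, uniform convergence implies convergence in \<open>L^q\<close>.\<close>

theorem compact_embedding_Lq_bounded:
  assumes \<Omega>: "bounded \<Omega>" "open \<Omega>" and q: "1 \<le> q"
  shows "compact_embedding (log_space p s lam :: 'n distrib set) (log_norm p s lam) (restricts_to \<Omega>)
           (Lp_space q (restrict_space lborel \<Omega>)) (Lp_norm q (restrict_space lborel \<Omega>))"
proof -
  let ?M = "restrict_space lborel \<Omega> :: (real^'n) measure"
  have \<Omega>': "\<Omega> \<in> sets lborel" using \<Omega>(2) by simp
  have "emeasure lborel \<Omega> < \<infinity>" using emeasure_bounded_finite[OF \<Omega>(1)] by simp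
  then have "finite_measure ?M"
    using \<Omega>' by (intro finite_measureI) (simp add: emeasure_restrict_space space_restrict_space less_top)
  then obtain A where A: "0 \<le> A" "\<And>f c. f \<in> borel_measurable ?M \<Longrightarrow> AE x in ?M. norm (f x) \<le> c \<Longrightarrow> 0 \<le> c \<Longrightarrow>
     f \<in> Lp_space q ?M \<and> Lp_norm q ?M f \<le> A * c"
    using q by (rule Lp_bounded_finite_measure) blast
  have meas: "f \<in> borel_measurable ?M" if "continuous_on \<Omega> f" for f :: "real^'n \<Rightarrow> complex"
    using borel_measurable_continuous_on_restrict[OF that]
    by (subst measurable_cong_sets[OF sets_restrict_space_cong[OF sets_lborel] refl])
  have ae: "AE x in ?M. f x = conv g x" if "is_function u (conv g)" "restricts_to \<Omega> u f"
    for u :: "'n distrib" and f g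
    using restricts_to_imp_AE[OF that(2,1)] \<Omega>' by (subst AE_restrict_space_iff) auto
  have qn: "0 \<le> qnorm_kernel" by (simp add: qnorm_kernel_def)
  show ?thesis
  proof (rule compact_embeddingI)
    show "\<exists>f\<in>Lp_space q ?M. restricts_to \<Omega> u f" if u: "u \<in> log_space p s lam" for u :: "'n distrib"
    proof -
      obtain g where g: "Lp_fun g" "is_function u (conv g)" using u by (rule log_space_representation)
      have "conv g \<in> Lp_space q ?M"
        using A(2)[of "conv g" "qnorm_kernel * pnorm g"] norm_conv_le[OF g(1)] qn pnorm_nonneg
          meas[OF continuous_on_subset[OF continuous_conv[OF g(1)]]] by auto
      then show ?thesis using g(2) by (auto simp: restricts_to_def)
    qed
    show "Lp_norm q ?M f \<le> (A * qnorm_kernel) * log_norm p s lam u"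
      if u: "u \<in> log_space p s lam" and f: "f \<in> Lp_space q ?M" "restricts_to \<Omega> u f" for u :: "'n distrib" and f
    proof -
      obtain g where g: "Lp_fun g" "pnorm g = log_norm p s lam u" "is_function u (conv g)"
        using u by (rule log_space_representation)
      have "AE x in ?M. norm (f x) \<le> qnorm_kernel * pnorm g"
        using ae[OF g(3) f(2)] by eventually_elim (simp add: norm_conv_le[OF g(1)])
      moreover have "f \<in> borel_measurable ?M" using f(1) by (simp add: Lp_space_def)
      ultimately show ?thesis
        using A(2)[of f "qnorm_kernel * pnorm g"] qn pnorm_nonneg[of g] by (simp add: g(2) mult.assoc)
    qed
    fix u :: "nat \<Rightarrow> 'n distrib" and f B
    assume u: "\<And>k. u k \<in> log_space p s lam" "\<And>k. log_norm p s lam (u k) \<le> B"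
      and f: "\<And>k. f k \<in> Lp_space q ?M" "\<And>k. restricts_to \<Omega> (u k) (f k)"
    obtain g where g: "\<And>k. Lp_fun (g k)" "\<And>k. pnorm (g k) \<le> B" "\<And>k. is_function (u k) (conv (g k))"
      by (rule log_space_bounded_sequence[of u B, OF u]) blast
    obtain r h where r: "strict_mono (r :: nat \<Rightarrow> nat)" "continuous_on (closure \<Omega>) h"
      "\<And>e. 0 < e \<Longrightarrow> \<exists>N. \<forall>k\<ge>N. \<forall>x\<in>closure \<Omega>. norm (conv (g (r k)) x - h x) < e"
      by (rule equicontinuous_subsequence[of "closure \<Omega>" g B, OF _ g(1,2)]) (use \<Omega>(1) in \<open>simp, blast\<close>)
    have hm: "h \<in> borel_measurable ?M" using continuous_on_subset[OF r(2) closure_subset] by (rule meas)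
    have "bounded (h ` closure \<Omega>)"
      using r(2) \<Omega>(1) by (intro compact_imp_bounded compact_continuous_image) auto
    then obtain c where c: "0 < c" "\<And>x. x \<in> closure \<Omega> \<Longrightarrow> norm (h x) \<le> c"
      unfolding bounded_pos by auto
    have "h \<in> Lp_space q ?M"
      using A(2)[OF hm, of c] c closure_subset[of \<Omega>] \<Omega>' by (auto simp: AE_restrict_space_iff intro!: AE_I2)
    moreover have "(\<lambda>k. Lp_norm q ?M (\<lambda>x. f (r k) x - h x)) \<longlonglongrightarrow> 0"
    proof (rule LIMSEQ_I)
      fix e :: real assume e: "0 < e"
      define d where "d = e / (2 * (A + 1))"
      have d: "0 < d" using e A(1) by (simp add: d_def)
      then obtain N where N: "\<And>k x. N \<le> k \<Longrightarrow> x \<in> closure \<Omega> \<Longrightarrow> norm (conv (g (r k)) x - h x) < d"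
        using r(3) by blast
      have "norm (Lp_norm q ?M (\<lambda>x. f (r k) x - h x) - 0) < e" if k: "N \<le> k" for k
      proof -
        have "f (r k) \<in> borel_measurable ?M" using f(1) by (auto simp: Lp_space_def)
        with hm have m: "(\<lambda>x. f (r k) x - h x) \<in> borel_measurable ?M" by (rule borel_measurable_diff[rotated])
        have "AE x in ?M. x \<in> \<Omega>" using \<Omega>' by (simp add: AE_restrict_space_iff)
        then have "AE x in ?M. norm (f (r k) x - h x) \<le> d"
          using ae[OF g(3) f(2), of "r k"]
          by eventually_elim (use N[OF k] closure_subset[of \<Omega>] in \<open>auto intro: less_imp_le\<close>)
        then have "Lp_norm q ?M (\<lambda>x. f (r k) x - h x) \<le> A * d" using A(2)[OF m] d by simp
        also have "A * d \<le> (A + 1) * d" using d by simp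
        also have "\<dots> = e / 2"
        proof -
          have "A + 1 \<noteq> 0" using A(1) by simp
          then show ?thesis by (simp add: d_def divide_simps)
        qed
        finally show ?thesis using e Lp_norm_nonneg[of q ?M "\<lambda>x. f (r k) x - h x"] by simp
      qed
      then show "\<exists>N. \<forall>k\<ge>N. norm (Lp_norm q ?M (\<lambda>x. f (r k) x - h x) - 0) < e" by blast
    qed
    ultimately show "\<exists>r g. strict_mono (r :: nat \<Rightarrow> nat) \<and> g \<in> Lp_space q ?M \<and> (\<lambda>k. Lp_norm q ?M (\<lambda>x. f (r k) x - g x)) \<longlonglongrightarrow> 0"
      using r(1) by blast
  qed
qed

end

section \<open>Radial functions and global compactness\<close>

definition radial :: "(real^'n::finite \<Rightarrow> complex) \<Rightarrow> bool" where
  "radial f \<longleftrightarrow> (\<forall>x y. norm x = norm y \<longrightarrow> f x = f y)"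

text \<open>
  Orthogonal maps preserve null sets, so \<open>v\<close> agrees almost everywhere, hence everywhere, with each of
  its rotations.
\<close>

lemma radial_if_AE_eq_radial:
  fixes v f :: "real^'n::finite \<Rightarrow> complex"
  assumes v: "continuous_on UNIV v" and f: "radial f" and ae: "AE x in lborel. v x = f x"
  shows "radial v"
  unfolding radial_def
proof (intro allI impI)
  fix x y :: "real^'n" assume "norm x = norm y"
  then obtain Q where Q: "orthogonal_transformation Q" "Q x = y"
    using orthogonal_transformation_exists by blast
  have lin: "linear Q" using Q(1) by (rule orthogonal_transformation_linear)
  obtain R where R: "orthogonal_transformation R" "\<And>z. R (Q z) = z"
    using orthogonal_transformation_inv[OF Q(1)] orthogonal_transformation_inj[OF Q(1)] by (metis inv_f_f)
  define N where "N = {z. v z \<noteq> f z}"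
  have "AE z in lebesgue. z \<notin> N" using ae by (simp add: N_def AE_completion_iff)
  then obtain N' where N': "N' \<in> null_sets lebesgue" "N \<subseteq> N'"
    unfolding eventually_ae_filter by auto
  then have "negligible N" using negligible_iff_null_sets negligible_subset by blast
  then have "negligible (R ` N)"
    using R(1) by (intro negligible_differentiable_image_negligible[OF order_refl] linear_imp_differentiable_on
        orthogonal_transformation_linear)
  then have "AE z in lebesgue. z \<notin> R ` N"
    unfolding negligible_iff_null_sets by (rule AE_not_in)
  then have "AE z in lborel. z \<notin> R ` N" by (simp only: AE_completion_iff)
  then have "AE z in lborel. v (Q z) = v z"
    using ae
  proof eventually_elim
    case (elim z)
    then have "Q z \<notin> N" using R(2)[of z] by (metis imageI)
    moreover have "f (Q z) = f z"
      using f orthogonal_transformation_norm[OF Q(1), of z] unfolding radial_def by blast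
    ultimately show ?case using elim by (simp add: N_def)
  qed
  then have "AE z in lborel. z \<in> UNIV \<longrightarrow> v (Q z) = v z" by simp
  moreover have "continuous_on UNIV (\<lambda>z. v (Q z))"
    using continuous_on_compose2[OF v linear_continuous_on[OF linear_conv_bounded_linear[THEN iffD1, OF lin]]] by simp
  ultimately have "v (Q x) = v x"
    using AE_eq_imp_eq_on_open[OF open_UNIV _ v] by blast
  then show "v x = v y" using Q(2) by simp
qed

text \<open>
  The points are taken on a circle in a coordinate plane, with first coordinates \<open>2 d j\<close>. This is where
  the dimension has to be at least 2.
\<close>

lemma separated_points_on_sphere:
  assumes "CARD('n::finite) \<ge> 2" and d: "0 \<le> d" and R: "2 * d * real N \<le> R"
  obtains P :: "nat \<Rightarrow> real^'n" where "\<And>j. j < N \<Longrightarrow> norm (P j) = R" "\<And>i j. i < N \<Longrightarrow> j < N \<Longrightarrow> i \<noteq> j \<Longrightarrow> 2 * d \<le> dist (P i) (P j)"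
proof -
  obtain S :: "'n set" where "card S = 2"
    using obtain_subset_with_card_n[OF assms(1)] by blast
  then obtain a b :: 'n where ab: "a \<noteq> b" unfolding card_2_iff by blast
  define c where "c j = 2 * d * real j" for j
  define P where "P j = axis a (c j) + axis b (sqrt (R\<^sup>2 - (c j)\<^sup>2))" for j
  have c: "0 \<le> c j" "c j \<le> R" if "j < N" for j
  proof -
    show "0 \<le> c j" using d by (simp add: c_def)
    have "c j \<le> 2 * d * real N" unfolding c_def using that d by (intro mult_left_mono) auto
    then show "c j \<le> R" using R by simp
  qed
  show ?thesis
  proof (rule that[of P])
    fix j assume j: "j < N"
    have "(c j)\<^sup>2 \<le> R\<^sup>2" using c[OF j] by (intro power_mono) auto
    moreover have "(norm (P j))\<^sup>2 = (c j)\<^sup>2 + (sqrt (R\<^sup>2 - (c j)\<^sup>2))\<^sup>2"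
      unfolding P_def power2_norm_eq_inner using ab
      by (simp add: inner_add_left inner_add_right inner_axis_axis power2_eq_square)
    ultimately have "(norm (P j))\<^sup>2 = R\<^sup>2" by simp
    then show "norm (P j) = R" using c[OF j] by (simp add: power2_eq_iff_nonneg)
  next
    fix i j assume ij: "i < N" "j < N" "i \<noteq> j"
    have "2 * d * 1 \<le> 2 * d * \<bar>real i - real j\<bar>"
      using d ij(3) by (intro mult_left_mono) (auto simp: abs_if)
    also have "\<dots> = \<bar>(P i - P j) $ a\<bar>"
      using d ab by (simp add: P_def c_def axis_def abs_mult flip: right_diff_distrib)
    also have "\<dots> \<le> norm (P i - P j)" by (rule component_le_norm_cart)
    finally show "2 * d \<le> dist (P i) (P j)" by (simp add: dist_norm)
  qed
qed

text \<open>
  If \<open>norm (v x) \<ge> e\<close>, then \<open>norm (v z) \<ge> e / 2\<close> on the balls of radius \<open>d\<close> about separated points of the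
  sphere through \<open>x\<close>. Their number grows with \<open>norm x\<close>, and \<open>W\<close> bounds it.
\<close>

lemma radial_uniform_decay:
  fixes e :: real
  assumes card: "CARD('n::finite) \<ge> 2" and p: "0 < p" and d: "0 < d" and e: "0 < e"
  obtains R where "\<And>v :: real^'n \<Rightarrow> complex. \<lbrakk>radial v; continuous_on UNIV v; integrable lborel (\<lambda>x. norm (v x) powr p);
      (LINT x|lborel. norm (v x) powr p) \<le> W; \<And>x y. norm (x - y) < d \<Longrightarrow> norm (v x - v y) < e / 2\<rbrakk>
      \<Longrightarrow> \<forall>x. R \<le> norm x \<longrightarrow> norm (v x) < e"
proof -
  let ?m = "measure lborel (ball (0::real^'n) d)"
  let ?w = "(e / 2) powr p"
  have m: "0 < ?m" using content_ball_pos[OF d, of "0::real^'n"] by simp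
  have w: "0 < ?w" using e by simp
  obtain N :: nat where N: "W / (?m * ?w) < real N" using reals_Archimedean2 by blast
  show ?thesis
  proof (rule that[of "2 * d * real N"], intro allI impI, rule ccontr)
    fix v :: "real^'n \<Rightarrow> complex" and x
    assume v: "radial v" "continuous_on UNIV v" "integrable lborel (\<lambda>x. norm (v x) powr p)"
      "(LINT x|lborel. norm (v x) powr p) \<le> W"
      and equi: "\<And>x y. norm (x - y) < d \<Longrightarrow> norm (v x - v y) < e / 2"
      and x: "2 * d * real N \<le> norm x" and "\<not> norm (v x) < e"
    then have vx: "e \<le> norm (v x)" by simp
    obtain P :: "nat \<Rightarrow> real^'n" where P: "\<And>j. j < N \<Longrightarrow> norm (P j) = norm x"
      "\<And>i j. i < N \<Longrightarrow> j < N \<Longrightarrow> i \<noteq> j \<Longrightarrow> 2 * d \<le> dist (P i) (P j)"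
      using separated_points_on_sphere[OF card less_imp_le[OF d] x] by blast
    have pointwise: "(\<Sum>j<N. ?w * indicator (ball (P j) d) z) \<le> norm (v z) powr p" for z
    proof (cases "\<exists>j<N. z \<in> ball (P j) d")
      case True
      then obtain j where j: "j < N" "z \<in> ball (P j) d" by blast
      have "z \<notin> ball (P i) d" if "i < N" "i \<noteq> j" for i
      proof
        assume "z \<in> ball (P i) d"
        then have "dist (P i) (P j) < d + d"
          using j(2) dist_triangle2[of "P i" "P j" z] by (simp add: dist_commute)
        then show False using P(2)[OF that(1) j(1) that(2)] by simp
      qed
      then have "(\<Sum>i<N. ?w * indicator (ball (P i) d) z) = (\<Sum>i<N. if i = j then ?w else 0)"
        using j by (intro sum.cong) (auto simp: indicator_def)
      also have "\<dots> = ?w" using j by simp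
      also have "\<dots> \<le> norm (v z) powr p"
      proof (rule powr_mono2)
        have "norm (v (P j) - v z) < e / 2" using j(2) by (intro equi) (simp add: dist_norm)
        moreover have "v (P j) = v x" using v(1) P(1)[OF j(1)] unfolding radial_def by blast
        ultimately show "e / 2 \<le> norm (v z)"
          using vx norm_triangle_ineq2[of "v x" "v z"] by simp
      qed (use p e in auto)
      finally show ?thesis .
    next
      case False
      then have zero: "(\<Sum>j<N. ?w * indicator (ball (P j) d) z) = 0" by (intro sum.neutral) auto
      show ?thesis unfolding zero by (rule powr_ge_zero)
    qed
    have intb: "integrable lborel (\<lambda>z. ?w * indicator (ball (P j) d) z :: real)" for j
      using emeasure_lborel_ball_finite[of "P j" d] by (intro integrable_mult_right integrable_real_indicator) auto
    have "real N * (?w * ?m) = (\<Sum>j<N. ?w * measure lborel (ball (P j) d))"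
      using d by (simp add: content_ball)
    also have "\<dots> = (LINT z|lborel. (\<Sum>j<N. ?w * indicator (ball (P j) d) z))"
      by (subst Bochner_Integration.integral_sum[OF intb]) simp
    also have "\<dots> \<le> (LINT z|lborel. norm (v z) powr p)"
      using intb v(3) pointwise by (intro integral_mono Bochner_Integration.integrable_sum) auto
    also have "\<dots> \<le> W" by (rule v(4))
    finally have "real N * (?w * ?m) \<le> W" .
    then show False using N m w by (simp add: divide_less_eq mult_ac)
  qed
qed

lemma interpolation_sup_Lp:
  fixes h :: "real^'n::finite \<Rightarrow> complex"
  assumes [measurable]: "h \<in> borel_measurable borel" and pq: "0 < p" "p < q" and c: "0 \<le> c" "\<And>x. norm (h x) \<le> c"
    and Lp: "integrable lborel (\<lambda>x. norm (h x) powr p)" "(LINT x|lborel. norm (h x) powr p) \<le> W"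
  shows "integrable lborel (\<lambda>x. norm (h x) powr q)" "(LINT x|lborel. norm (h x) powr q) \<le> c powr (q - p) * W"
proof -
  have le: "norm (h x) powr q \<le> c powr (q - p) * norm (h x) powr p" for x
  proof -
    have "norm (h x) powr q = norm (h x) powr (q - p) * norm (h x) powr p"
      by (simp flip: powr_add)
    also have "\<dots> \<le> c powr (q - p) * norm (h x) powr p"
      using c(2)[of x] pq by (intro mult_right_mono powr_mono2) auto
    finally show ?thesis .
  qed
  show int: "integrable lborel (\<lambda>x. norm (h x) powr q)"
    by (rule Bochner_Integration.integrable_bound[OF integrable_mult_right[OF Lp(1), of "c powr (q - p)"]])
      (use le in auto)
  have "(LINT x|lborel. norm (h x) powr q) \<le> (LINT x|lborel. c powr (q - p) * norm (h x) powr p)"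
    using int Lp(1) le by (intro integral_mono) auto
  also have "\<dots> \<le> c powr (q - p) * W" using Lp(2) by (simp add: mult_left_mono)
  finally show "(LINT x|lborel. norm (h x) powr q) \<le> c powr (q - p) * W" .
qed

lemma fatou_Lp:
  fixes v :: "nat \<Rightarrow> real^'n::finite \<Rightarrow> complex"
  assumes [measurable]: "\<And>k. v k \<in> borel_measurable borel" "h \<in> borel_measurable borel"
    and lim: "\<And>x. (\<lambda>k. v k x) \<longlonglongrightarrow> h x" and p: "0 < p"
    and Lp: "\<And>k. integrable lborel (\<lambda>x. norm (v k x) powr p)" "\<And>k. (LINT x|lborel. norm (v k x) powr p) \<le> W"
  shows "integrable lborel (\<lambda>x. norm (h x) powr p)" "(LINT x|lborel. norm (h x) powr p) \<le> W"
proof -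
  have W: "0 \<le> W" using Lp(2)[of 0] by (rule order_trans[rotated]) simp
  have "(\<integral>\<^sup>+x. ennreal (norm (h x) powr p) \<partial>lborel) = (\<integral>\<^sup>+x. liminf (\<lambda>k. ennreal (norm (v k x) powr p)) \<partial>lborel)"
  proof (rule nn_integral_cong)
    fix x
    have "(\<lambda>k. ennreal (norm (v k x) powr p)) \<longlonglongrightarrow> ennreal (norm (h x) powr p)"
      using p by (intro tendsto_ennrealI tendsto_powr2 tendsto_norm lim tendsto_const) auto
    then show "ennreal (norm (h x) powr p) = liminf (\<lambda>k. ennreal (norm (v k x) powr p))"
      by (intro lim_imp_Liminf[symmetric]) auto
  qed
  also have "\<dots> \<le> liminf (\<lambda>k. \<integral>\<^sup>+x. ennreal (norm (v k x) powr p) \<partial>lborel)"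
    by (rule nn_integral_liminf) measurable
  also have "\<dots> \<le> ennreal W"
  proof (rule Liminf_le)
    show "\<forall>\<^sub>F k in sequentially. (\<integral>\<^sup>+x. ennreal (norm (v k x) powr p) \<partial>lborel) \<le> ennreal W"
      using Lp by (intro always_eventually) (simp add: nn_integral_eq_integral ennreal_leI)
  qed simp
  finally have le: "(\<integral>\<^sup>+x. ennreal (norm (h x) powr p) \<partial>lborel) \<le> ennreal W" .
  then have "(\<integral>\<^sup>+x. ennreal (norm (h x) powr p) \<partial>lborel) < \<infinity>" by (rule le_less_trans) simp
  then show int: "integrable lborel (\<lambda>x. norm (h x) powr p)" by (intro integrableI_nonneg) auto
  show "(LINT x|lborel. norm (h x) powr p) \<le> W"
    using le W by (simp add: nn_integral_eq_integral[OF int])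
qed

context log_potential
begin

lemma log_space_rad_representation:
  assumes u: "u \<in> (log_space_rad p s lam :: 'n distrib set)"
  obtains g where "Lp_fun g" "pnorm g = log_norm p s lam u" "is_function u (conv g)" "radial (conv g)"
proof -
  obtain f where f: "is_function u f" "radial f"
    using u by (auto simp: log_space_rad_def radial_def)
  obtain g where g: "Lp_fun g" "pnorm g = log_norm p s lam u" "is_function u (conv g)"
    using u by (auto simp: log_space_rad_def elim: log_space_representation)
  have "radial (conv g)"
    using continuous_conv[OF g(1)] f(2) is_function_unique[OF g(3) f(1)] by (rule radial_if_AE_eq_radial)
  with g show ?thesis by (rule that)
qed

lemma pnorm_powr: "pnorm g powr p = (LINT x|lborel. norm (g x) powr p)"
  using p by (simp add: pnorm_def powr_powr integral_nonneg_AE)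

lemma uniform_decay_conv:
  assumes card: "CARD('n) \<ge> 2" and e: "0 < e"
  obtains R where "\<And>g x. Lp_fun g \<Longrightarrow> pnorm g \<le> B \<Longrightarrow> radial (conv g) \<Longrightarrow> R \<le> norm x \<Longrightarrow> norm (conv g x) < e"
proof -
  obtain C where C: "0 \<le> C" "\<And>g. Lp_fun g \<Longrightarrow> integrable lborel (\<lambda>x. norm (conv g x) powr p) \<and>
     (LINT x|lborel. norm (conv g x) powr p) \<le> C * (LINT x|lborel. norm (g x) powr p)"
    using young_inequality by blast
  obtain d where d: "0 < d" "\<And>g x y. Lp_fun g \<Longrightarrow> pnorm g \<le> B \<Longrightarrow> norm (x - y) < d \<Longrightarrow> norm (conv g x - conv g y) < e / 2"
    using equicontinuous_conv[of "e / 2" B] e by auto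
  obtain R where R: "\<And>v :: real^'n \<Rightarrow> complex. \<lbrakk>radial v; continuous_on UNIV v; integrable lborel (\<lambda>x. norm (v x) powr p);
      (LINT x|lborel. norm (v x) powr p) \<le> C * B powr p; \<And>x y. norm (x - y) < d \<Longrightarrow> norm (v x - v y) < e / 2\<rbrakk>
      \<Longrightarrow> \<forall>x. R \<le> norm x \<longrightarrow> norm (v x) < e"
    using radial_uniform_decay[OF card _ d(1) e, of p "C * B powr p"] p by auto
  have "norm (conv g x) < e" if g: "Lp_fun g" "pnorm g \<le> B" "radial (conv g)" "R \<le> norm x" for g x
  proof -
    have "(LINT x|lborel. norm (g x) powr p) \<le> B powr p"
      unfolding pnorm_powr[symmetric] using g(2) p pnorm_nonneg by (intro powr_mono2) auto
    then have "C * (LINT x|lborel. norm (g x) powr p) \<le> C * B powr p" using C(1) by (rule mult_left_mono)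
    with C(2)[OF g(1)] have "(LINT x|lborel. norm (conv g x) powr p) \<le> C * B powr p" by linarith
    then have "\<forall>x. R \<le> norm x \<longrightarrow> norm (conv g x) < e"
      using R[OF g(3) continuous_conv[OF g(1)]] C(2)[OF g(1)] d(2)[OF g(1,2)] by blast
    then show ?thesis using g(4) by blast
  qed
  then show ?thesis by (rule that)
qed

lemma conv_C0:
  assumes "CARD('n) \<ge> 2" "Lp_fun g" "radial (conv g)"
  shows "conv g \<in> C0_space"
proof -
  have "(conv g \<longlongrightarrow> 0) at_infinity"
    unfolding Lim_at_infinity
  proof (intro allI impI)
    fix e :: real assume "0 < e"
    then obtain R where "\<And>h x. Lp_fun h \<Longrightarrow> pnorm h \<le> pnorm g \<Longrightarrow> radial (conv h) \<Longrightarrow> R \<le> norm x \<Longrightarrow> norm (conv h x) < e"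
      using uniform_decay_conv[OF assms(1)] by blast
    then show "\<exists>b. \<forall>x. b \<le> norm x \<longrightarrow> dist (conv g x) 0 < e" using assms by (intro exI[of _ R]) auto
  qed
  then show ?thesis using continuous_conv[OF assms(2)] by (simp add: C0_space_def)
qed

text \<open>
  The diagonal of the subsequences from the balls \<open>cball 0 i\<close> converges locally uniformly. Uniform decay
  makes it Cauchy uniformly on the whole space.
\<close>

lemma radial_uniform_subsequence:
  assumes card: "CARD('n) \<ge> 2" and g: "\<And>k. Lp_fun (g k)" "\<And>k. pnorm (g k) \<le> B" "\<And>k. radial (conv (g k))"
  obtains r h where "strict_mono (r :: nat \<Rightarrow> nat)" "h \<in> C0_space"
    "\<And>e. 0 < e \<Longrightarrow> \<exists>N. \<forall>k\<ge>N. \<forall>x. norm (conv (g (r k)) x - h x) < e"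
proof -
  define P where "P i r \<longleftrightarrow> (\<forall>e>0. \<exists>N. \<forall>m\<ge>N. \<forall>n\<ge>N. \<forall>x\<in>cball 0 (real i). norm (conv (g (r m)) x - conv (g (r n)) x) < e)"
    for i :: nat and r :: "nat \<Rightarrow> nat"
  have sub: "\<exists>k. strict_mono (k :: nat \<Rightarrow> nat) \<and> P i (r \<circ> k)" for i r
  proof -
    obtain k h where k: "strict_mono (k :: nat \<Rightarrow> nat)"
      "\<And>e. 0 < e \<Longrightarrow> \<exists>N. \<forall>n\<ge>N. \<forall>x\<in>cball 0 (real i). norm (conv (g (r (k n))) x - h x) < e"
    proof (rule equicontinuous_subsequence[of "cball 0 (real i)" "\<lambda>n. g (r n)" B])
    qed (use g in auto)
    have "P i (r \<circ> k)"
      unfolding P_def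
    proof (intro allI impI)
      fix e :: real assume "0 < e"
      then obtain N where N: "\<And>n x. N \<le> n \<Longrightarrow> x \<in> cball 0 (real i) \<Longrightarrow> norm (conv (g (r (k n))) x - h x) < e / 2"
        using k(2)[OF half_gt_zero[OF \<open>0 < e\<close>]] by blast
      have "norm (conv (g (r (k m))) x - conv (g (r (k n))) x) < e" if "N \<le> m" "N \<le> n" "x \<in> cball 0 (real i)" for m n x
        using norm_diff_triangle_less[OF N[OF that(1,3)], of "conv (g (r (k n))) x" "e / 2"] N[OF that(2,3)]
        by (simp add: norm_minus_commute)
      then show "\<exists>N. \<forall>m\<ge>N. \<forall>n\<ge>N. \<forall>x\<in>cball 0 (real i). norm (conv (g ((r \<circ> k) m)) x - conv (g ((r \<circ> k) n)) x) < e"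
        by (intro exI[of _ N]) simp
    qed
    with k(1) show ?thesis by blast
  qed
  have P_P: "P i (r \<circ> k2)" if 1: "P i (r \<circ> k1)" and 2: "\<And>j. M \<le> j \<Longrightarrow> \<exists>j'. j \<le> j' \<and> k2 j = k1 j'"
    for i and r k1 k2 :: "nat \<Rightarrow> nat" and M
    unfolding P_def
  proof (intro allI impI)
    fix e :: real assume "0 < e"
    then obtain N where N: "\<And>m n x. N \<le> m \<Longrightarrow> N \<le> n \<Longrightarrow> x \<in> cball 0 (real i) \<Longrightarrow> norm (conv (g (r (k1 m))) x - conv (g (r (k1 n))) x) < e"
      using 1 unfolding P_def comp_def by blast
    have "norm (conv (g (r (k2 m))) x - conv (g (r (k2 n))) x) < e" if mn: "max M N \<le> m" "max M N \<le> n" "x \<in> cball 0 (real i)" for m n x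
    proof -
      obtain m' n' where "m \<le> m'" "k2 m = k1 m'" "n \<le> n'" "k2 n = k1 n'" using 2[of m] 2[of n] mn by auto
      then show ?thesis using N[of m' n' x] mn by simp
    qed
    then show "\<exists>N. \<forall>m\<ge>N. \<forall>n\<ge>N. \<forall>x\<in>cball 0 (real i). norm (conv (g ((r \<circ> k2) m)) x - conv (g ((r \<circ> k2) n)) x) < e"
      by (intro exI[of _ "max M N"]) simp
  qed
  obtain r where r: "strict_mono (r :: nat \<Rightarrow> nat)" "\<And>i. P i (id \<circ> r)"
    using subsequence_diagonalization_lemma[of P id] sub P_P by blast
  have "\<forall>e>0. \<exists>N. \<forall>m n x. N \<le> m \<and> N \<le> n \<and> True \<longrightarrow> dist (conv (g (r m)) x) (conv (g (r n)) x) < e"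
  proof (intro allI impI)
    fix e :: real assume e: "0 < e"
    then obtain R where R: "\<And>g x. Lp_fun g \<Longrightarrow> pnorm g \<le> B \<Longrightarrow> radial (conv g) \<Longrightarrow> R \<le> norm x \<Longrightarrow> norm (conv g x) < e / 2"
      using uniform_decay_conv[OF card half_gt_zero[OF e], of B] by blast
    obtain i :: nat where i: "R \<le> real i" using real_arch_simple by blast
    obtain N where N: "\<And>m n x. N \<le> m \<Longrightarrow> N \<le> n \<Longrightarrow> x \<in> cball 0 (real i) \<Longrightarrow> norm (conv (g (r m)) x - conv (g (r n)) x) < e"
      using r(2)[of i] e unfolding P_def id_comp by blast
    have "dist (conv (g (r m)) x) (conv (g (r n)) x) < e" if "N \<le> m" "N \<le> n" for m n x
    proof (cases "norm x \<le> real i")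
      case True
      then show ?thesis using N[OF that, of x] by (simp add: dist_norm)
    next
      case False
      then have "R \<le> norm x" using i by simp
      then have "norm (conv (g (r m)) x) < e / 2" "norm (conv (g (r n)) x) < e / 2" using R g by blast+
      then show ?thesis using norm_triangle_ineq4[of "conv (g (r m)) x" "conv (g (r n)) x"] by (simp add: dist_norm)
    qed
    then show "\<exists>N. \<forall>m n x. N \<le> m \<and> N \<le> n \<and> True \<longrightarrow> dist (conv (g (r m)) x) (conv (g (r n)) x) < e" by blast
  qed
  then obtain h where h: "\<And>e. 0 < e \<Longrightarrow> \<exists>N. \<forall>n x. N \<le> n \<longrightarrow> dist (conv (g (r n)) x) (h x) < e"
    unfolding uniformly_convergent_eq_cauchy[symmetric] by auto
  have unif: "uniform_limit UNIV (\<lambda>n. conv (g (r n))) h sequentially"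
    unfolding uniform_limit_sequentially_iff using h by blast
  have "continuous_on UNIV h"
    using unif by (rule uniform_limit_theorem[rotated]) (auto intro: always_eventually continuous_conv g)
  moreover have "(h \<longlongrightarrow> 0) at_infinity"
    unfolding Lim_at_infinity
  proof (intro allI impI)
    fix e :: real assume e: "0 < e"
    then obtain N where N: "\<And>n x. N \<le> n \<Longrightarrow> dist (conv (g (r n)) x) (h x) < e / 2" using h[OF half_gt_zero[OF e]] by blast
    have "(conv (g (r N)) \<longlongrightarrow> 0) at_infinity" using conv_C0[OF card g(1,3)] by (simp add: C0_space_def)
    then obtain b where b: "\<And>x. b \<le> norm x \<Longrightarrow> dist (conv (g (r N)) x) 0 < e / 2"
      unfolding Lim_at_infinity using e by (metis half_gt_zero)
    have "dist (h x) 0 < e" if "b \<le> norm x" for x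
      using b[OF that] N[of N x] dist_triangle_half_r[of "conv (g (r N)) x" "h x" e 0] by auto
    then show "\<exists>b. \<forall>x. b \<le> norm x \<longrightarrow> dist (h x) 0 < e" by blast
  qed
  ultimately have "h \<in> C0_space" by (simp add: C0_space_def)
  moreover have "\<exists>N. \<forall>k\<ge>N. \<forall>x. norm (conv (g (r k)) x - h x) < e" if "0 < e" for e
    using h[OF that] by (simp add: dist_norm)
  ultimately show ?thesis using r(1) by (intro that[of r h]) auto
qed

lemma log_space_rad_bounded_sequence:
  assumes "\<And>k. u k \<in> (log_space_rad p s lam :: 'n distrib set)" "\<And>k. log_norm p s lam (u k) \<le> B"
  obtains g where "\<And>k::nat. Lp_fun (g k)" "\<And>k. pnorm (g k) \<le> B" "\<And>k. is_function (u k) (conv (g k))"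
    "\<And>k. radial (conv (g k))"
proof -
  have "\<exists>g. Lp_fun g \<and> pnorm g \<le> B \<and> is_function (u k) (conv g) \<and> radial (conv g)" for k
    using log_space_rad_representation[OF assms(1)] assms(2) by metis
  then show ?thesis using that by metis
qed

theorem compact_embedding_C0:
  assumes card: "CARD('n) \<ge> 2"
  shows "compact_embedding (log_space_rad p s lam :: 'n distrib set) (log_norm p s lam) (restricts_to UNIV)
           C0_space (sup_norm UNIV)"
proof (rule compact_embeddingI)
  have eq: "f = conv g"
    if g: "Lp_fun g" "is_function u (conv g)" and f: "restricts_to UNIV u f" "f \<in> C0_space"
    for u :: "'n distrib" and f g
  proof
    fix x
    have "continuous_on UNIV f" using f by (simp add: C0_space_def)
    then show "f x = conv g x"
      using AE_eq_imp_eq_on_open[OF open_UNIV _ continuous_conv[OF g(1)] restricts_to_imp_AE[OF f(1) g(2)]] by blast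
  qed
  show "\<exists>f\<in>C0_space. restricts_to UNIV u f" if u: "u \<in> log_space_rad p s lam" for u :: "'n distrib"
  proof -
    obtain g where g: "Lp_fun g" "is_function u (conv g)" "radial (conv g)"
      using u by (rule log_space_rad_representation)
    have "restricts_to UNIV u (conv g)" using g(2) by (auto simp: restricts_to_def)
    then show ?thesis using conv_C0[OF card g(1,3)] by blast
  qed
  show "sup_norm UNIV f \<le> qnorm_kernel * log_norm p s lam u"
    if u: "u \<in> log_space_rad p s lam" and f: "f \<in> C0_space" "restricts_to UNIV u f" for u :: "'n distrib" and f
  proof -
    obtain g where g: "Lp_fun g" "pnorm g = log_norm p s lam u" "is_function u (conv g)" "radial (conv g)"
      using u by (rule log_space_rad_representation)
    show ?thesis
      unfolding eq[OF g(1,3) f(2,1)] g(2)[symmetric] using norm_conv_le[OF g(1)] by (intro sup_norm_le) auto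
  qed
  fix u :: "nat \<Rightarrow> 'n distrib" and f B
  assume u: "\<And>k. u k \<in> log_space_rad p s lam" "\<And>k. log_norm p s lam (u k) \<le> B"
    and f: "\<And>k. f k \<in> C0_space" "\<And>k. restricts_to UNIV (u k) (f k)"
  obtain g where g: "\<And>k. Lp_fun (g k)" "\<And>k. pnorm (g k) \<le> B" "\<And>k. is_function (u k) (conv (g k))"
    "\<And>k. radial (conv (g k))"
    by (rule log_space_rad_bounded_sequence[of u B, OF u]) blast
  obtain r h where r: "strict_mono (r :: nat \<Rightarrow> nat)" "h \<in> C0_space"
    "\<And>e. 0 < e \<Longrightarrow> \<exists>N. \<forall>k\<ge>N. \<forall>x. norm (conv (g (r k)) x - h x) < e"
    by (rule radial_uniform_subsequence[of g B, OF card g(1,2,4)]) blast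
  have "f k = conv (g k)" for k
    using eq[OF g(1,3) f(2,1)] .
  then have "(\<lambda>k. sup_norm UNIV (\<lambda>x. f (r k) x - h x)) \<longlonglongrightarrow> 0"
    using r(3) by (intro sup_norm_tendsto_0) auto
  with r(1,2) show "\<exists>r g. strict_mono (r :: nat \<Rightarrow> nat) \<and> g \<in> C0_space \<and> (\<lambda>k. sup_norm UNIV (\<lambda>x. f (r k) x - g x)) \<longlonglongrightarrow> 0"
    by blast
qed

end

text \<open>
  The bound for the norm in \<open>L^q\<close> of a function bounded by \<open>c\<close> with \<open>\<integral> |f| powr p \<le> W\<close>. Including \<open>q = \<infinity>\<close>
  allows all exponents to be treated at once.
\<close>

definition interpolation_bound :: "ennreal \<Rightarrow> real \<Rightarrow> real \<Rightarrow> real \<Rightarrow> real" where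
  "interpolation_bound q p c W =
     (if q = \<infinity> then c else (c powr (enn2real q - p) * W) powr (1 / enn2real q))"

lemma finite_exponent_cases:
  assumes "ennreal p < q" "0 < p"
  obtains "q = \<infinity>" | q' where "q = ennreal q'" "p < q'" "0 < q'" "enn2real q = q'" "q \<noteq> \<infinity>"
proof (cases q)
  case (real q')
  then have "p < q'" using assms by (simp add: ennreal_less_iff)
  then show ?thesis using real assms by (intro that(2)[of q']) auto
qed (use that in simp)

lemma interpolation_bound_scale:
  assumes q: "ennreal p < q" "0 < p" and pos: "0 \<le> a" "0 \<le> b" "0 \<le> N"
  shows "interpolation_bound q p (a * N) (b * N powr p) = interpolation_bound q p a b * N"
  using q
proof (cases rule: finite_exponent_cases)
  case (2 q')
  have eq: "(a * N) powr (q' - p) * (b * N powr p) = (a powr (q' - p) * b) * N powr q'"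
  proof -
    have "N powr q' = N powr (q' - p) * N powr p" by (simp flip: powr_add)
    then show ?thesis using pos by (simp add: powr_mult)
  qed
  have "((a * N) powr (q' - p) * (b * N powr p)) powr (1 / q') = (a powr (q' - p) * b) powr (1 / q') * N"
    unfolding eq using pos 2(3) by (simp add: powr_mult powr_powr)
  then show ?thesis using 2(4,5) by (simp add: interpolation_bound_def)
qed (simp add: interpolation_bound_def)

lemma interpolation_bound_small:
  assumes q: "ennreal p < q" "0 < p" and W: "0 \<le> W" and e: "0 < e"
  obtains c where "0 < c" "interpolation_bound q p c W < e"
proof -
  have "((\<lambda>c. interpolation_bound q p c W) \<longlongrightarrow> 0) (at_right 0)"
    using q
  proof (cases rule: finite_exponent_cases)
    case 1
    then show ?thesis by (simp add: interpolation_bound_def)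
  next
    case (2 q')
    have "((\<lambda>c::real. c) \<longlongrightarrow> 0) (at_right 0)" by (rule tendsto_ident_at)
    then have "((\<lambda>c::real. c powr (q' - p)) \<longlongrightarrow> 0 powr (q' - p)) (at_right 0)"
      using 2(2) eventually_at_right_less[of "0::real"]
      by (intro tendsto_powr2) (auto elim: eventually_mono)
    from tendsto_mult[OF this tendsto_const[of W]]
    have "((\<lambda>c::real. c powr (q' - p) * W) \<longlongrightarrow> 0) (at_right 0)" by simp
    then have "((\<lambda>c::real. (c powr (q' - p) * W) powr (1 / q')) \<longlongrightarrow> 0 powr (1 / q')) (at_right 0)"
      using 2(3) W by (intro tendsto_powr2) auto
    then show ?thesis using 2(4,5) by (simp add: interpolation_bound_def)
  qed
  then have "\<forall>\<^sub>F c in at_right 0. interpolation_bound q p c W < e \<and> 0 < c"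
    using e by (intro eventually_conj order_tendstoD(2) eventually_at_right_less) 
  then have "\<exists>c. interpolation_bound q p c W < e \<and> 0 < c"
    by (rule eventually_happens'[rotated]) simp
  then show ?thesis using that by blast
qed

lemma Lp_norm_le_interpolation_bound:
  fixes h f :: "real^'n::finite \<Rightarrow> complex"
  assumes q: "ennreal p < q" "0 < p"
    and [measurable]: "h \<in> borel_measurable borel" "f \<in> borel_measurable borel"
    and ae: "AE x in lborel. f x = h x" and c: "0 \<le> c" "\<And>x. norm (h x) \<le> c"
    and Lp: "integrable lborel (\<lambda>x. norm (h x) powr p)" "(LINT x|lborel. norm (h x) powr p) \<le> W"
  shows "f \<in> Lp_space q lborel" "Lp_norm q lborel f \<le> interpolation_bound q p c W"
proof -
  have "f \<in> Lp_space q lborel \<and> Lp_norm q lborel f \<le> interpolation_bound q p c W"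
    using q
  proof (cases rule: finite_exponent_cases)
    case 1
    have "AE x in lborel. norm (f x) \<le> c" using ae by eventually_elim (simp add: c)
    then show ?thesis
      using 1 c(1) Lp_infinity_bounded[of f lborel c] by (simp add: interpolation_bound_def)
  next
    case (2 q')
    have hq: "integrable lborel (\<lambda>x. norm (h x) powr q')" "(LINT x|lborel. norm (h x) powr q') \<le> c powr (q' - p) * W"
      by (rule interpolation_sup_Lp[OF _ q(2) 2(2) c Lp]; measurable)+
    have ae': "AE x in lborel. norm (f x) powr q' = norm (h x) powr q'"
      using ae by eventually_elim simp
    have fq: "integrable lborel (\<lambda>x. norm (f x) powr q')"
      using hq(1) by (subst integrable_cong_AE[OF _ _ ae']) auto
    have "(LINT x|lborel. norm (f x) powr q') = (LINT x|lborel. norm (h x) powr q')"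
      by (rule integral_cong_AE[OF _ _ ae']) auto
    then have "(LINT x|lborel. norm (f x) powr q') powr (1 / q') \<le> (c powr (q' - p) * W) powr (1 / q')"
      using hq(2) 2(3) by (intro powr_mono2) auto
    then show ?thesis using fq 2 by (simp add: Lp_space_def Lp_norm_def interpolation_bound_def)
  qed
  then show "f \<in> Lp_space q lborel" "Lp_norm q lborel f \<le> interpolation_bound q p c W" by auto
qed

context log_potential
begin

text \<open>
  The uniform limit \<open>h\<close> inherits the bound in \<open>L^p\<close> by Fatou's lemma, so the differences are bounded in
  \<open>L^p\<close> and small in the supremum norm.
\<close>

theorem compact_embedding_Lq_radial:
  assumes card: "CARD('n) \<ge> 2" and q: "ennreal p < q"
  shows "compact_embedding (log_space_rad p s lam :: 'n distrib set) (log_norm p s lam) (restricts_to UNIV)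
           (Lp_space q lborel) (Lp_norm q lborel)"
proof -
  have p0: "0 < p" using p by simp
  obtain C where C: "0 \<le> C" "\<And>g. Lp_fun g \<Longrightarrow> integrable lborel (\<lambda>x. norm (conv g x) powr p) \<and>
     (LINT x|lborel. norm (conv g x) powr p) \<le> C * (LINT x|lborel. norm (g x) powr p)"
    using young_inequality by blast
  have qn: "0 \<le> qnorm_kernel" by (simp add: qnorm_kernel_def)
  have conv_bound: "f \<in> Lp_space q lborel \<and> Lp_norm q lborel f \<le> interpolation_bound q p qnorm_kernel C * pnorm g"
    if g: "Lp_fun g" and f: "f \<in> borel_measurable borel" "AE x in lborel. f x = conv g x" for f g
  proof -
    have "integrable lborel (\<lambda>x. norm (conv g x) powr p)"
      "(LINT x|lborel. norm (conv g x) powr p) \<le> C * pnorm g powr p"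
      using C(2)[OF g] by (auto simp: pnorm_powr)
    from Lp_norm_le_interpolation_bound[OF q p0 conv_measurable[OF g] f _ norm_conv_le[OF g] this]
    show ?thesis
      using qn pnorm_nonneg[of g] C(1) by (simp add: interpolation_bound_scale[OF q p0])
  qed
  have ae: "AE x in lborel. f x = conv g x" if "is_function u (conv g)" "restricts_to UNIV u f" for u :: "'n distrib" and f g
    using restricts_to_imp_AE[OF that(2,1)] by simp
  show ?thesis
  proof (rule compact_embeddingI)
    show "\<exists>f\<in>Lp_space q lborel. restricts_to UNIV u f" if u: "u \<in> log_space_rad p s lam" for u :: "'n distrib"
    proof -
      obtain g where g: "Lp_fun g" "is_function u (conv g)" "radial (conv g)"
        using u by (rule log_space_rad_representation)
      have "restricts_to UNIV u (conv g)" using g(2) by (auto simp: restricts_to_def)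
      then show ?thesis using conv_bound[OF g(1) conv_measurable[OF g(1)]] by auto
    qed
    show "Lp_norm q lborel f \<le> interpolation_bound q p qnorm_kernel C * log_norm p s lam u"
      if u: "u \<in> log_space_rad p s lam" and f: "f \<in> Lp_space q lborel" "restricts_to UNIV u f" for u :: "'n distrib" and f
    proof -
      obtain g where g: "Lp_fun g" "pnorm g = log_norm p s lam u" "is_function u (conv g)" "radial (conv g)"
        using u by (rule log_space_rad_representation)
      have "f \<in> borel_measurable borel" using f(1) by (simp add: Lp_space_def)
      from conv_bound[OF g(1) this ae[OF g(3) f(2)]] show ?thesis by (simp add: g(2))
    qed
    fix u :: "nat \<Rightarrow> 'n distrib" and f B
    assume u: "\<And>k. u k \<in> log_space_rad p s lam" "\<And>k. log_norm p s lam (u k) \<le> B"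
      and f: "\<And>k. f k \<in> Lp_space q lborel" "\<And>k. restricts_to UNIV (u k) (f k)"
    obtain g where g: "\<And>k. Lp_fun (g k)" "\<And>k. pnorm (g k) \<le> B" "\<And>k. is_function (u k) (conv (g k))"
      "\<And>k. radial (conv (g k))"
      by (rule log_space_rad_bounded_sequence[of u B, OF u]) blast
    obtain r h where r: "strict_mono (r :: nat \<Rightarrow> nat)" "h \<in> C0_space"
      "\<And>e. 0 < e \<Longrightarrow> \<exists>N. \<forall>k\<ge>N. \<forall>x. norm (conv (g (r k)) x - h x) < e"
      by (rule radial_uniform_subsequence[of g B, OF card g(1,2,4)]) blast
    have B0: "0 \<le> B" using order_trans[OF pnorm_nonneg g(2)] .
    define W where "W = C * B powr p"
    define v where "v k = conv (g (r k))" for k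
    have vm: "v k \<in> borel_measurable borel" for k unfolding v_def by (rule conv_measurable[OF g(1)])
    have hm: "h \<in> borel_measurable borel" using r(2) unfolding C0_space_def by (auto intro: borel_measurable_continuous_onI)
    have v: "integrable lborel (\<lambda>x. norm (v k x) powr p)" "(LINT x|lborel. norm (v k x) powr p) \<le> W" for k
    proof -
      note Ck = C(2)[OF g(1)[of "r k"]]
      show "integrable lborel (\<lambda>x. norm (v k x) powr p)" using Ck by (simp add: v_def)
      have "(LINT x|lborel. norm (g (r k) x) powr p) \<le> B powr p"
        unfolding pnorm_powr[symmetric] using g(2) p pnorm_nonneg by (intro powr_mono2) auto
      then have "C * (LINT x|lborel. norm (g (r k) x) powr p) \<le> W"
        unfolding W_def using C(1) by (rule mult_left_mono)
      with Ck show "(LINT x|lborel. norm (v k x) powr p) \<le> W" unfolding v_def by linarith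
    qed
    have lim: "(\<lambda>k. v k x) \<longlonglongrightarrow> h x" for x
    proof (rule LIMSEQ_I)
      fix e :: real assume "0 < e"
      then show "\<exists>N. \<forall>k\<ge>N. norm (v k x - h x) < e" using r(3)[of e] unfolding v_def by blast
    qed
    have h: "integrable lborel (\<lambda>x. norm (h x) powr p)" "(LINT x|lborel. norm (h x) powr p) \<le> W"
      by (rule fatou_Lp[OF vm hm lim p0 v])+
    have dm: "(\<lambda>x. v k x - h x) \<in> borel_measurable borel" for k using vm hm by measurable
    have dle: "norm (v k x - h x) powr p \<le> 2 powr p * (norm (v k x) powr p + norm (h x) powr p)" for k x
    proof -
      have "norm (v k x - h x) powr p \<le> (norm (v k x) + norm (h x)) powr p"
        using p by (intro powr_mono2 norm_triangle_ineq4) auto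
      also have "\<dots> \<le> 2 powr p * (norm (v k x) powr p + norm (h x) powr p)"
        using p by (intro powr_add_le) auto
      finally show ?thesis .
    qed
    have d: "integrable lborel (\<lambda>x. norm (v k x - h x) powr p)" "(LINT x|lborel. norm (v k x - h x) powr p) \<le> 2 powr p * (W + W)" for k
    proof -
      have int: "integrable lborel (\<lambda>x. 2 powr p * (norm (v k x) powr p + norm (h x) powr p))"
        using v(1) h(1) by (intro integrable_mult_right Bochner_Integration.integrable_add)
      show dint: "integrable lborel (\<lambda>x. norm (v k x - h x) powr p)"
        by (rule Bochner_Integration.integrable_bound[OF int])
          (use dle dm[of k] in \<open>auto intro: order_trans[OF _ abs_ge_self]\<close>)
      have "(LINT x|lborel. norm (v k x - h x) powr p) \<le> (LINT x|lborel. 2 powr p * (norm (v k x) powr p + norm (h x) powr p))"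
        using dint int dle by (rule integral_mono)
      also have "\<dots> = 2 powr p * ((LINT x|lborel. norm (v k x) powr p) + (LINT x|lborel. norm (h x) powr p))"
        using v(1) h(1) by simp
      also have "\<dots> \<le> 2 powr p * (W + W)" using v(2) h(2) by (intro mult_left_mono add_mono) auto
      finally show "(LINT x|lborel. norm (v k x - h x) powr p) \<le> 2 powr p * (W + W)" .
    qed
    have hb: "norm (h x) \<le> qnorm_kernel * B" for x
    proof (rule tendsto_upperbound[OF tendsto_norm[OF lim]])
      have "norm (v k x) \<le> qnorm_kernel * B" for k
        using norm_conv_le[OF g(1), of "r k" x] mult_left_mono[OF g(2)[of "r k"] qn] unfolding v_def by linarith
      then show "\<forall>\<^sub>F k in sequentially. norm (v k x) \<le> qnorm_kernel * B" by simp
    qed simp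
    have "h \<in> Lp_space q lborel"
      using Lp_norm_le_interpolation_bound(1)[OF q p0 hm hm _ _ hb h] qn B0 by simp
    moreover have "(\<lambda>k. Lp_norm q lborel (\<lambda>x. f (r k) x - h x)) \<longlonglongrightarrow> 0"
    proof (rule LIMSEQ_I)
      fix e :: real assume "0 < e"
      then obtain c where c: "0 < c" "interpolation_bound q p c (2 powr p * (W + W)) < e"
        using interpolation_bound_small[OF q p0, of "2 powr p * (W + W)"] C(1) by (auto simp: W_def)
      obtain N where N: "\<And>k x. N \<le> k \<Longrightarrow> norm (v k x - h x) < c" using r(3)[OF c(1)] unfolding v_def by blast
      have "norm (Lp_norm q lborel (\<lambda>x. f (r k) x - h x) - 0) < e" if k: "N \<le> k" for k
      proof -
        have fm: "f (r k) \<in> borel_measurable borel" using f(1) by (auto simp: Lp_space_def)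
        have fh: "(\<lambda>x. f (r k) x - h x) \<in> borel_measurable borel" using fm hm by measurable
        have "AE x in lborel. f (r k) x = v k x" unfolding v_def by (rule ae[OF g(3) f(2)])
        then have aefh: "AE x in lborel. f (r k) x - h x = v k x - h x" by eventually_elim simp
        have "Lp_norm q lborel (\<lambda>x. f (r k) x - h x) \<le> interpolation_bound q p c (2 powr p * (W + W))"
          by (rule Lp_norm_le_interpolation_bound(2)[OF q p0 dm fh aefh less_imp_le[OF c(1)] less_imp_le[OF N[OF k]] d])
        with c(2) show ?thesis using Lp_norm_nonneg[of q lborel "\<lambda>x. f (r k) x - h x"] by simp
      qed
      then show "\<exists>N. \<forall>k\<ge>N. norm (Lp_norm q lborel (\<lambda>x. f (r k) x - h x) - 0) < e" by blast
    qed
    ultimately show "\<exists>r g. strict_mono (r :: nat \<Rightarrow> nat) \<and> g \<in> Lp_space q lborel \<and> (\<lambda>k. Lp_norm q lborel (\<lambda>x. f (r k) x - g x)) \<longlonglongrightarrow> 0"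
      using r(1) by blast
  qed
qed

end

section \<open>The embedding theorem\<close>

theorem theorem1p15:
  fixes s p lam :: real
  assumes "0 < s" and "1 < p" and "1 < lam"
  shows "(\<forall>\<Omega> :: (real^'n::finite) set.
            bounded \<Omega> \<and> lipschitz_domain \<Omega> \<and> real CARD('n) = 2 * s * p \<longrightarrow>
            compact_embedding (log_space p s lam) (log_norm p s lam) (restricts_to \<Omega>)
              (cont_space (closure \<Omega>)) (sup_norm (closure \<Omega>)) \<and>
            (\<forall>q::ennreal. 1 \<le> q \<longrightarrow>
              compact_embedding (log_space p s lam) (log_norm p s lam) (restricts_to \<Omega>)
                (Lp_space q (restrict_space lborel \<Omega>)) (Lp_norm q (restrict_space lborel \<Omega>)))) \<and>
         (CARD('n) \<ge> 2 \<and> real CARD('n) = 2 * s * p \<longrightarrow>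
            compact_embedding (log_space_rad p s lam :: 'n distrib set) (log_norm p s lam)
              (restricts_to UNIV) C0_space (sup_norm UNIV) \<and>
            (\<forall>q::ennreal. ennreal p < q \<longrightarrow>
              compact_embedding (log_space_rad p s lam :: 'n distrib set) (log_norm p s lam)
                (restricts_to UNIV) (Lp_space q lborel) (Lp_norm q lborel)))"
proof (intro conjI allI impI)
  fix \<Omega> :: "(real^'n) set"
  assume \<Omega>: "bounded \<Omega> \<and> lipschitz_domain \<Omega> \<and> real CARD('n) = 2 * s * p"
  then interpret log_potential s p lam "TYPE('n)" using assms by unfold_locales auto
  from \<Omega> have "bounded \<Omega>" "open \<Omega>" "\<Omega> \<noteq> {}" by (auto simp: lipschitz_domain_def)
  then show "compact_embedding (log_space p s lam) (log_norm p s lam) (restricts_to \<Omega>)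
              (cont_space (closure \<Omega>)) (sup_norm (closure \<Omega>))"
    by (rule compact_embedding_continuous)
  fix q :: ennreal assume "1 \<le> q"
  with \<open>bounded \<Omega>\<close> \<open>open \<Omega>\<close>
  show "compact_embedding (log_space p s lam) (log_norm p s lam) (restricts_to \<Omega>)
                (Lp_space q (restrict_space lborel \<Omega>)) (Lp_norm q (restrict_space lborel \<Omega>))"
    by (rule compact_embedding_Lq_bounded)
next
  assume n: "CARD('n) \<ge> 2 \<and> real CARD('n) = 2 * s * p"
  then interpret log_potential s p lam "TYPE('n)" using assms by unfold_locales auto
  show "compact_embedding (log_space_rad p s lam :: 'n distrib set) (log_norm p s lam)
              (restricts_to UNIV) C0_space (sup_norm UNIV)"
    using n by (intro compact_embedding_C0) simp
  fix q :: ennreal assume "ennreal p < q"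
  then show "compact_embedding (log_space_rad p s lam :: 'n distrib set) (log_norm p s lam)
                (restricts_to UNIV) (Lp_space q lborel) (Lp_norm q lborel)"
    using n by (intro compact_embedding_Lq_radial) auto
qed

end
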